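(* Let $m=p+q$, write $\mathbb R^m=\mathbb R^p\oplus\mathbb R^q$, $x=u+v$ with $u\in\mathbb R^p$, $v\in\mathbb R^q$, and let $n\in\mathbb N$. The decomposition $$\mathcal H_n(\mathbb R^m)=\bigoplus_{2s+k+i=n}\tau_H\big(|u|^{2s}\mathcal H_k(\mathbb R^p)\otimes\mathcal H_i(\mathbb R^q)\big)$$ (sum over all $s,k,i\in\mathbb N$ with $2s+k+i=n$) is multiplicity free under the action of $\mathrm{SO}(p)\times\mathrm{SO}(q)$.
   Context: $\mathbb N=\{0,1,2,\dots\}$. $\mathcal P(\mathbb R^d)$ is the space of complex-valued polynomials on $\mathbb R^d$, $\mathcal H(\mathbb R^d)$ its subspace of harmonic polynomials and $\mathcal H_k(\mathbb R^d)$ the space of harmonic polynomials homogeneous of degree $k$. $P_H:\mathcal P(\mathbb R^m)\to\mathcal H(\mathbb R^m)$ is the harmonic projection, i.e. the projection onto the $s=0$ summand of the (Fischer) decomposition $\mathcal P(\mathbb R^m)=\bigoplus_{s\ge0}|x|^{2s}\mathcal H(\mathbb R^m)$. The map $\tau_H:\mathcal P(\mathbb R^p)\otimes\mathcal H(\mathbb R^q)\to\mathcal H(\mathbb R^m)$ is the linear map with $\tau_H(K\otimes G)=P_H(K(u)G(v))$. Rotation groups act on polynomials by $(g\cdot P)(x)=P(g^{-1}x)$, and $\mathrm{SO}(p)\times\mathrm{SO}(q)$ is embedded block-diagonally in $\mathrm{SO}(m)$.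
   Formalization: Here p, q ≥ 1 and p + q ≥ 3. For p = q = 1 the group SO(1)×SO(1) is trivial while, for n ≥ 1, two of the summands are nonzero lines (for n = 1 spanned by u and v), hence equivalent, so the decomposition is not multiplicity free there. *)

theory Defs
  imports "HOL-Analysis.Analysis" "HOL-Library.Function_Algebras"
begin

section \<open>Spaces of complex-valued functions\<close>

definition cscale :: "complex \<Rightarrow> ('a \<Rightarrow> complex) \<Rightarrow> 'a \<Rightarrow> complex"
  where "cscale c f = (\<lambda>x. c * f x)"

global_interpretation cfun: vector_space cscale
  by unfold_locales (auto simp: cscale_def algebra_simps fun_eq_iff)

text \<open>\<open>V\<close> is the internal direct sum of the finite family \<open>(U i)\<^sub>i\<close>.
  Some of the \<open>U i\<close> may be zero.\<close>

definition direct_sum :: "('a \<Rightarrow> complex) set \<Rightarrow> 'i set \<Rightarrow> ('i \<Rightarrow> ('a \<Rightarrow> complex) set) \<Rightarrow> bool"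
  where "direct_sum V I U \<longleftrightarrow>
    finite I \<and>
    (\<forall>i\<in>I. cfun.subspace (U i)) \<and>
    V = {(\<Sum>i\<in>I. f i) |f. \<forall>i\<in>I. f i \<in> U i} \<and>
    (\<forall>f. (\<forall>i\<in>I. f i \<in> U i) \<and> (\<Sum>i\<in>I. f i) = 0 \<longrightarrow> (\<forall>i\<in>I. f i = 0))"

text \<open>The algebraic tensor product of function spaces \<open>A\<close> and \<open>B\<close>, realised inside the
  functions on the product through the canonical embedding
  \<open>K \<otimes> G \<mapsto> ((u, v) \<mapsto> K u * G v)\<close>, which is injective.\<close>

definition tensor_space ::
    "('a \<Rightarrow> complex) set \<Rightarrow> ('b \<Rightarrow> complex) set \<Rightarrow> ('a \<times> 'b \<Rightarrow> complex) set"
  where "tensor_space A B = cfun.span {(\<lambda>(u, v). K u * G v) |K G. K \<in> A \<and> G \<in> B}"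


section \<open>Harmonic polynomials\<close>

definition laplacian :: "('a::euclidean_space \<Rightarrow> complex) \<Rightarrow> 'a \<Rightarrow> complex"
  where "laplacian f x =
    (\<Sum>b\<in>Basis. frechet_derivative (\<lambda>y. frechet_derivative f (at y) b) (at x) b)"

definition harmonic_polys :: "('a::euclidean_space \<Rightarrow> complex) set"
  where "harmonic_polys = {f. polynomial_function f \<and> (\<forall>x. laplacian f x = 0)}"

definition harmonic_homogeneous :: "nat \<Rightarrow> ('a::euclidean_space \<Rightarrow> complex) set"
  where "harmonic_homogeneous k =
    {f \<in> harmonic_polys. \<forall>c x. f (c *\<^sub>R x) = of_real c ^ k * f x}"

definition norm_power_mult :: "nat \<Rightarrow> ('a::euclidean_space \<Rightarrow> complex) \<Rightarrow> 'a \<Rightarrow> complex"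
  where "norm_power_mult s f = (\<lambda>x. of_real (norm x ^ (2 * s)) * f x)"

text \<open>The component with \<open>s = 0\<close> of a polynomial in the Fischer decomposition. For polynomials
  \<open>f\<close> the description is well defined, since the polynomials are the direct sum of the spaces
  \<open>norm_power_mult s ` harmonic_polys\<close>; elsewhere the value is arbitrary.\<close>

definition harmonic_projection :: "('a::euclidean_space \<Rightarrow> complex) \<Rightarrow> 'a \<Rightarrow> complex"
  where "harmonic_projection f =
    (THE h. \<exists>N g. (\<forall>s\<le>N. g s \<in> harmonic_polys) \<and>
                  f = (\<Sum>s\<le>N. norm_power_mult s (g s)) \<and> h = g 0)"

text \<open>As \<open>K \<otimes> G\<close> is identified with \<open>K u * G v\<close>, the linear map determined by
  \<open>K \<otimes> G \<mapsto> harmonic_projection (K u * G v)\<close> is the harmonic projection on the sum of the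
  two Euclidean spaces; it is meant to be applied to elements of tensor products.\<close>

definition tau_H ::
    "('a::euclidean_space \<times> 'b::euclidean_space \<Rightarrow> complex) \<Rightarrow> 'a \<times> 'b \<Rightarrow> complex"
  where "tau_H F = harmonic_projection F"


section \<open>Representations on function spaces\<close>

definition subrepresentation ::
    "'g set \<Rightarrow> ('g \<Rightarrow> ('a \<Rightarrow> complex) \<Rightarrow> 'a \<Rightarrow> complex) \<Rightarrow> ('a \<Rightarrow> complex) set \<Rightarrow> bool"
  where "subrepresentation G \<rho> W \<longleftrightarrow> cfun.subspace W \<and> (\<forall>g\<in>G. \<forall>f\<in>W. \<rho> g f \<in> W)"

definition irreducible_subrep ::
    "'g set \<Rightarrow> ('g \<Rightarrow> ('a \<Rightarrow> complex) \<Rightarrow> 'a \<Rightarrow> complex) \<Rightarrow> ('a \<Rightarrow> complex) set \<Rightarrow> bool"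
  where "irreducible_subrep G \<rho> W \<longleftrightarrow>
    subrepresentation G \<rho> W \<and> W \<noteq> {0} \<and>
    (\<forall>U. subrepresentation G \<rho> U \<and> U \<subseteq> W \<longrightarrow> U = {0} \<or> U = W)"

definition equivalent_subreps ::
    "'g set \<Rightarrow> ('g \<Rightarrow> ('a \<Rightarrow> complex) \<Rightarrow> 'a \<Rightarrow> complex) \<Rightarrow>
      ('a \<Rightarrow> complex) set \<Rightarrow> ('a \<Rightarrow> complex) set \<Rightarrow> bool"
  where "equivalent_subreps G \<rho> W W' \<longleftrightarrow>
    (\<exists>\<phi>. bij_betw \<phi> W W' \<and>
         (\<forall>f\<in>W. \<forall>f'\<in>W. \<phi> (f + f') = \<phi> f + \<phi> f') \<and>
         (\<forall>c. \<forall>f\<in>W. \<phi> (cscale c f) = cscale c (\<phi> f)) \<and>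
         (\<forall>g\<in>G. \<forall>f\<in>W. \<phi> (\<rho> g f) = \<rho> g (\<phi> f)))"

text \<open>A decomposition of \<open>V\<close> into subrepresentations \<open>U i\<close> is multiplicity free if the
  irreducible constituents of all the \<open>U i\<close> taken together are pairwise inequivalent. The
  \<open>U i\<close> are not required to be irreducible themselves, because the harmonic polynomials of
  degree \<open>k > 0\<close> on the plane split into two inequivalent characters of the rotation group.\<close>

definition multiplicity_free_decomposition ::
    "'g set \<Rightarrow> ('g \<Rightarrow> ('a \<Rightarrow> complex) \<Rightarrow> 'a \<Rightarrow> complex) \<Rightarrow>
      ('a \<Rightarrow> complex) set \<Rightarrow> 'i set \<Rightarrow> ('i \<Rightarrow> ('a \<Rightarrow> complex) set) \<Rightarrow> bool"
  where "multiplicity_free_decomposition G \<rho> V I U \<longleftrightarrow>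
    direct_sum V I U \<and>
    (\<forall>i\<in>I. subrepresentation G \<rho> (U i)) \<and>
    (\<exists>(N :: 'i \<Rightarrow> nat) W.
      (\<forall>i\<in>I. direct_sum (U i) {..<N i} (W i) \<and> (\<forall>j<N i. irreducible_subrep G \<rho> (W i j))) \<and>
      (\<forall>i\<in>I. \<forall>i'\<in>I. \<forall>j<N i. \<forall>j'<N i'.
         (i, j) \<noteq> (i', j') \<longrightarrow> \<not> equivalent_subreps G \<rho> (W i j) (W i' j')))"

definition SO :: "(real^'n^'n) set"
  where "SO = {A. rotation_matrix A}"

text \<open>\<open>(g \<cdot> P)(x) = P(g\<^sup>-\<^sup>1 x)\<close> for the block-diagonal \<open>g\<close> with blocks \<open>A\<close> and \<open>B\<close>.\<close>

definition block_action ::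
    "(real^'p^'p) \<times> (real^'q^'q) \<Rightarrow> ((real^'p) \<times> (real^'q) \<Rightarrow> complex) \<Rightarrow>
      (real^'p) \<times> (real^'q) \<Rightarrow> complex"
  where "block_action = (\<lambda>(A, B) P (u, v). P (matrix_inv A *v u, matrix_inv B *v v))"

end

theory Submission
  imports Defs
begin

text \<open>
  Write \<open>N\<close> for the square of the norm. If \<open>h\<close> is harmonic and homogeneous then the Laplacian maps
  \<open>N\<^sup>s\<^sup>+\<^sup>1 h\<close> to a positive multiple of \<open>N\<^sup>s h\<close>; this yields existence and uniqueness of the Fischer
  decomposition. As \<open>\<bar>v\<bar>\<^sup>2 = N - \<bar>u\<bar>\<^sup>2\<close>, every polynomial is modulo \<open>N\<close> a sum of terms
  \<open>\<bar>u\<bar>\<^sup>2\<^sup>s K(u) G(v)\<close> with harmonic \<open>K\<close> and \<open>G\<close>; such a sum is harmonic in \<open>v\<close> and hence vanishes if it is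
  divisible by \<open>N\<close>. This gives the direct sum.

  For the constituents, let \<open>C\<close> be an invariant space of homogeneous polynomials in which functions are
  determined by their values on the orbit of a point \<open>x0\<close> and in which the functions fixed by the
  stabiliser of \<open>x0\<close> form at most a line. By Riesz representation with respect to an invariant inner
  product, every functional on \<open>C\<close> invariant under the stabiliser is a multiple of the evaluation at
  \<open>x0\<close>. Applied to the orthogonal projection on an invariant subspace this shows that \<open>C\<close> is
  irreducible; applied to an equivalence with another such space it shows that the two spaces contain
  nonzero functions which agree on the orbit. On a product of spheres this forces the degrees, and
  then the spaces, to coincide.
\<close>

section \<open>Polynomial functions and directional derivatives\<close>

text \<open>The hypothesis on the dimensions excludes exactly \<open>p = q = 1\<close>: both groups
  are then trivial, and for n at least 1 the harmonic polynomials of degree n form a two-dimensional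
  space on which they act trivially. Low dimensions also shape the rest. On the line the orbit of a
  point is that point alone and carries no information about the degree; but harmonic degrees are at
  most 1 there, and 2s + k + i = n recovers such a degree from its parity once the other one is
  known. In the plane stabilisers are trivial, so the harmonic polynomials of positive degree have
  too many fixed functions and are first cut into two lines. From dimension 3 on the fixed functions
  are the zonal harmonics. The constituents are found and compared inside the tensor products, where
  a function can be frozen in one variable; the harmonic projection, injective and equivariant
  there, carries them over afterwards. The inner product is algebraic, built from derivatives at the
  origin, so its properties follow by induction on the degree.\<close>

definition coord :: "'a::euclidean_space \<Rightarrow> 'a \<Rightarrow> complex"
  where "coord b = (\<lambda>x. of_real (x \<bullet> b))"

definition pd :: "'a::euclidean_space \<Rightarrow> ('a \<Rightarrow> complex) \<Rightarrow> 'a \<Rightarrow> complex"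
  where "pd b f = (\<lambda>x. frechet_derivative f (at x) b)"

lemma cscale_apply: "cscale c f x = c * f x"
  by (simp add: cscale_def)

lemma sum_fun_apply: "(\<Sum>i\<in>I. f i) x = (\<Sum>i\<in>I. f i x)" for f :: "'i \<Rightarrow> 'a \<Rightarrow> complex"
  by (induction I rule: infinite_finite_induct) auto

lemma power_fun_apply: "(f ^ n) x = f x ^ n" for f :: "'a \<Rightarrow> complex"
  by (induction n) auto

text \<open>Rule instances found by unification are often eta-expanded, and the pointwise equations
  would then rewrite inside functions; hence they are applied on demand only.\<close>

lemmas fapply = cscale_apply sum_fun_apply power_fun_apply plus_fun_apply zero_fun_apply
  times_fun_apply one_fun_apply minus_apply uminus_apply

declare plus_fun_apply [simp del] zero_fun_apply [simp del] times_fun_apply [simp del]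
  one_fun_apply [simp del] minus_apply [simp del] uminus_apply [simp del]

lemma cscale_mult_left: "cscale c f * g = cscale c (f * g)"
  by (simp add: fun_eq_iff fapply)

lemma cscale_mult_right: "f * cscale c g = cscale c (f * g)"
  by (simp add: fun_eq_iff fapply)

lemma polynomial_function_times:
  fixes f g :: "'a::euclidean_space \<Rightarrow> complex"
  assumes "polynomial_function f" "polynomial_function g"
  shows "polynomial_function (f * g)"
proof -
  have "real_polynomial_function (\<lambda>x. Re (f x))" "real_polynomial_function (\<lambda>x. Im (f x))"
       "real_polynomial_function (\<lambda>x. Re (g x))" "real_polynomial_function (\<lambda>x. Im (g x))"
    using assms bounded_linear_Re bounded_linear_Im
    unfolding polynomial_function_def o_def by blast+
  then have 1: "real_polynomial_function (\<lambda>x. Re (f x) * Re (g x) - Im (f x) * Im (g x))"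
    and 2: "real_polynomial_function (\<lambda>x. Re (f x) * Im (g x) + Im (f x) * Re (g x))"
    by (auto intro!: real_polynomial_function_diff)
  have "(f * g) = (\<lambda>x. (Re (f x) * Re (g x) - Im (f x) * Im (g x)) *\<^sub>R 1 +
                  (Re (f x) * Im (g x) + Im (f x) * Re (g x)) *\<^sub>R \<i>)"
    by (auto simp: fun_eq_iff fapply complex_eq_iff)
  then show ?thesis
    using 1 2 by (auto simp: real_polynomial_function_eq intro!: polynomial_function_add polynomial_function_mult)
qed

lemma polynomial_function_plus:
  "polynomial_function f \<Longrightarrow> polynomial_function g \<Longrightarrow> polynomial_function (f + g)"
  by (simp add: plus_fun_def polynomial_function_add)

lemma polynomial_function_fun_const: "polynomial_function (0 :: 'a::euclidean_space \<Rightarrow> complex)"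
  "polynomial_function (1 :: 'a::euclidean_space \<Rightarrow> complex)"
  by (auto simp: zero_fun_def one_fun_def)

lemma polynomial_function_cscale:
  "polynomial_function (f :: 'a::euclidean_space \<Rightarrow> complex) \<Longrightarrow> polynomial_function (cscale c f)"
  using polynomial_function_times[of "\<lambda>_. c" f] by (auto simp: cscale_def times_fun_def)

lemma polynomial_function_minus':
  "polynomial_function (f :: 'a::euclidean_space \<Rightarrow> complex) \<Longrightarrow> polynomial_function g \<Longrightarrow>
    polynomial_function (f - g)"
  using polynomial_function_diff[of f g] by (simp add: fun_diff_def)

lemma polynomial_function_fun_sum:
  "(\<And>i. i \<in> I \<Longrightarrow> polynomial_function (f i :: 'a::euclidean_space \<Rightarrow> complex)) \<Longrightarrow>
    polynomial_function (\<Sum>i\<in>I. f i)"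
  by (induction I rule: infinite_finite_induct)
     (auto intro: polynomial_function_fun_const polynomial_function_plus)

lemma polynomial_function_power:
  "polynomial_function (f :: 'a::euclidean_space \<Rightarrow> complex) \<Longrightarrow> polynomial_function (f ^ n)"
  by (induction n) (auto intro: polynomial_function_fun_const polynomial_function_times)

lemma polynomial_function_coord: "polynomial_function (coord b)"
  unfolding coord_def
  by (intro polynomial_function_bounded_linear bounded_linear_compose[OF bounded_linear_of_real]
      bounded_linear_inner_left)

lemmas poly_intros = polynomial_function_times polynomial_function_plus
  polynomial_function_fun_const polynomial_function_cscale polynomial_function_minus'
  polynomial_function_fun_sum polynomial_function_power polynomial_function_coord

subsection \<open>Homogeneous polynomials\<close>

text \<open>Homogeneous polynomials are treated as functions throughout, without coefficient
  families. Building monomials one coordinate at a time yields the induction rule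
  \<open>hpoly_induct\<close>.\<close>

fun hmonos :: "nat \<Rightarrow> ('a::euclidean_space \<Rightarrow> complex) set" where
  "hmonos 0 = {1}"
| "hmonos (Suc k) = {coord b * m |b m. b \<in> Basis \<and> m \<in> hmonos k}"

definition hpoly :: "nat \<Rightarrow> ('a::euclidean_space \<Rightarrow> complex) set"
  where "hpoly k = cfun.span (hmonos k)"

lemma finite_hmonos: "finite (hmonos k)"
proof (induction k)
  case (Suc k)
  have "hmonos (Suc k) = (\<lambda>(b, m). coord b * m) ` (Basis \<times> (hmonos k :: ('a \<Rightarrow> complex) set))"
    by auto
  then show ?case using Suc by simp
qed simp

lemma subspace_hpoly: "cfun.subspace (hpoly k)"
  by (simp add: hpoly_def)

lemma hpoly_0: "1 \<in> hpoly 0"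
  by (simp add: hpoly_def cfun.span_base)

lemma hpoly_add: "f \<in> hpoly k \<Longrightarrow> g \<in> hpoly k \<Longrightarrow> f + g \<in> hpoly k"
  and hpoly_cscale: "f \<in> hpoly k \<Longrightarrow> cscale c f \<in> hpoly k"
  and hpoly_zero: "0 \<in> hpoly k"
  and hpoly_diff: "f \<in> hpoly k \<Longrightarrow> g \<in> hpoly k \<Longrightarrow> f - g \<in> hpoly k"
  and hpoly_sum: "(\<And>i. i \<in> I \<Longrightarrow> F i \<in> hpoly k) \<Longrightarrow> sum F I \<in> hpoly k"
  by (simp_all add: hpoly_def cfun.span_add cfun.span_scale cfun.span_zero cfun.span_diff cfun.span_sum)

lemma hpoly_Basis_mult:
  assumes "b \<in> Basis" "f \<in> hpoly k"
  shows "coord b * f \<in> hpoly (Suc k)"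
  using assms(2) unfolding hpoly_def
proof (induction rule: cfun.span_induct_alt)
  case base
  then show ?case by (simp add: cfun.span_zero)
next
  case (step c x y)
  have "coord b * (cscale c x + y) = cscale c (coord b * x) + coord b * y"
    by (simp add: algebra_simps fun_eq_iff fapply)
  moreover have "coord b * x \<in> hmonos (Suc k)" using step assms by auto
  ultimately show ?case
    using step by (simp del: hmonos.simps add: cfun.span_add cfun.span_scale cfun.span_base)
qed

text \<open>The monomials use basis directions only. Coordinates in other directions occur later,
  such as the one along the base point of an orbit.\<close>

lemma hpoly_coord_mult:
  assumes "f \<in> hpoly k"
  shows "coord c * f \<in> hpoly (Suc k)"
proof -
  have "coord c * f = (\<Sum>b\<in>Basis. cscale (of_real (c \<bullet> b)) (coord b * f))"
  proof
    fix x
    have "coord c x = (\<Sum>b\<in>Basis. of_real (c \<bullet> b) * coord b x)"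
      unfolding coord_def by (subst euclidean_inner) (simp add: mult.commute)
    then show "(coord c * f) x = (\<Sum>b\<in>Basis. cscale (of_real (c \<bullet> b)) (coord b * f)) x"
      by (simp add: sum_distrib_right mult.assoc fapply)
  qed
  then show ?thesis
    using hpoly_Basis_mult[OF _ assms] by (auto intro!: hpoly_sum hpoly_cscale)
qed

lemma hpoly_induct [consumes 1, case_names one mult add zero cscale]:
  assumes "f \<in> hpoly k"
    and "P 0 1"
    and mult: "\<And>k b f. b \<in> Basis \<Longrightarrow> f \<in> hpoly k \<Longrightarrow> P k f \<Longrightarrow> P (Suc k) (coord b * f)"
    and add: "\<And>k f g. f \<in> hpoly k \<Longrightarrow> g \<in> hpoly k \<Longrightarrow> P k f \<Longrightarrow> P k g \<Longrightarrow> P k (f + g)"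
    and zero: "\<And>k. P k 0"
    and cscale: "\<And>k f c. f \<in> hpoly k \<Longrightarrow> P k f \<Longrightarrow> P k (cscale c f)"
  shows "P k f"
proof -
  have mono: "P k m" if "m \<in> hmonos k" for m
    using that
  proof (induction k arbitrary: m)
    case (Suc k)
    then show ?case by (auto intro!: mult simp: hpoly_def cfun.span_base)
  qed (use assms in auto)
  have "f \<in> cfun.span (hmonos k)" using assms(1) by (simp add: hpoly_def)
  \<comment> \<open>Membership is carried along because the cases \<open>add\<close> and
    \<open>cscale\<close> require it of their summands.\<close>
  then have "f \<in> hpoly k \<and> P k f"
  proof (induction rule: cfun.span_induct_alt)
    case (step c x y)
    then have "x \<in> hpoly k" by (simp add: hpoly_def cfun.span_base)
    with step mono[of x] show ?case by (auto intro!: add cscale hpoly_add hpoly_cscale)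
  qed (simp add: zero hpoly_zero)
  then show ?thesis by simp
qed

lemma hpoly_mult:
  assumes "f \<in> hpoly j" "g \<in> hpoly k"
  shows "f * g \<in> hpoly (j + k)"
  using assms
proof (induction rule: hpoly_induct)
  case (add k' f g')
  then show ?case by (simp add: hpoly_add distrib_right)
next
  case (mult k' b f)
  then show ?case using hpoly_coord_mult[of "f * g" _ b] by (simp add: mult.assoc)
qed (auto simp: cscale_mult_left intro: hpoly_cscale hpoly_zero)

lemma hpoly_coord: "coord b \<in> hpoly 1"
  using hpoly_coord_mult[OF hpoly_0, of b] by simp

lemma hpoly_power: "f \<in> hpoly j \<Longrightarrow> f ^ n \<in> hpoly (n * j)"
  by (induction n) (auto simp: hpoly_0 intro: hpoly_mult)

lemma polynomial_hpoly: "f \<in> hpoly k \<Longrightarrow> polynomial_function f"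
  by (induction rule: hpoly_induct) (auto intro: poly_intros)

lemma hpoly_scaleR:
  assumes "f \<in> hpoly k"
  shows "f (c *\<^sub>R x) = of_real c ^ k * f x"
  using assms by (induction rule: hpoly_induct) (auto simp: coord_def fapply algebra_simps)

lemma hpoly_0_const: "f \<in> hpoly 0 \<Longrightarrow> f x = f y"
  using hpoly_scaleR[of f 0 0 x] hpoly_scaleR[of f 0 0 y] by simp

text \<open>Real and imaginary parts of the coefficients belong to real polynomials in
  \<open>t\<close> that vanish identically. Homogeneous components are compared by means of this:
  restrict to a ray and read off coefficients.\<close>

lemma complex_polyfun_eq_0:
  fixes c :: "nat \<Rightarrow> complex"
  assumes "\<And>t::real. (\<Sum>k\<le>N. of_real t ^ k * c k) = 0" "k \<le> N"
  shows "c k = 0"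
proof -
  have "(\<Sum>k\<le>N. Re (c k) * t ^ k) = 0" "(\<Sum>k\<le>N. Im (c k) * t ^ k) = 0" for t
    using arg_cong[OF assms(1)[of t], of Re] arg_cong[OF assms(1)[of t], of Im]
    by (simp_all flip: of_real_power add: mult.commute)
  then have "Re (c k) = 0 \<and> Im (c k) = 0"
    using polyfun_eq_0[of "\<lambda>k. Re (c k)" N] polyfun_eq_0[of "\<lambda>k. Im (c k)" N] assms(2) by auto
  then show ?thesis by (simp add: complex_eq_iff)
qed

text \<open>Evaluate at \<open>t *\<^sub>R x\<close> and take the coefficient of the power
  \<open>m\<close> of \<open>t\<close>. Several indices may have the same degree, so that sums over
  pairs or triples can be split by total degree.\<close>

lemma hpoly_graded:
  fixes F :: "'i \<Rightarrow> 'a::euclidean_space \<Rightarrow> complex"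
  assumes "finite I" "\<And>i. i \<in> I \<Longrightarrow> F i \<in> hpoly (d i)" "(\<Sum>i\<in>I. F i) = 0"
  shows "(\<Sum>i\<in>{i\<in>I. d i = m}. F i) = 0"
proof
  fix x
  \<comment> \<open>Inserting \<open>m\<close> keeps the set nonempty and lets the bound cover a
    degree that no index has.\<close>
  define N where "N = Max (insert m (d ` I))"
  have N: "d i \<le> N" if "i \<in> I" for i
    unfolding N_def using assms(1) that by (intro Max_ge) auto
  have mN: "m \<le> N"
    unfolding N_def using assms(1) by (intro Max_ge) auto
  have "(\<Sum>k\<le>N. of_real t ^ k * (\<Sum>i\<in>{i\<in>I. d i = k}. F i x)) = 0" for t :: real
  proof -
    have "(\<Sum>k\<le>N. of_real t ^ k * (\<Sum>i\<in>{i\<in>I. d i = k}. F i x)) =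
      (\<Sum>k\<le>N. (\<Sum>i\<in>{i\<in>I. d i = k}. F i (t *\<^sub>R x)))"
      unfolding sum_distrib_left
      using hpoly_scaleR[OF assms(2)] by (intro sum.cong) auto
    also have "\<dots> = (\<Sum>i\<in>I. F i (t *\<^sub>R x))"
      using N by (subst sum.group) (use assms(1) in auto)
    also have "\<dots> = (\<Sum>i\<in>I. F i) (t *\<^sub>R x)" by (simp add: fapply)
    also have "\<dots> = 0" using assms(3) by (simp add: fapply)
    finally show ?thesis .
  qed
  from complex_polyfun_eq_0[where c = "\<lambda>k. \<Sum>i\<in>{i\<in>I. d i = k}. F i x", OF this mN]
  show "(\<Sum>i\<in>{i\<in>I. d i = m}. F i) x = 0 x" by (simp add: fapply)
qed

section \<open>Polynomial functions as finite sums of homogeneous ones\<close>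

definition polys :: "('a::euclidean_space \<Rightarrow> complex) set"
  where "polys = cfun.span (\<Union>k. hmonos k)"

lemma hpoly_polys: "f \<in> hpoly k \<Longrightarrow> f \<in> polys"
  unfolding hpoly_def polys_def by (rule set_mp[OF cfun.span_mono]) auto

lemma polys_mult:
  assumes "f \<in> polys" "g \<in> polys"
  shows "f * g \<in> polys"
proof -
  have *: "m * g \<in> polys" if m: "m \<in> (\<Union>k. hmonos k)" for m
    using assms(2) unfolding polys_def
  proof (induction rule: cfun.span_induct_alt)
    case (step c x y)
    have eq: "m * (cscale c x + y) = cscale c (m * x) + m * y"
      by (simp add: algebra_simps fun_eq_iff fapply)
    obtain j k where "m \<in> hmonos j" "x \<in> hmonos k" using m step(1) by blast
    then have "m \<in> hpoly j" "x \<in> hpoly k" by (simp_all add: hpoly_def cfun.span_base)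
    then have "m * x \<in> polys" by (rule hpoly_polys[OF hpoly_mult])
    then show ?case
      using step unfolding eq
      by (auto intro!: cfun.span_add cfun.span_scale simp: polys_def)
  qed (simp add: cfun.span_zero)
  show ?thesis
    using assms(1) unfolding polys_def
  proof (induction rule: cfun.span_induct_alt)
    case (step c x y)
    have "(cscale c x + y) * g = cscale c (x * g) + y * g"
      by (simp add: algebra_simps fun_eq_iff fapply)
    then show ?case
      using step * by (auto intro!: cfun.span_add cfun.span_scale simp: polys_def)
  qed (simp add: cfun.span_zero)
qed

lemma real_polynomial_polys:
  "real_polynomial_function f \<Longrightarrow> (\<lambda>x. of_real (f x)) \<in> polys"
proof (induction rule: real_polynomial_function.induct)
  case (linear f)
  have f_eq: "f x = (\<Sum>b\<in>Basis. (x \<bullet> b) * f b)" for x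
  proof -
    note f = bounded_linear.linear[OF linear]
    have "f x = f (\<Sum>b\<in>Basis. (x \<bullet> b) *\<^sub>R b)" by (simp add: euclidean_representation)
    also have "\<dots> = (\<Sum>b\<in>Basis. f ((x \<bullet> b) *\<^sub>R b))" by (rule linear_sum[OF f])
    finally show ?thesis by (simp add: linear_cmul[OF f])
  qed
  have "(\<lambda>x. of_real (f x)) = (\<Sum>b\<in>Basis. cscale (of_real (f b)) (coord b))"
    by (rule ext, subst f_eq) (simp add: fapply coord_def mult.commute)
  then show ?case
    using hpoly_polys[OF hpoly_coord] by (auto simp: polys_def intro!: cfun.span_sum cfun.span_scale)
next
  case (const c)
  have "(\<lambda>x. of_real c) = cscale (of_real c) (1 :: 'a \<Rightarrow> complex)"
    by (auto simp: fun_eq_iff fapply)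
  then show ?case
    using hpoly_polys[OF hpoly_0] by (auto simp: polys_def intro!: cfun.span_scale)
next
  case (add f g)
  have "(\<lambda>x. of_real (f x + g x)) = (\<lambda>x. of_real (f x)) + (\<lambda>x. of_real (g x) :: complex)"
    by (auto simp: fun_eq_iff fapply)
  then show ?case using add by (auto simp: polys_def intro!: cfun.span_add)
next
  case (mult f g)
  have "(\<lambda>x. of_real (f x * g x)) = (\<lambda>x. of_real (f x)) * (\<lambda>x. of_real (g x) :: complex)"
    by (auto simp: fun_eq_iff fapply)
  then show ?case using mult polys_mult by auto
qed

lemma polynomial_polys:
  fixes f :: "'a::euclidean_space \<Rightarrow> complex"
  assumes "polynomial_function f"
  shows "f \<in> polys"
proof -
  have "real_polynomial_function (\<lambda>x. Re (f x))" "real_polynomial_function (\<lambda>x. Im (f x))"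
    using assms bounded_linear_Re bounded_linear_Im
    unfolding polynomial_function_def o_def by blast+
  moreover have "f = (\<lambda>x. of_real (Re (f x))) + cscale \<i> (\<lambda>x. of_real (Im (f x)))"
    by (auto simp: fun_eq_iff fapply complex_eq_iff)
  ultimately show ?thesis
    using real_polynomial_polys unfolding polys_def
    by (metis cfun.span_add cfun.span_scale)
qed

lemma polys_decompose:
  assumes "f \<in> polys"
  shows "\<exists>N F. (\<forall>k. F k \<in> hpoly k) \<and> f = (\<Sum>k\<le>N. F k)"
  using assms unfolding polys_def
proof (induction rule: cfun.span_induct_alt)
  case base
  show ?case by (rule exI[of _ 0], rule exI[of _ "\<lambda>_. 0"]) (simp add: hpoly_zero)
next
  case (step c m f)
  then obtain N F j where F: "\<And>k. F k \<in> hpoly k" "f = (\<Sum>k\<le>N. F k)" and m: "m \<in> hmonos j"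
    by auto
  define G where "G k = (if k \<le> N then F k else 0) + (if k = j then cscale c m else 0)" for k
  have "m \<in> hpoly j" using m by (simp add: hpoly_def cfun.span_base)
  then have "G k \<in> hpoly k" for k
    using F by (auto simp: G_def intro!: hpoly_add hpoly_cscale hpoly_zero)
  moreover have "cscale c m + f = (\<Sum>k\<le>max N j. G k)"
  proof -
    have "(\<Sum>k\<le>max N j. if k \<le> N then F k else 0) = (\<Sum>k\<le>N. F k)"
      by (rule sum.mono_neutral_cong_right) auto
    then show ?thesis
      unfolding G_def sum.distrib F(2) by (simp add: add.commute)
  qed
  ultimately show ?case by blast
qed

lemma polynomial_decompose:
  fixes f :: "'a::euclidean_space \<Rightarrow> complex"
  assumes "polynomial_function f"
  obtains N F where "\<And>k. F k \<in> hpoly k" "f = (\<Sum>k\<le>N. F k)"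
  using polys_decompose[OF polynomial_polys[OF assms]] by blast

text \<open>This links homogeneity by scaling, as used in \<open>harmonic_homogeneous\<close>, with
  the span of monomials: along each ray only the coefficient of the power \<open>k\<close> can
  survive.\<close>

lemma polynomial_homogeneous_hpoly:
  fixes f :: "'a::euclidean_space \<Rightarrow> complex"
  assumes "polynomial_function f" and hom: "\<And>c x. f (c *\<^sub>R x) = of_real c ^ k * f x"
  shows "f \<in> hpoly k"
proof -
  obtain N F where F: "\<And>k. F k \<in> hpoly k" "f = (\<Sum>k\<le>N. F k)"
    using polynomial_decompose[OF assms(1)] by metis
  \<comment> \<open>The length \<open>N\<close> of the decomposition may be smaller than
    \<open>k\<close>; the component of degree \<open>k\<close> is then zero.\<close>
  define M where "M = max N k"
  define F' where "F' j = (if j \<le> N then F j else 0)" for j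
  have "f = (\<Sum>k\<le>M. F' k)"
    unfolding F(2) F'_def M_def by (rule sum.mono_neutral_cong_left) auto
  have F': "F' j \<in> hpoly j" for j using F by (auto simp: F'_def hpoly_zero)
  have "f x = F' k x" for x
  proof -
    have "(\<Sum>j\<le>M. of_real t ^ j * (F' j x - (if j = k then f x else 0))) = 0" for t :: real
    proof -
      have "(\<Sum>j\<le>M. of_real t ^ j * (F' j x - (if j = k then f x else 0))) =
        (\<Sum>j\<le>M. F' j (t *\<^sub>R x)) - (\<Sum>j\<le>M. if j = k then of_real t ^ k * f x else 0)"
        unfolding sum_subtractf[symmetric]
        by (intro sum.cong) (auto simp: hpoly_scaleR[OF F'] algebra_simps)
      also have "(\<Sum>j\<le>M. F' j (t *\<^sub>R x)) = f (t *\<^sub>R x)"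
        by (simp add: \<open>f = (\<Sum>k\<le>M. F' k)\<close> fapply)
      also have "(\<Sum>j\<le>M. if j = k then of_real t ^ k * f x else 0) = of_real t ^ k * f x"
        by (simp add: M_def)
      finally show ?thesis by (simp add: hom)
    qed
    from complex_polyfun_eq_0[OF this, of k] show ?thesis by (simp add: M_def)
  qed
  then have "f = F' k" by auto
  then show ?thesis using F' by simp
qed

subsection \<open>Derivatives of polynomials\<close>

lemma polynomial_has_derivative:
  "polynomial_function f \<Longrightarrow> (f has_derivative (\<lambda>b. pd b f x)) (at x)"
  unfolding pd_def
  using differentiable_at_polynomial_function[of f x UNIV]
  by (simp add: frechet_derivative_works)

lemma pdI: "(f has_derivative D) (at x) \<Longrightarrow> pd b f x = D b"
  unfolding pd_def using frechet_derivative_at by metis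

lemma pd_add:
  assumes "polynomial_function f" "polynomial_function g"
  shows "pd b (f + g) = pd b f + pd b g"
proof
  fix x
  have "((f + g) has_derivative (\<lambda>b. pd b f x + pd b g x)) (at x)"
    unfolding plus_fun_def
    by (rule has_derivative_add; rule polynomial_has_derivative; fact)
  then show "pd b (f + g) x = (pd b f + pd b g) x" by (simp add: pdI fapply)
qed

lemma pd_times:
  assumes "polynomial_function f" "polynomial_function g"
  shows "pd b (f * g) = pd b f * g + f * pd b g"
proof
  fix x
  have "((f * g) has_derivative (\<lambda>b. f x * pd b g x + pd b f x * g x)) (at x)"
    unfolding times_fun_def
    by (rule has_derivative_mult; rule polynomial_has_derivative; fact)
  then show "pd b (f * g) x = (pd b f * g + f * pd b g) x" by (simp add: pdI fapply)
qed

lemma pd_const: "pd b (\<lambda>x. c) = 0"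
  by (simp add: pd_def fun_eq_iff fapply)

lemma pd_one [simp]: "pd b 1 = 0" and pd_zero [simp]: "pd b 0 = 0"
  by (simp_all add: zero_fun_def one_fun_def pd_def)

lemma pd_cscale:
  assumes "polynomial_function (f :: 'a::euclidean_space \<Rightarrow> complex)"
  shows "pd b (cscale c f) = cscale c (pd b f)"
proof -
  have "cscale c g = (\<lambda>x. c) * g" for g :: "'a \<Rightarrow> complex" by (simp add: fun_eq_iff fapply)
  then show ?thesis
    using pd_times[of "\<lambda>x. c" f b] assms by (simp add: pd_const)
qed

lemma pd_coord [simp]: "pd b (coord c) = cscale (of_real (b \<bullet> c)) 1"
proof
  fix x
  have "((\<lambda>x. complex_of_real (x \<bullet> c)) has_derivative (\<lambda>b. of_real (b \<bullet> c))) (at x)"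
    by (intro bounded_linear_imp_has_derivative bounded_linear_compose[OF bounded_linear_of_real]
        bounded_linear_inner_left)
  then show "pd b (coord c) x = cscale (of_real (b \<bullet> c)) 1 x"
    by (simp add: pdI coord_def fapply)
qed

text \<open>Truncated subtraction leaves degree 0 at degree 0. The second conjunct repairs this: in
  the product rule \<open>coord c * pd b f\<close> would otherwise have degree 1 when
  \<open>f\<close> is constant.\<close>

lemma pd_hpoly: "f \<in> hpoly k \<Longrightarrow> pd b f \<in> hpoly (k - 1) \<and> (k = 0 \<longrightarrow> pd b f = 0)"
proof (induction rule: hpoly_induct)
  case (mult k c f)
  have "coord c * pd b f \<in> hpoly k"
    using mult hpoly_coord_mult[of "pd b f" "k - 1" c] by (cases k) (auto simp: hpoly_zero)
  with mult show ?case
    by (auto simp: pd_times polynomial_function_coord polynomial_hpoly cscale_mult_left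
        intro!: hpoly_add hpoly_cscale)
qed (auto simp: hpoly_zero pd_add polynomial_hpoly pd_cscale intro: hpoly_add hpoly_cscale)

lemma pd_hpoly_Suc: "f \<in> hpoly (Suc k) \<Longrightarrow> pd b f \<in> hpoly k"
  using pd_hpoly[of f "Suc k" b] by simp

lemma pd_sum:
  assumes "\<And>i. i \<in> I \<Longrightarrow> polynomial_function (F i)"
  shows "pd b (\<Sum>i\<in>I. F i) = (\<Sum>i\<in>I. pd b (F i :: 'a::euclidean_space \<Rightarrow> complex))"
  using assms
  by (induction I rule: infinite_finite_induct) (auto simp: pd_add polynomial_function_fun_sum)

lemma polynomial_pd:
  assumes "polynomial_function (f :: 'a::euclidean_space \<Rightarrow> complex)"
  shows "polynomial_function (pd b f)"
proof -
  obtain N F where F: "\<And>k. F k \<in> hpoly k" "f = (\<Sum>k\<le>N. F k)"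
    using polynomial_decompose[OF assms] by metis
  have "pd b f = (\<Sum>k\<le>N. pd b (F k))"
    unfolding F(2) using F(1) polynomial_hpoly by (intro pd_sum) blast
  then show ?thesis
    using pd_hpoly[OF F(1)] polynomial_hpoly by (auto intro!: polynomial_function_fun_sum)
qed

lemma polynomial_induct [consumes 1, case_names hpoly add]:
  assumes "polynomial_function (f :: 'a::euclidean_space \<Rightarrow> complex)"
    and "\<And>k f. f \<in> hpoly k \<Longrightarrow> P f"
    and "\<And>f g. polynomial_function f \<Longrightarrow> polynomial_function g \<Longrightarrow> P f \<Longrightarrow> P g \<Longrightarrow> P (f + g)"
  shows "P f"
proof -
  obtain N F where F: "\<And>k. F k \<in> hpoly k" "f = (\<Sum>k\<le>N. F k)"
    using polynomial_decompose[OF assms(1)] by metis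
  have "polynomial_function (\<Sum>k\<le>N. F k) \<and> P (\<Sum>k\<le>N. F k)" for N
  proof (induction N)
    case (Suc N)
    moreover have "polynomial_function (F (Suc N))" using F polynomial_hpoly by blast
    ultimately show ?case using assms(2)[OF F(1), of "Suc N"] assms(3)
      by (auto intro: polynomial_function_plus)
  next
    case 0
    show ?case using assms(2)[OF F(1), of 0] polynomial_hpoly[OF F(1)] by simp
  qed
  then show ?thesis by (simp add: F(2))
qed

lemma pd_direction_add:
  "polynomial_function f \<Longrightarrow> pd (a + b) f = pd a f + pd b f"
  unfolding fun_eq_iff fapply
  using linear_add[OF has_derivative_linear[OF polynomial_has_derivative]] by fastforce

lemma pd_direction_scaleR:
  "polynomial_function f \<Longrightarrow> pd (r *\<^sub>R b) f = cscale (of_real r) (pd b f)"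
  unfolding fun_eq_iff fapply
  using linear_cmul[OF has_derivative_linear[OF polynomial_has_derivative]]
  by (fastforce simp: scaleR_conv_of_real)

lemma pd_compose:
  assumes "polynomial_function f" "linear g"
  shows "pd b (f \<circ> g) = pd (g b) f \<circ> g"
proof
  fix x
  have "(g has_derivative g) (at x)"
    using assms(2) by (simp add: linear_imp_has_derivative)
  then have "(f \<circ> g has_derivative ((\<lambda>b. pd b f (g x)) \<circ> g)) (at x)"
    using polynomial_has_derivative[OF assms(1)] by (rule diff_chain_at)
  then show "pd b (f \<circ> g) x = (pd (g b) f \<circ> g) x"
    by (simp add: pdI)
qed

lemma polynomial_compose_linear:
  assumes "polynomial_function (f :: 'b::euclidean_space \<Rightarrow> complex)"
    "linear (g :: 'a::euclidean_space \<Rightarrow> 'b)"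
  shows "polynomial_function (f \<circ> g)"
  using assms(1) polynomial_function_bounded_linear[of g] assms(2)
    polynomial_function_compose[of g f] linear_conv_bounded_linear by blast

lemma hpoly_compose_linear:
  assumes "f \<in> hpoly k" "linear (g :: 'a::euclidean_space \<Rightarrow> 'b::euclidean_space)"
  shows "f \<circ> g \<in> hpoly k"
  using assms polynomial_compose_linear[OF polynomial_hpoly[OF assms(1)] assms(2)]
  by (intro polynomial_homogeneous_hpoly) (auto simp: linear_cmul hpoly_scaleR)

lemma euler:
  assumes "f \<in> hpoly k"
  shows "(\<Sum>b\<in>Basis. coord b * pd b f) = cscale (of_nat k) f"
  using assms
proof (induction rule: hpoly_induct)
  case (mult k c f)
  have "(\<Sum>b\<in>Basis. coord b * pd b (coord c * f)) =
    (\<Sum>b\<in>Basis. (if b = c then coord c * f else 0) + coord c * (coord b * pd b f))"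
    using mult.hyps
    by (intro sum.cong)
       (auto simp: pd_times polynomial_hpoly polynomial_function_coord fun_eq_iff fapply algebra_simps
          inner_Basis)
  also have "\<dots> = coord c * f + coord c * (\<Sum>b\<in>Basis. coord b * pd b f)"
    using mult.hyps by (simp add: sum.distrib sum_distrib_left)
  also have "\<dots> = cscale (of_nat (Suc k)) (coord c * f)"
    by (simp add: mult fun_eq_iff fapply algebra_simps)
  finally show ?case .
next
  case (add k f g)
  then have "(\<Sum>b\<in>Basis. coord b * pd b (f + g)) =
    (\<Sum>b\<in>Basis. coord b * pd b f) + (\<Sum>b\<in>Basis. coord b * pd b g)"
    by (simp add: pd_add polynomial_hpoly distrib_left sum.distrib)
  with add show ?case by (simp add: cfun.scale_right_distrib)
next
  case (cscale k f c)
  from cscale.hyps have "(\<Sum>b\<in>Basis. coord b * pd b (cscale c f)) = cscale c (\<Sum>b\<in>Basis. coord b * pd b f)"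
    by (simp add: pd_cscale polynomial_hpoly cscale_mult_right cfun.scale_sum_right)
  also note cscale.IH
  finally show ?case by (simp only: cfun.scale_scale mult.commute[of c])
qed auto

text \<open>The trace of a real bilinear form does not depend on the orthonormal basis. Applied to
  second derivatives this makes the Laplacian commute with \<open>g\<close>; applied to the
  Hermitian form of first derivatives it carries the invariance of \<open>fip\<close> from one
  degree to the next.\<close>

lemma trace_orthogonal:
  fixes \<beta> :: "'a::euclidean_space \<Rightarrow> 'a \<Rightarrow> complex" and g :: "'a \<Rightarrow> 'a"
  assumes "orthogonal_transformation g"
    and add: "\<And>a b c. \<beta> (a + b) c = \<beta> a c + \<beta> b c" "\<And>a b c. \<beta> c (a + b) = \<beta> c a + \<beta> c b"
    and scale: "\<And>r a b. \<beta> (r *\<^sub>R a) b = of_real r * \<beta> a b" "\<And>r a b. \<beta> a (r *\<^sub>R b) = of_real r * \<beta> a b"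
  shows "(\<Sum>b\<in>Basis. \<beta> (g b) (g b)) = (\<Sum>b\<in>Basis. \<beta> b b)"
proof -
  have sum1: "\<beta> (\<Sum>i\<in>I. F i) c = (\<Sum>i\<in>I. \<beta> (F i) c)" if "finite I" for I :: "'a set" and F c
    using that scale(1)[of 0 0 c] by (induction I rule: finite_induct) (auto simp: add)
  have sum2: "\<beta> c (\<Sum>i\<in>I. F i) = (\<Sum>i\<in>I. \<beta> c (F i))" if "finite I" for I :: "'a set" and F c
    using that scale(2)[of c 0 0] by (induction I rule: finite_induct) (auto simp: add)
  have expand: "\<beta> x y = (\<Sum>c\<in>Basis. \<Sum>d\<in>Basis. of_real ((x \<bullet> c) * (y \<bullet> d)) * \<beta> c d)" for x y
    apply (subst (1) euclidean_representation[of x, symmetric])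
    apply (subst (1) euclidean_representation[of y, symmetric])
    apply (simp add: sum1 sum2 scale sum_distrib_left mult.assoc)
    apply (subst sum.swap)
    apply (intro sum.cong refl)
    apply (rule mult.left_commute)
    done
  \<comment> \<open>The inverse is also the adjoint. Moving \<open>g\<close> to the other side of
    the inner products turns the sum over \<open>b\<close> into \<open>h c \<bullet> h d\<close>,
    which equals \<open>c \<bullet> d\<close>.\<close>
  define h where "h = inv g"
  have h: "orthogonal_transformation h" "\<And>x. g (h x) = x"
    unfolding h_def using assms(1)
    by (simp_all add: orthogonal_transformation_inv surj_f_inv_f orthogonal_transformation_surj)
  have gh: "g b \<bullet> c = b \<bullet> h c" for b c
  proof -
    have "g b \<bullet> g (h c) = b \<bullet> h c"
      using assms(1) unfolding orthogonal_transformation_def by blast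
    then show ?thesis by (simp only: h(2))
  qed
  have "(\<Sum>b\<in>Basis. \<beta> (g b) (g b)) =
    (\<Sum>b\<in>Basis. \<Sum>c\<in>Basis. \<Sum>d\<in>Basis. of_real ((g b \<bullet> c) * (g b \<bullet> d)) * \<beta> c d)"
    by (intro sum.cong refl expand)
  also have "\<dots> = (\<Sum>c\<in>Basis. \<Sum>b\<in>Basis. \<Sum>d\<in>Basis. of_real ((g b \<bullet> c) * (g b \<bullet> d)) * \<beta> c d)"
    by (rule sum.swap)
  also have "\<dots> = (\<Sum>c\<in>Basis. \<Sum>d\<in>Basis. \<Sum>b\<in>Basis. of_real ((g b \<bullet> c) * (g b \<bullet> d)) * \<beta> c d)"
    by (intro sum.cong refl sum.swap)
  also have "\<dots> = (\<Sum>c\<in>Basis. \<Sum>d\<in>Basis. of_real (\<Sum>b\<in>Basis. (h c \<bullet> b) * (h d \<bullet> b)) * \<beta> c d)"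
    by (simp add: gh sum_distrib_right inner_commute[of "h _"])
  also have "\<dots> = (\<Sum>c\<in>Basis. \<Sum>d\<in>Basis. of_real (c \<bullet> d) * \<beta> c d)"
    using h(1) unfolding orthogonal_transformation_def by (subst euclidean_inner[symmetric]) simp
  also have "\<dots> = (\<Sum>c\<in>Basis. \<Sum>d\<in>Basis. if d = c then \<beta> c d else 0)"
    by (intro sum.cong) (auto simp: inner_Basis)
  also have "\<dots> = (\<Sum>b\<in>Basis. \<beta> b b)" by simp
  finally show ?thesis .
qed

section \<open>The Laplacian and the Fischer decomposition\<close>

lemma laplacian_eq: "laplacian f = (\<Sum>b\<in>Basis. pd b (pd b f))"
  by (auto simp: fun_eq_iff fapply laplacian_def pd_def)

lemma laplacian_add:
  "polynomial_function f \<Longrightarrow> polynomial_function g \<Longrightarrow> laplacian (f + g) = laplacian f + laplacian g"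
  by (simp add: laplacian_eq pd_add polynomial_pd sum.distrib)

lemma laplacian_cscale:
  "polynomial_function f \<Longrightarrow> laplacian (cscale c f) = cscale c (laplacian f)"
  by (simp add: laplacian_eq pd_cscale polynomial_pd cfun.scale_sum_right)

lemma laplacian_zero [simp]: "laplacian 0 = 0"
  by (simp add: laplacian_eq)

lemma laplacian_diff:
  assumes "polynomial_function f" "polynomial_function g"
  shows "laplacian (f - g) = laplacian f - laplacian g"
  using laplacian_add[of "f - g" g] assms by (simp add: poly_intros eq_diff_eq)

lemma laplacian_sum:
  "(\<And>i. i \<in> I \<Longrightarrow> polynomial_function (F i)) \<Longrightarrow> laplacian (\<Sum>i\<in>I. F i) = (\<Sum>i\<in>I. laplacian (F i))"
  by (induction I rule: infinite_finite_induct) (auto simp: laplacian_add poly_intros)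

lemma laplacian_hpoly: "f \<in> hpoly k \<Longrightarrow> laplacian f \<in> hpoly (k - 2)"
  unfolding laplacian_eq using pd_hpoly[of _ "k - 1"] pd_hpoly[of f k]
  by (auto intro!: hpoly_sum simp: numeral_2_eq_2)

text \<open>Complements \<open>laplacian_hpoly\<close>, whose degree \<open>k - 2\<close> is
  truncated for these \<open>k\<close>.\<close>

lemma laplacian_hpoly_low: "f \<in> hpoly k \<Longrightarrow> k < 2 \<Longrightarrow> laplacian f = 0"
  unfolding laplacian_eq
  using pd_hpoly[of f k] pd_hpoly[of _ "k - 1"] by (intro sum.neutral) auto

lemma laplacian_orthogonal:
  fixes f :: "'a::euclidean_space \<Rightarrow> complex" and g :: "'a \<Rightarrow> 'a"
  assumes "polynomial_function f" "orthogonal_transformation g"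
  shows "laplacian (f \<circ> g) = laplacian f \<circ> g"
proof
  fix x
  have lin: "linear g" using assms(2) by (rule orthogonal_transformation_linear)
  have "pd b (pd b (f \<circ> g)) = pd (g b) (pd (g b) f) \<circ> g" for b
    using assms(1) lin by (simp add: pd_compose polynomial_pd)
  then have "laplacian (f \<circ> g) x = (\<Sum>b\<in>Basis. pd (g b) (pd (g b) f) (g x))"
    by (simp add: laplacian_eq fapply)
  also have "\<dots> = (\<Sum>b\<in>Basis. pd b (pd b f) (g x))"
    using assms(1)
    by (intro trace_orthogonal[OF assms(2), where \<beta> = "\<lambda>a b. pd a (pd b f) (g x)"];
        simp only: pd_direction_add pd_direction_scaleR polynomial_pd pd_add pd_cscale fapply)
  finally show "laplacian (f \<circ> g) x = (laplacian f \<circ> g) x"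
    by (simp add: laplacian_eq fapply)
qed

section \<open>Powers of the squared norm: existence and uniqueness of the Fischer
  decomposition\<close>

definition nsq :: "'a::euclidean_space \<Rightarrow> complex"
  where "nsq = (\<lambda>x. of_real (x \<bullet> x))"

lemma norm_power_mult_eq: "norm_power_mult s f = nsq ^ s * f"
  by (simp add: fun_eq_iff fapply norm_power_mult_def nsq_def power2_norm_eq_inner power_mult)

lemma nsq_eq: "nsq = (\<Sum>b\<in>Basis. coord b * coord b)"
proof
  fix x :: 'a
  show "nsq x = (\<Sum>b\<in>Basis. coord b * coord b) x"
    unfolding nsq_def by (subst euclidean_inner) (simp add: fapply coord_def)
qed

lemma nsq_hpoly: "nsq \<in> hpoly 2"
  unfolding nsq_eq using hpoly_mult[OF hpoly_coord hpoly_coord] by (auto intro!: hpoly_sum simp: numeral_2_eq_2)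

lemma polynomial_nsq: "polynomial_function nsq"
  using nsq_hpoly by (rule polynomial_hpoly)

lemma nsq_power_hpoly: "f \<in> hpoly k \<Longrightarrow> nsq ^ s * f \<in> hpoly (2 * s + k)"
  using hpoly_mult[OF hpoly_power[OF nsq_hpoly, of s], of f k] by (simp add: mult.commute)

lemma pd_nsq:
  assumes "c \<in> Basis"
  shows "pd c nsq = cscale 2 (coord c)"
proof -
  have "pd c nsq = (\<Sum>b\<in>Basis. pd c (coord b * coord b))"
    unfolding nsq_eq by (rule pd_sum) (intro poly_intros)
  also have "\<dots> = (\<Sum>b\<in>Basis. if b = c then cscale 2 (coord c) else 0)"
    using assms by (intro sum.cong) (auto simp: pd_times poly_intros inner_Basis fapply fun_eq_iff)
  finally show ?thesis using assms by simp
qed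

text \<open>The part \<open>2 * DIM('a)\<close> is the Laplacian of the squared norm. The part
  \<open>4 * k\<close> is the mixed term, twice the product of the gradients, evaluated by Euler's
  identity.\<close>

lemma laplacian_nsq_times:
  fixes f :: "'a::euclidean_space \<Rightarrow> complex"
  assumes "f \<in> hpoly k"
  shows "laplacian (nsq * f) = cscale (of_nat (2 * DIM('a) + 4 * k)) f + nsq * laplacian f"
proof -
  have pf: "polynomial_function f" using assms by (rule polynomial_hpoly)
  have "pd c (pd c (nsq * f)) = cscale 2 f + cscale 4 (coord c * pd c f) + nsq * pd c (pd c f)"
    if "c \<in> Basis" for c
    using that pf
    by (simp add: pd_times pd_nsq polynomial_pd poly_intros polynomial_nsq pd_add pd_cscale
        cscale_mult_left) (simp add: fun_eq_iff fapply algebra_simps)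
  then have "laplacian (nsq * f) =
    (\<Sum>c\<in>Basis. cscale 2 f + cscale 4 (coord c * pd c f) + nsq * pd c (pd c f))"
    by (simp add: laplacian_eq)
  also have "\<dots> = cscale (of_nat (2 * DIM('a))) f + cscale 4 (\<Sum>c\<in>Basis. coord c * pd c f)
      + nsq * laplacian f"
    by (simp add: sum.distrib laplacian_eq cfun.scale_sum_right sum_distrib_left fun_eq_iff fapply
        algebra_simps)
  also have "\<dots> = cscale (of_nat (2 * DIM('a) + 4 * k)) f + nsq * laplacian f"
    by (simp add: euler[OF assms] fun_eq_iff fapply algebra_simps)
  finally show ?thesis .
qed

lemma harmonic_homogeneous_eq: "harmonic_homogeneous k = {f \<in> hpoly k. laplacian f = 0}"
  by (auto simp: harmonic_homogeneous_def harmonic_polys_def polynomial_hpoly hpoly_scaleR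
      fun_eq_iff fapply intro: polynomial_homogeneous_hpoly)

lemma harmonic_homogeneousD:
  assumes "f \<in> harmonic_homogeneous k"
  shows "f \<in> hpoly k" "laplacian f = 0" "polynomial_function f"
  using assms by (auto simp: harmonic_homogeneous_eq polynomial_hpoly)

lemma harmonic_polysD:
  assumes "f \<in> harmonic_polys"
  shows "laplacian f = 0" "polynomial_function f"
  using assms by (auto simp: harmonic_polys_def fun_eq_iff fapply)

lemma harmonic_polysI: "polynomial_function f \<Longrightarrow> laplacian f = 0 \<Longrightarrow> f \<in> harmonic_polys"
  by (auto simp: harmonic_polys_def fapply)

lemma harmonic_homogeneous_polys: "f \<in> harmonic_homogeneous k \<Longrightarrow> f \<in> harmonic_polys"
  by (simp add: harmonic_homogeneous_def)

lemma subspace_harmonic_homogeneous: "cfun.subspace (harmonic_homogeneous k)"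
  unfolding cfun.subspace_def harmonic_homogeneous_eq
  by (auto simp: hpoly_zero hpoly_add hpoly_cscale laplacian_add laplacian_cscale polynomial_hpoly)

lemma subspace_harmonic_polys: "cfun.subspace harmonic_polys"
  unfolding cfun.subspace_def
  by (auto simp: laplacian_add laplacian_cscale poly_intros harmonic_polysD intro!: harmonic_polysI)

text \<open>The factor is the sum of \<open>2 * DIM('a) + 4 * (2 * j + k)\<close> over j from 0 to
  s, the contributions of \<open>laplacian_nsq_times\<close> when the powers are peeled off one by
  one. It is nonzero because the dimension is positive.\<close>

lemma laplacian_nsq_power:
  fixes h :: "'a::euclidean_space \<Rightarrow> complex"
  assumes "h \<in> harmonic_homogeneous k"
  shows "laplacian (nsq ^ Suc s * h) =
    cscale (of_nat (2 * (s + 1) * (2 * s + 2 * k + DIM('a)))) (nsq ^ s * h)"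
proof (induction s)
  case 0
  show ?case
    using laplacian_nsq_times[of h k] harmonic_homogeneousD[OF assms] by (simp add: algebra_simps)
next
  case (Suc s)
  have "nsq ^ Suc s * h \<in> hpoly (2 * Suc s + k)"
    using nsq_power_hpoly harmonic_homogeneousD(1)[OF assms] by blast
  from laplacian_nsq_times[OF this]
  have "laplacian (nsq ^ Suc (Suc s) * h) =
    cscale (of_nat (2 * DIM('a) + 4 * (2 * Suc s + k))) (nsq ^ Suc s * h) +
    nsq * laplacian (nsq ^ Suc s * h)"
    by (simp add: mult.assoc)
  also have "\<dots> = cscale (of_nat (2 * (Suc s + 1) * (2 * Suc s + 2 * k + DIM('a)))) (nsq ^ Suc s * h)"
    unfolding Suc by (simp add: fun_eq_iff fapply algebra_simps)
  finally show ?case .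
qed

text \<open>The Laplacian kills the term \<open>s = 0\<close> and lowers all other powers by one,
  with nonzero factors, so the induction hypothesis applies to the shifted family. The degrees
  \<open>\<kappa>\<close> are arbitrary so that they can be shifted too.\<close>

lemma fischer_unique_homogeneous:
  fixes h :: "nat \<Rightarrow> 'a::euclidean_space \<Rightarrow> complex"
  assumes "\<And>s. s \<le> S \<Longrightarrow> h s \<in> harmonic_homogeneous (\<kappa> s)" "(\<Sum>s\<le>S. nsq ^ s * h s) = 0" "s \<le> S"
  shows "h s = 0"
  using assms
proof (induction S arbitrary: h \<kappa> s)
  case 0
  then show ?case by simp
next
  case (Suc S)
  define c where "c s = 2 * (s + 1) * (2 * s + 2 * \<kappa> (Suc s) + DIM('a))" for s
  define g where "g s = cscale (of_nat (c s)) (h (Suc s))" for s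
  have pol: "polynomial_function (nsq ^ s * h s)" if "s \<le> Suc S" for s
    using Suc.prems(1)[OF that] by (intro poly_intros polynomial_nsq harmonic_homogeneousD)
  have "0 = laplacian (\<Sum>s\<le>Suc S. nsq ^ s * h s)"
    by (simp add: Suc.prems(2) del: sum.atMost_Suc)
  also have "\<dots> = (\<Sum>s\<le>Suc S. laplacian (nsq ^ s * h s))"
    using pol by (intro laplacian_sum) auto
  also have "\<dots> = laplacian (h 0) + (\<Sum>s\<le>S. laplacian (nsq ^ Suc s * h (Suc s)))"
    by (simp add: sum.atMost_Suc_shift del: sum.atMost_Suc)
  also have "laplacian (h 0) = 0"
    using Suc.prems(1)[of 0] harmonic_homogeneousD by blast
  also have "(\<Sum>s\<le>S. laplacian (nsq ^ Suc s * h (Suc s))) = (\<Sum>s\<le>S. nsq ^ s * g s)"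
    by (rule sum.cong[OF refl], subst laplacian_nsq_power[OF Suc.prems(1)])
       (auto simp: g_def c_def cscale_mult_right)
  finally have "(\<Sum>s\<le>S. nsq ^ s * g s) = 0" by simp
  moreover have "g s \<in> harmonic_homogeneous (\<kappa> (Suc s))" if "s \<le> S" for s
    unfolding g_def using that Suc.prems(1)
    by (intro cfun.subspace_scale subspace_harmonic_homogeneous) auto
  ultimately have "g s = 0" if "s \<le> S" for s
    using Suc.IH[of g "\<lambda>s. \<kappa> (Suc s)" s] that by blast
  then have hs: "h (Suc s) = 0" if "s \<le> S" for s
    using that unfolding g_def c_def cfun.scale_eq_0_iff of_nat_eq_0_iff by simp
  have "(\<Sum>s\<le>Suc S. nsq ^ s * h s) = h 0"
    by (subst sum.atMost_Suc_shift) (simp add: hs)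
  with Suc.prems(2) have "h 0 = 0" by simp
  then show ?case using hs Suc.prems(3) by (cases s) auto
qed

text \<open>Decompose the Laplacian of \<open>f\<close>, which has smaller degree, and invert the
  Laplacian term by term with the factors of \<open>laplacian_nsq_power\<close>. The resulting
  \<open>r\<close> has the same Laplacian as \<open>f\<close>, so \<open>f - r\<close> is the
  missing harmonic term.\<close>

lemma fischer_exists_homogeneous:
  fixes f :: "'a::euclidean_space \<Rightarrow> complex"
  assumes "f \<in> hpoly n"
  shows "\<exists>h. (\<forall>s. 2 * s \<le> n \<longrightarrow> h s \<in> harmonic_homogeneous (n - 2 * s)) \<and>
    f = (\<Sum>s\<le>n div 2. nsq ^ s * h s)"
  using assms
proof (induction n arbitrary: f rule: less_induct)
  case (less n)
  show ?case
  proof (cases "n < 2")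
    case True
    then have "s = 0" if "2 * s \<le> n" for s using that by simp
    moreover have "f \<in> harmonic_homogeneous n"
      using less.prems laplacian_hpoly_low[OF less.prems True] by (simp add: harmonic_homogeneous_eq)
    ultimately show ?thesis
      using True by (intro exI[of _ "\<lambda>_. f"]) fastforce
  next
    case False
    define m where "m = n - 2"
    have n: "n = Suc (Suc m)" using False by (simp add: m_def)
    have "laplacian f \<in> hpoly m"
      using laplacian_hpoly[OF less.prems] n by simp
    then have "\<exists>g. (\<forall>s. 2 * s \<le> m \<longrightarrow> g s \<in> harmonic_homogeneous (m - 2 * s)) \<and>
      laplacian f = (\<Sum>s\<le>m div 2. nsq ^ s * g s)"
      by (intro less.IH) (simp add: n)
    then obtain g where g: "\<And>s. 2 * s \<le> m \<Longrightarrow> g s \<in> harmonic_homogeneous (m - 2 * s)"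
      "laplacian f = (\<Sum>s\<le>m div 2. nsq ^ s * g s)" by blast
    define c where "c s = 2 * (s + 1) * (2 * s + 2 * (m - 2 * s) + DIM('a))" for s
    define h' where "h' s = cscale (1 / of_nat (c s)) (g s)" for s
    define r where "r = (\<Sum>s\<le>m div 2. nsq ^ Suc s * h' s)"
    have h': "h' s \<in> harmonic_homogeneous (m - 2 * s)" if "s \<le> m div 2" for s
      unfolding h'_def using that
      by (intro cfun.subspace_scale subspace_harmonic_homogeneous g) auto
    have hp: "nsq ^ Suc s * h' s \<in> hpoly n" if "s \<le> m div 2" for s
    proof -
      have "2 * Suc s + (m - 2 * s) = n" using that n by auto
      then show ?thesis
        using nsq_power_hpoly[OF harmonic_homogeneousD(1)[OF h'[OF that]], of "Suc s"] by metis
    qed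
    then have r: "r \<in> hpoly n" unfolding r_def by (intro hpoly_sum) auto
    have "laplacian r = (\<Sum>s\<le>m div 2. laplacian (nsq ^ Suc s * h' s))"
      unfolding r_def using hp polynomial_hpoly by (intro laplacian_sum) blast
    also have "\<dots> = (\<Sum>s\<le>m div 2. nsq ^ s * g s)"
    proof (rule sum.cong[OF refl])
      fix s assume "s \<in> {..m div 2}"
      then have "laplacian (nsq ^ Suc s * h' s) = cscale (of_nat (c s)) (nsq ^ s * h' s)"
        unfolding c_def by (intro laplacian_nsq_power h') simp
      also have "\<dots> = cscale (of_nat (c s) * (1 / of_nat (c s))) (nsq ^ s * g s)"
        by (simp add: h'_def cscale_mult_right)
      also have "of_nat (c s) * (1 / of_nat (c s)) = (1 :: complex)"
        unfolding c_def by (simp del: of_nat_mult of_nat_add)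
      finally show "laplacian (nsq ^ Suc s * h' s) = nsq ^ s * g s" by simp
    qed
    finally have "laplacian r = laplacian f" using g(2) by simp
    then have "f - r \<in> harmonic_homogeneous n"
      using less.prems r by (auto simp: harmonic_homogeneous_eq hpoly_diff laplacian_diff polynomial_hpoly)
    define h where "h s = (case s of 0 \<Rightarrow> f - r | Suc s \<Rightarrow> h' s)" for s
    have "h s \<in> harmonic_homogeneous (n - 2 * s)" if "2 * s \<le> n" for s
      using that h' \<open>f - r \<in> harmonic_homogeneous n\<close> by (auto simp: h_def n split: nat.split)
    moreover have "f = (\<Sum>s\<le>n div 2. nsq ^ s * h s)"
    proof -
      have "n div 2 = Suc (m div 2)" by (simp add: n)
      then have "(\<Sum>s\<le>n div 2. nsq ^ s * h s) = h 0 + (\<Sum>s\<le>m div 2. nsq ^ Suc s * h (Suc s))"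
        by (simp add: sum.atMost_Suc_shift del: sum.atMost_Suc)
      also have "\<dots> = f" by (simp add: h_def r_def)
      finally show ?thesis by simp
    qed
    ultimately show ?thesis by blast
  qed
qed

lemma harmonic_decompose:
  fixes f :: "'a::euclidean_space \<Rightarrow> complex"
  assumes "f \<in> harmonic_polys"
  shows "\<exists>N F. (\<forall>k. F k \<in> harmonic_homogeneous k) \<and> (\<forall>k>N. F k = 0) \<and> f = (\<Sum>k\<le>N. F k)"
proof -
  obtain N F where F: "\<And>k. F k \<in> hpoly k" "f = (\<Sum>k\<le>N. F k)"
    using polynomial_decompose[of f] harmonic_polysD[OF assms] by metis
  \<comment> \<open>Only from degree 2 on is \<open>k - 2\<close> injective, so the low degrees are
    removed before the sum is split by degree.\<close>
  have "(\<Sum>k\<in>{2..N}. laplacian (F k)) = (\<Sum>k\<le>N. laplacian (F k))"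
    using laplacian_hpoly_low[OF F(1)] by (intro sum.mono_neutral_left) auto
  also have "\<dots> = laplacian f"
    unfolding F(2) using polynomial_hpoly[OF F(1)] by (intro laplacian_sum[symmetric]) auto
  also have "\<dots> = 0" using harmonic_polysD[OF assms] by simp
  finally have eq: "(\<Sum>k\<in>{2..N}. laplacian (F k)) = 0" .
  have "laplacian (F k) = 0" if "k \<le> N" for k
  proof (cases "k < 2")
    case True
    then show ?thesis using laplacian_hpoly_low F by blast
  next
    case False
    have "(\<Sum>i\<in>{i\<in>{2..N}. i - 2 = k - 2}. laplacian (F i)) = 0"
      using eq laplacian_hpoly[OF F(1)] by (intro hpoly_graded) auto
    moreover have "{i\<in>{2..N}. i - 2 = k - 2} = {k}" using False that by auto
    ultimately show ?thesis by simp
  qed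
  then have "(\<lambda>k. if k \<le> N then F k else 0) k \<in> harmonic_homogeneous k" for k
    using F(1) by (simp add: harmonic_homogeneous_eq hpoly_zero)
  moreover have "f = (\<Sum>k\<le>N. (\<lambda>k. if k \<le> N then F k else 0) k)"
    unfolding F(2) by (intro sum.cong) auto
  ultimately show ?thesis
    by (intro exI[of _ N] exI[of _ "\<lambda>k. if k \<le> N then F k else 0"]) auto
qed

text \<open>The harmonic factors may have parts of many degrees. Among all terms of a fixed total
  degree \<open>2 * s + k\<close> there is at most one for each power of the squared norm, which is
  the homogeneous case.\<close>

lemma fischer_unique:
  fixes g :: "nat \<Rightarrow> 'a::euclidean_space \<Rightarrow> complex"
  assumes g: "\<And>s. s \<le> S \<Longrightarrow> g s \<in> harmonic_polys" and zero: "(\<Sum>s\<le>S. nsq ^ s * g s) = 0"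
    and s: "s \<le> S"
  shows "g s = 0"
proof -
  have "\<forall>s\<in>{..S}. \<exists>NF. (\<forall>k. snd NF k \<in> harmonic_homogeneous k) \<and> (\<forall>k>fst NF. snd NF k = 0) \<and>
      g s = (\<Sum>k\<le>fst NF. snd NF k)"
    using harmonic_decompose[OF g] by force
  then obtain NF where NF: "\<forall>s\<in>{..S}. (\<forall>k. snd (NF s) k \<in> harmonic_homogeneous k) \<and>
      (\<forall>k>fst (NF s). snd (NF s) k = 0) \<and> g s = (\<Sum>k\<le>fst (NF s). snd (NF s) k)"
    unfolding bchoice_iff by blast
  define G where "G s = snd (NF s)" for s
  define M where "M = Max ((\<lambda>s. fst (NF s)) ` {..S})"
  have G: "G s k \<in> harmonic_homogeneous k" if "s \<le> S" for s k
    using NF that by (simp add: G_def)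
  have gG: "g s = (\<Sum>k\<le>M. G s k)" if "s \<le> S" for s
  proof -
    have "fst (NF s) \<le> M" unfolding M_def using that by (intro Max_ge) auto
    then have "(\<Sum>k\<le>fst (NF s). G s k) = (\<Sum>k\<le>M. G s k)"
      using NF that by (intro sum.mono_neutral_left) (auto simp: G_def)
    then show ?thesis using NF that by (simp add: G_def)
  qed
  have Gzero: "G s k = 0" if "s \<le> S" "k \<le> M" for s k
  proof -
    define m where "m = 2 * s + k"
    \<comment> \<open>At most one \<open>j\<close> meets the condition, so \<open>h t\<close> is the
      part of \<open>g t\<close> of degree \<open>m - 2 * t\<close>. If there is none it is zero,
      which also covers the case where the subtraction is truncated.\<close>
    define h where "h t = (\<Sum>j\<le>M. if 2 * t + j = m then G t j else 0)" for t
    define I where "I = {..S} \<times> {..M}"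
    define T where "T p = nsq ^ fst p * G (fst p) (snd p)" for p
    have "(\<Sum>p\<in>I. T p) = (\<Sum>s\<le>S. nsq ^ s * g s)"
      unfolding I_def T_def sum.cartesian_product'
      by (intro sum.cong) (auto simp: gG sum_distrib_left)
    then have "(\<Sum>p\<in>I. T p) = 0" using zero by simp
    then have "(\<Sum>p\<in>{p\<in>I. 2 * fst p + snd p = m}. T p) = 0"
      by (rule hpoly_graded[rotated 2])
         (use nsq_power_hpoly[OF harmonic_homogeneousD(1)[OF G]] in \<open>auto simp: I_def T_def\<close>)
    also have "(\<Sum>p\<in>{p\<in>I. 2 * fst p + snd p = m}. T p) =
        (\<Sum>p\<in>I. if 2 * fst p + snd p = m then T p else 0)"
      by (rule sum.inter_filter) (simp add: I_def)
    also have "\<dots> = (\<Sum>t\<le>S. \<Sum>j\<le>M. if 2 * t + j = m then T (t, j) else 0)"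
      unfolding I_def sum.cartesian_product' by simp
    also have "\<dots> = (\<Sum>t\<le>S. nsq ^ t * h t)"
      unfolding h_def sum_distrib_left by (intro sum.cong) (auto simp: T_def)
    finally have "(\<Sum>t\<le>S. nsq ^ t * h t) = 0" .
    moreover have "h t \<in> harmonic_homogeneous (m - 2 * t)" if "t \<le> S" for t
      unfolding h_def
      by (intro cfun.subspace_sum subspace_harmonic_homogeneous)
         (use G[OF that] in \<open>auto intro: cfun.subspace_0 subspace_harmonic_homogeneous\<close>)
    ultimately have "h s = 0"
      using \<open>s \<le> S\<close> by (intro fischer_unique_homogeneous[of S h "\<lambda>t. m - 2 * t"])
    moreover have "h s = (\<Sum>j\<le>M. if j = k then G s k else 0)"
      unfolding h_def m_def by (intro sum.cong) auto
    ultimately show ?thesis using that by simp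
  qed
  show ?thesis using gG[OF s] Gzero[OF s] by simp
qed

lemma fischer_exists:
  fixes f :: "'a::euclidean_space \<Rightarrow> complex"
  assumes "polynomial_function f"
  shows "\<exists>N g. (\<forall>s. g s \<in> harmonic_polys) \<and> f = (\<Sum>s\<le>N. nsq ^ s * g s)"
  using assms
proof (induction rule: polynomial_induct)
  case (hpoly k f)
  then obtain h where h: "\<And>s. 2 * s \<le> k \<Longrightarrow> h s \<in> harmonic_homogeneous (k - 2 * s)"
    "f = (\<Sum>s\<le>k div 2. nsq ^ s * h s)"
    using fischer_exists_homogeneous by blast
  have "(if 2 * s \<le> k then h s else 0) \<in> harmonic_polys" for s
    using h(1) harmonic_homogeneous_polys cfun.subspace_0[OF subspace_harmonic_polys] by auto
  moreover have "f = (\<Sum>s\<le>k div 2. nsq ^ s * (if 2 * s \<le> k then h s else 0))"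
    unfolding h(2) by (intro sum.cong) auto
  ultimately show ?case
    by (intro exI[of _ "k div 2"] exI[of _ "\<lambda>s. if 2 * s \<le> k then h s else 0"]) auto
next
  case (add f f')
  from add.IH obtain N g N' g' where g: "\<And>s. g s \<in> harmonic_polys"
    "\<And>s. g' s \<in> harmonic_polys"
    "f = (\<Sum>s\<le>N. nsq ^ s * g s)" "f' = (\<Sum>s\<le>N'. nsq ^ s * g' s)"
    by blast
  define G where "G s = (if s \<le> N then g s else 0) + (if s \<le> N' then g' s else 0)" for s
  note sub = subspace_harmonic_polys
  have "G s \<in> harmonic_polys" for s
    unfolding G_def using g cfun.subspace_0[OF sub] cfun.subspace_add[OF sub] by auto
  moreover have "f + f' = (\<Sum>s\<le>max N N'. nsq ^ s * G s)"
  proof -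
    have 1: "(\<Sum>s\<le>max N N'. nsq ^ s * (if s \<le> N then g s else 0)) = f"
      unfolding g by (rule sum.mono_neutral_cong_right) auto
    have 2: "(\<Sum>s\<le>max N N'. nsq ^ s * (if s \<le> N' then g' s else 0)) = f'"
      unfolding g by (rule sum.mono_neutral_cong_right) auto
    show ?thesis unfolding G_def distrib_left sum.distrib 1 2 ..
  qed
  ultimately show ?case by blast
qed

section \<open>The harmonic projection\<close>

lemma nsq_shift: "h + nsq * (\<Sum>s\<le>N. nsq ^ s * g s) =
    (\<Sum>s\<le>Suc N. nsq ^ s * (case s of 0 \<Rightarrow> h | Suc s \<Rightarrow> g s))"
  by (simp add: sum.atMost_Suc_shift sum_distrib_left mult.assoc del: sum.atMost_Suc)

text \<open>The form in which uniqueness is mostly used: a harmonic polynomial divisible by the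
  squared norm is zero.\<close>

lemma harmonic_nsq_mult_zero:
  fixes h Q :: "'a::euclidean_space \<Rightarrow> complex"
  assumes "h \<in> harmonic_polys" "polynomial_function Q" "h + nsq * Q = 0"
  shows "h = 0"
proof -
  obtain N g where g: "\<And>s. g s \<in> harmonic_polys" "Q = (\<Sum>s\<le>N. nsq ^ s * g s)"
    using fischer_exists[OF assms(2)] by blast
  have "(\<Sum>s\<le>Suc N. nsq ^ s * (case s of 0 \<Rightarrow> h | Suc s \<Rightarrow> g s)) = 0"
    using assms(3) unfolding g(2) nsq_shift .
  then have "(case 0::nat of 0 \<Rightarrow> h | Suc s \<Rightarrow> g s) = 0"
    by (rule fischer_unique[rotated]) (use assms g in \<open>auto split: nat.split\<close>)
  then show ?thesis by simp
qed

text \<open>The working rule for the definite description: a harmonic part and any polynomial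
  quotient suffice, since the quotient has a Fischer decomposition of its own.\<close>

lemma harmonic_projection_eqI:
  fixes h Q :: "'a::euclidean_space \<Rightarrow> complex"
  assumes "h \<in> harmonic_polys" "polynomial_function Q"
  shows "harmonic_projection (h + nsq * Q) = h"
  unfolding harmonic_projection_def
proof (rule the_equality)
  obtain N g where g: "\<And>s. g s \<in> harmonic_polys" "Q = (\<Sum>s\<le>N. nsq ^ s * g s)"
    using fischer_exists[OF assms(2)] by blast
  show "\<exists>N g. (\<forall>s\<le>N. g s \<in> harmonic_polys) \<and>
      h + nsq * Q = (\<Sum>s\<le>N. norm_power_mult s (g s)) \<and> h = g 0"
    using assms g
    by (intro exI[of _ "Suc N"] exI[of _ "\<lambda>s. case s of 0 \<Rightarrow> h | Suc s \<Rightarrow> g s"])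
       (auto simp: nsq_shift norm_power_mult_eq split: nat.split simp del: sum.atMost_Suc)
next
  fix h'
  assume "\<exists>N g. (\<forall>s\<le>N. g s \<in> harmonic_polys) \<and>
      h + nsq * Q = (\<Sum>s\<le>N. norm_power_mult s (g s)) \<and> h' = g 0"
  then obtain N g where g: "\<And>s. s \<le> N \<Longrightarrow> g s \<in> harmonic_polys" "h' = g 0"
    "h + nsq * Q = (\<Sum>s\<le>N. nsq ^ s * g s)"
    by (auto simp: norm_power_mult_eq)
  \<comment> \<open>All terms with positive exponent, with one factor \<open>nsq\<close> taken
    out.\<close>
  define Q' where "Q' = (\<Sum>s<N. nsq ^ s * g (Suc s))"
  have "(\<Sum>s\<le>N. nsq ^ s * g s) = g 0 + nsq * Q'"
    unfolding Q'_def by (cases N) (simp_all add: sum.atMost_Suc_shift sum_distrib_left mult.assoc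
        lessThan_Suc_atMost del: sum.atMost_Suc)
  then have "(h - h') + nsq * (Q - Q') = 0"
    using g by (simp add: algebra_simps)
  moreover have "polynomial_function (Q - Q')"
    unfolding Q'_def using assms g(1)
    by (auto intro!: poly_intros polynomial_nsq intro: harmonic_polysD(2))
  moreover have "h - h' \<in> harmonic_polys"
    using assms g by (auto intro: cfun.subspace_diff[OF subspace_harmonic_polys])
  ultimately show "h' = h" using harmonic_nsq_mult_zero by fastforce
qed

lemma harmonic_projection_decompose:
  fixes f :: "'a::euclidean_space \<Rightarrow> complex"
  assumes "polynomial_function f"
  obtains Q where "harmonic_projection f \<in> harmonic_polys" "polynomial_function Q"
    "f = harmonic_projection f + nsq * Q"
proof -
  obtain N g where g: "\<And>s. g s \<in> harmonic_polys" "f = (\<Sum>s\<le>N. nsq ^ s * g s)"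
    using fischer_exists[OF assms(1)] by blast
  define Q where "Q = (\<Sum>s<N. nsq ^ s * g (Suc s))"
  have f: "f = g 0 + nsq * Q"
    unfolding Q_def g by (cases N) (simp_all add: sum.atMost_Suc_shift sum_distrib_left mult.assoc
        lessThan_Suc_atMost del: sum.atMost_Suc)
  have Q: "polynomial_function Q"
    unfolding Q_def using g(1) by (auto intro!: poly_intros polynomial_nsq intro: harmonic_polysD(2))
  have "harmonic_projection f = g 0"
    unfolding f using g Q by (intro harmonic_projection_eqI) auto
  then show ?thesis using that f Q g by metis
qed

lemma harmonic_projection_add:
  assumes "polynomial_function f" "polynomial_function (g :: 'a::euclidean_space \<Rightarrow> complex)"
  shows "harmonic_projection (f + g) = harmonic_projection f + harmonic_projection g"
proof -
  obtain Q Q' where "harmonic_projection f \<in> harmonic_polys" "polynomial_function Q"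
    "f = harmonic_projection f + nsq * Q" "harmonic_projection g \<in> harmonic_polys"
    "polynomial_function Q'" "g = harmonic_projection g + nsq * Q'"
    using harmonic_projection_decompose[OF assms(1)] harmonic_projection_decompose[OF assms(2)]
    by metis
  note Q = this
  have "f + g = (harmonic_projection f + nsq * Q) + (harmonic_projection g + nsq * Q')"
    using Q by simp
  also have "\<dots> = (harmonic_projection f + harmonic_projection g) + nsq * (Q + Q')"
    by (simp only: distrib_left ac_simps)
  finally have "harmonic_projection (f + g) =
    harmonic_projection ((harmonic_projection f + harmonic_projection g) + nsq * (Q + Q'))"
    by (rule arg_cong)
  also have "\<dots> = harmonic_projection f + harmonic_projection g"
    by (intro harmonic_projection_eqI polynomial_function_plus
        cfun.subspace_add[OF subspace_harmonic_polys] Q)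
  finally show ?thesis .
qed

lemma harmonic_projection_cscale:
  assumes "polynomial_function (f :: 'a::euclidean_space \<Rightarrow> complex)"
  shows "harmonic_projection (cscale c f) = cscale c (harmonic_projection f)"
proof -
  obtain Q where Q: "harmonic_projection f \<in> harmonic_polys" "polynomial_function Q"
    "f = harmonic_projection f + nsq * Q"
    using harmonic_projection_decompose assms by metis
  have "cscale c f = cscale c (harmonic_projection f) + nsq * cscale c Q"
    using arg_cong[OF Q(3), of "cscale c"] by (simp add: cfun.scale_right_distrib cscale_mult_right)
  then show ?thesis
    using harmonic_projection_eqI[of "cscale c (harmonic_projection f)" "cscale c Q"] Q
      cfun.subspace_scale[OF subspace_harmonic_polys] polynomial_function_cscale by metis
qed

lemma harmonic_projection_zero: "harmonic_projection 0 = 0"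
  using harmonic_projection_cscale[of 0 0] by (simp add: poly_intros)

lemma harmonic_projection_sum:
  "(\<And>i. i \<in> I \<Longrightarrow> polynomial_function (F i)) \<Longrightarrow>
    harmonic_projection (\<Sum>i\<in>I. F i) = (\<Sum>i\<in>I. harmonic_projection (F i))"
  by (induction I rule: infinite_finite_induct)
     (auto simp: harmonic_projection_add poly_intros harmonic_projection_zero)

lemma harmonic_projection_nsq:
  "polynomial_function Q \<Longrightarrow> harmonic_projection (nsq * Q) = 0"
  using harmonic_projection_eqI[of 0 Q] cfun.subspace_0[OF subspace_harmonic_polys] by simp

lemma harmonic_projection_harmonic: "h \<in> harmonic_polys \<Longrightarrow> harmonic_projection h = h"
  using harmonic_projection_eqI[of h 0] by (simp add: poly_intros)

lemma harmonic_compose_orthogonal: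
  fixes g :: "'a::euclidean_space \<Rightarrow> 'a"
  assumes "h \<in> harmonic_polys" "orthogonal_transformation g"
  shows "h \<circ> g \<in> harmonic_polys"
proof (rule harmonic_polysI)
  show "polynomial_function (h \<circ> g)"
    by (intro polynomial_compose_linear harmonic_polysD(2) orthogonal_transformation_linear assms)
  show "laplacian (h \<circ> g) = 0"
    using laplacian_orthogonal[OF harmonic_polysD(2)[OF assms(1)] assms(2)]
    by (simp add: harmonic_polysD(1)[OF assms(1)] fun_eq_iff fapply)
qed

lemma harmonic_homogeneous_compose_orthogonal:
  fixes g :: "'a::euclidean_space \<Rightarrow> 'a"
  assumes "h \<in> harmonic_homogeneous k" "orthogonal_transformation g"
  shows "h \<circ> g \<in> harmonic_homogeneous k"
  using assms harmonic_compose_orthogonal[OF harmonic_homogeneous_polys[OF assms(1)] assms(2)]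
    hpoly_compose_linear[OF harmonic_homogeneousD(1)[OF assms(1)] orthogonal_transformation_linear[OF assms(2)]]
  by (auto simp: harmonic_homogeneous_eq dest: harmonic_polysD)

lemma nsq_orthogonal: "orthogonal_transformation g \<Longrightarrow> nsq (g x) = nsq x"
  by (simp add: nsq_def orthogonal_transformation_def)

lemma harmonic_projection_orthogonal:
  fixes g :: "'a::euclidean_space \<Rightarrow> 'a"
  assumes "polynomial_function (f :: 'a::euclidean_space \<Rightarrow> complex)" "orthogonal_transformation g"
  shows "harmonic_projection (f \<circ> g) = harmonic_projection f \<circ> g"
proof -
  obtain Q where Q: "harmonic_projection f \<in> harmonic_polys" "polynomial_function Q"
    "f = harmonic_projection f + nsq * Q"
    using harmonic_projection_decompose assms by metis
  have eq: "f \<circ> g = (harmonic_projection f \<circ> g) + nsq * (Q \<circ> g)"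
  proof
    fix x
    have "f (g x) = (harmonic_projection f + nsq * Q) (g x)" using Q(3) by simp
    then show "(f \<circ> g) x = ((harmonic_projection f \<circ> g) + nsq * (Q \<circ> g)) x"
      by (simp add: fapply nsq_orthogonal[OF assms(2)])
  qed
  show ?thesis
    unfolding eq
    by (intro harmonic_projection_eqI harmonic_compose_orthogonal polynomial_compose_linear Q
        orthogonal_transformation_linear assms)
qed

lemma harmonic_projection_hpoly:
  fixes f :: "'a::euclidean_space \<Rightarrow> complex"
  assumes "f \<in> hpoly n"
  shows "harmonic_projection f \<in> harmonic_homogeneous n"
proof -
  obtain h where h: "\<And>s. 2 * s \<le> n \<Longrightarrow> h s \<in> harmonic_homogeneous (n - 2 * s)"
    "f = (\<Sum>s\<le>n div 2. nsq ^ s * h s)"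
    using fischer_exists_homogeneous[OF assms] by blast
  have pol: "polynomial_function (h s)" if "s \<le> n div 2" for s
    using h(1)[of s] that harmonic_homogeneousD by fastforce
  have "harmonic_projection (nsq ^ s * h s) = (if s = 0 then h 0 else 0)" if "s \<le> n div 2" for s
  proof (cases s)
    case 0
    then show ?thesis
      using h(1)[of 0] by (auto intro: harmonic_projection_harmonic harmonic_homogeneous_polys)
  next
    case (Suc t)
    then show ?thesis
      using harmonic_projection_nsq[of "nsq ^ t * h s"] pol[OF that]
      by (simp add: poly_intros polynomial_nsq mult.assoc)
  qed
  then have "harmonic_projection f = h 0"
    unfolding h(2) using pol
    by (subst harmonic_projection_sum) (auto intro!: poly_intros polynomial_nsq)
  then show ?thesis using h(1)[of 0] by simp
qed

section \<open>Direct sums and linear maps on function spaces\<close>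

lemma subspace_sums_family:
  assumes "\<And>i. i \<in> I \<Longrightarrow> cfun.subspace (U i)"
  shows "cfun.subspace {(\<Sum>i\<in>I. f i) |f. \<forall>i\<in>I. f i \<in> U i}"
  unfolding cfun.subspace_def
proof safe
  show "\<exists>f. 0 = (\<Sum>i\<in>I. f i) \<and> (\<forall>i\<in>I. f i \<in> U i)"
    by (intro exI[of _ "\<lambda>_. 0"]) (auto intro: cfun.subspace_0[OF assms])
next
  fix f g assume "\<forall>i\<in>I. f i \<in> U i" "\<forall>i\<in>I. g i \<in> U i"
  then show "\<exists>h. (\<Sum>i\<in>I. f i) + (\<Sum>i\<in>I. g i) = (\<Sum>i\<in>I. h i) \<and> (\<forall>i\<in>I. h i \<in> U i)"
    by (intro exI[of _ "\<lambda>i. f i + g i"]) (auto simp: sum.distrib intro: cfun.subspace_add[OF assms])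
next
  fix c f assume "\<forall>i\<in>I. f i \<in> U i"
  then show "\<exists>h. cscale c (\<Sum>i\<in>I. f i) = (\<Sum>i\<in>I. h i) \<and> (\<forall>i\<in>I. h i \<in> U i)"
    by (intro exI[of _ "\<lambda>i. cscale c (f i)"])
       (auto simp: cfun.scale_sum_right intro: cfun.subspace_scale[OF assms])
qed

lemma mem_sums_family:
  assumes "finite I" "\<And>i. i \<in> I \<Longrightarrow> cfun.subspace (U i)" "i \<in> I" "x \<in> U i"
  shows "x \<in> {(\<Sum>i\<in>I. f i) |f. \<forall>i\<in>I. f i \<in> U i}"
  using assms cfun.subspace_0 by (intro CollectI exI[of _ "\<lambda>j. if j = i then x else 0"]) auto

text \<open>Linearity is required on \<open>D\<close> only, because the harmonic projection has a
  known value on polynomials and an arbitrary one elsewhere.\<close>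

definition linear_on_space :: "('a \<Rightarrow> complex) set \<Rightarrow> (('a \<Rightarrow> complex) \<Rightarrow> 'b \<Rightarrow> complex) \<Rightarrow> bool"
  where "linear_on_space D L \<longleftrightarrow>
    (\<forall>f\<in>D. \<forall>g\<in>D. L (f + g) = L f + L g) \<and> (\<forall>c. \<forall>f\<in>D. L (cscale c f) = cscale c (L f))"

lemma linear_on_spaceD:
  assumes "linear_on_space D L"
  shows "f \<in> D \<Longrightarrow> g \<in> D \<Longrightarrow> L (f + g) = L f + L g"
    and "f \<in> D \<Longrightarrow> L (cscale c f) = cscale c (L f)"
  using assms by (auto simp: linear_on_space_def)

lemma linear_on_space_subset: "linear_on_space D L \<Longrightarrow> T \<subseteq> D \<Longrightarrow> linear_on_space T L"
  by (auto simp: linear_on_space_def subset_iff)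

lemma linear_on_space_zero: "linear_on_space D L \<Longrightarrow> cfun.subspace D \<Longrightarrow> L 0 = 0"
  using linear_on_spaceD(2)[of D L 0 0] cfun.subspace_0[of D] by simp

lemma linear_on_space_diff:
  assumes "linear_on_space D L" "cfun.subspace D" "f \<in> D" "g \<in> D"
  shows "L (f - g) = L f - L g"
  using linear_on_spaceD(1)[OF assms(1) cfun.subspace_diff[OF assms(2-4)] assms(4)]
  by (simp add: eq_diff_eq)

lemma linear_on_space_sum:
  assumes "linear_on_space D L" "cfun.subspace D" "\<And>i. i \<in> I \<Longrightarrow> f i \<in> D"
  shows "L (\<Sum>i\<in>I. f i) = (\<Sum>i\<in>I. L (f i))"
  using assms(3)
proof (induction I rule: infinite_finite_induct)
  case (insert i I)
  then have "L (f i + (\<Sum>i\<in>I. f i)) = L (f i) + L (\<Sum>i\<in>I. f i)"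
    by (intro linear_on_spaceD(1)[OF assms(1)] cfun.subspace_sum assms(2)) auto
  with insert show ?case by simp
qed (simp_all add: linear_on_space_zero[OF assms(1,2)])

lemma subspace_image:
  assumes "linear_on_space D L" "cfun.subspace T" "T \<subseteq> D"
  shows "cfun.subspace (L ` T)"
proof -
  have L: "linear_on_space T L" using assms linear_on_space_subset by blast
  show ?thesis
    unfolding cfun.subspace_def
  proof (intro conjI ballI allI)
    show "0 \<in> L ` T"
      using linear_on_space_zero[OF L assms(2)] cfun.subspace_0[OF assms(2)] by (metis imageI)
  next
    fix x y assume "x \<in> L ` T" "y \<in> L ` T"
    then obtain f g where fg: "f \<in> T" "x = L f" "g \<in> T" "y = L g" by blast
    then have "x + y = L (f + g)" by (simp add: linear_on_spaceD(1)[OF L])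
    then show "x + y \<in> L ` T" using cfun.subspace_add[OF assms(2) fg(1,3)] by (rule image_eqI)
  next
    fix c x assume "x \<in> L ` T"
    then obtain f where f: "f \<in> T" "x = L f" by blast
    then have "cscale c x = L (cscale c f)" by (simp add: linear_on_spaceD(2)[OF L])
    then show "cscale c x \<in> L ` T" using cfun.subspace_scale[OF assms(2) f(1)] by (rule image_eqI)
  qed
qed

section \<open>Polynomials on a product\<close>

lemma tensor_space_subspace: "cfun.subspace (tensor_space A B)"
  by (simp add: tensor_space_def)

lemma tensor_space_base: "K \<in> A \<Longrightarrow> G \<in> B \<Longrightarrow> (\<lambda>(u, v). K u * G v) \<in> tensor_space A B"
  unfolding tensor_space_def by (rule cfun.span_base) blast

lemma tensor_space_induct [consumes 1, case_names zero step]: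
  assumes "F \<in> tensor_space A B" "P 0"
    "\<And>c K G F. K \<in> A \<Longrightarrow> G \<in> B \<Longrightarrow> F \<in> tensor_space A B \<Longrightarrow> P F \<Longrightarrow>
      P (cscale c (\<lambda>(u, v). K u * G v) + F)"
  shows "P F"
proof -
  have "F \<in> tensor_space A B \<and> P F"
    using assms(1) unfolding tensor_space_def
  proof (induction rule: cfun.span_induct_alt)
    case base
    show ?case using assms(2) by (simp add: cfun.span_zero)
  next
    case (step c x y)
    then obtain K G where KG: "x = (\<lambda>(u, v). K u * G v)" "K \<in> A" "G \<in> B" by blast
    have "y \<in> tensor_space A B" "P y" using step by (auto simp: tensor_space_def)
    then have "P (cscale c x + y)" "cscale c x + y \<in> tensor_space A B"
      unfolding KG(1) using KG assms(3)
      by (auto intro!: cfun.subspace_add[OF tensor_space_subspace]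
          cfun.subspace_scale[OF tensor_space_subspace] tensor_space_base)
    then show ?case by (simp add: tensor_space_def)
  qed
  then show ?thesis by simp
qed

text \<open>Freezing a variable returns to a space of functions of the other one. Nearly all facts
  about tensor products below reduce to one factor in this way.\<close>

lemma tensor_space_section1:
  assumes "F \<in> tensor_space A B" "cfun.subspace A"
  shows "(\<lambda>u. F (u, v)) \<in> A"
  using assms(1)
proof (induction rule: tensor_space_induct)
  case zero
  have "(\<lambda>u. (0 :: 'a \<times> 'b \<Rightarrow> complex) (u, v)) = 0" by (simp add: fun_eq_iff fapply)
  then show ?case using cfun.subspace_0[OF assms(2)] by simp
next
  case (step c K G F)
  have "(\<lambda>u. (cscale c (\<lambda>(u, v). K u * G v) + F) (u, v)) = cscale (c * G v) K + (\<lambda>u. F (u, v))"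
    by (simp add: fun_eq_iff fapply)
  then show ?case
    using step cfun.subspace_add[OF assms(2)] cfun.subspace_scale[OF assms(2)] by metis
qed

lemma tensor_space_section2:
  assumes "F \<in> tensor_space A B" "cfun.subspace B"
  shows "(\<lambda>v. F (u, v)) \<in> B"
  using assms(1)
proof (induction rule: tensor_space_induct)
  case zero
  have "(\<lambda>v. (0 :: 'a \<times> 'b \<Rightarrow> complex) (u, v)) = 0" by (simp add: fun_eq_iff fapply)
  then show ?case using cfun.subspace_0[OF assms(2)] by simp
next
  case (step c K G F)
  have "(\<lambda>v. (cscale c (\<lambda>(u, v). K u * G v) + F) (u, v)) = cscale (c * K u) G + (\<lambda>v. F (u, v))"
    by (simp add: fun_eq_iff fapply)
  then show ?case
    using step cfun.subspace_add[OF assms(2)] cfun.subspace_scale[OF assms(2)] by metis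
qed

lemma tensor_space_mono: "A \<subseteq> A' \<Longrightarrow> B \<subseteq> B' \<Longrightarrow> tensor_space A B \<subseteq> tensor_space A' B'"
  unfolding tensor_space_def by (rule cfun.span_mono) blast

lemma linear_fst': "linear fst"
  by (simp add: linear_iff)

lemma linear_snd': "linear snd"
  by (simp add: linear_iff)

lemma hpoly_product:
  fixes K :: "'a::euclidean_space \<Rightarrow> complex" and G :: "'b::euclidean_space \<Rightarrow> complex"
  assumes "K \<in> hpoly a" "G \<in> hpoly b"
  shows "(\<lambda>(u, v). K u * G v) \<in> hpoly (a + b)"
proof -
  have "(\<lambda>(u, v). K u * G v) = (K \<circ> fst) * (G \<circ> snd)" by (auto simp: fun_eq_iff fapply)
  then show ?thesis
    by (simp only: hpoly_mult[OF hpoly_compose_linear[OF assms(1) linear_fst']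
        hpoly_compose_linear[OF assms(2) linear_snd']])
qed

lemma tensor_space_hpoly:
  fixes A :: "('a::euclidean_space \<Rightarrow> complex) set" and B :: "('b::euclidean_space \<Rightarrow> complex) set"
  assumes "F \<in> tensor_space A B" "A \<subseteq> hpoly a" "B \<subseteq> hpoly b"
  shows "F \<in> hpoly (a + b)"
  using assms(1)
  by (induction rule: tensor_space_induct)
     (use assms in \<open>auto intro!: hpoly_zero hpoly_add hpoly_cscale hpoly_product\<close>)

definition nsq1 :: "'a::euclidean_space \<times> 'b::euclidean_space \<Rightarrow> complex"
  where "nsq1 = nsq \<circ> fst"

definition nsq2 :: "'a::euclidean_space \<times> 'b::euclidean_space \<Rightarrow> complex"
  where "nsq2 = nsq \<circ> snd"

lemma nsq1_apply: "nsq1 (u, v) = nsq u" and nsq2_apply: "nsq2 (u, v) = nsq v"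
  by (simp_all add: nsq1_def nsq2_def)

lemma nsq_product: "nsq = nsq1 + nsq2"
  by (auto simp: fun_eq_iff fapply nsq1_def nsq2_def nsq_def)

lemma nsq1_hpoly: "nsq1 \<in> hpoly 2" and nsq2_hpoly: "nsq2 \<in> hpoly 2"
  unfolding nsq1_def nsq2_def
  by (rule hpoly_compose_linear[OF nsq_hpoly] linear_fst' linear_snd')+

lemma polynomial_nsq1: "polynomial_function nsq1" and polynomial_nsq2: "polynomial_function nsq2"
  by (rule polynomial_hpoly nsq1_hpoly nsq2_hpoly)+

lemma nsq1_power_hpoly: "f \<in> hpoly k \<Longrightarrow> nsq1 ^ s * f \<in> hpoly (2 * s + k)"
  using hpoly_mult[OF hpoly_power[OF nsq1_hpoly, of s], of f k] by (simp add: mult.commute)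

text \<open>The factor \<open>nsq1 ^ s\<close> is moved from the tensor product into the map. Each
  summand of the decomposition thus becomes the image of \<open>harmonic_tensor k i\<close>, which
  does not depend on \<open>s\<close>.\<close>

definition lift :: "nat \<Rightarrow> ('a::euclidean_space \<times> 'b::euclidean_space \<Rightarrow> complex) \<Rightarrow> 'a \<times> 'b \<Rightarrow> complex"
  where "lift s F = harmonic_projection (nsq1 ^ s * F)"

abbreviation harmonic_tensor ::
  "nat \<Rightarrow> nat \<Rightarrow> ('a::euclidean_space \<times> 'b::euclidean_space \<Rightarrow> complex) set"
  where "harmonic_tensor k i \<equiv> tensor_space (harmonic_homogeneous k) (harmonic_homogeneous i)"

lemma harmonic_tensor_hpoly: "F \<in> harmonic_tensor k i \<Longrightarrow> F \<in> hpoly (k + i)"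
  by (erule tensor_space_hpoly) (auto dest: harmonic_homogeneousD)

lemma tau_H_image:
  fixes A :: "('a::euclidean_space \<Rightarrow> complex) set" and B :: "('b::euclidean_space \<Rightarrow> complex) set"
  shows "tau_H ` tensor_space (norm_power_mult s ` A) B = lift s ` tensor_space A B"
proof -
  have eq: "(\<lambda>(u, v). norm_power_mult s K u * G v) = nsq1 ^ s * (\<lambda>(u, v). K u * G v)"
    for K :: "'a \<Rightarrow> complex" and G :: "'b \<Rightarrow> complex"
    by (auto simp: fun_eq_iff fapply norm_power_mult_eq nsq1_def)
  have lin: "nsq1 ^ s * (cscale c f + g) = cscale c (nsq1 ^ s * f) + nsq1 ^ s * g"
    for c and f g :: "'a \<times> 'b \<Rightarrow> complex"
    by (simp add: fun_eq_iff fapply algebra_simps)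
  note sub = cfun.subspace_add[OF tensor_space_subspace] cfun.subspace_scale[OF tensor_space_subspace]
  have "F \<in> (\<lambda>F. nsq1 ^ s * F) ` tensor_space A B"
    if "F \<in> tensor_space (norm_power_mult s ` A) B" for F
    using that
  proof (induction rule: tensor_space_induct)
    case zero
    have "(0 :: 'a \<times> 'b \<Rightarrow> complex) = nsq1 ^ s * 0" by simp
    then show ?case using cfun.subspace_0[OF tensor_space_subspace] by (rule image_eqI)
  next
    case (step c K' G F)
    then obtain K F' where K: "K' = norm_power_mult s K" "K \<in> A"
      and F': "F = nsq1 ^ s * F'" "F' \<in> tensor_space A B" by auto
    have "cscale c (\<lambda>(u, v). K' u * G v) + F = nsq1 ^ s * (cscale c (\<lambda>(u, v). K u * G v) + F')"
      unfolding K F' eq lin ..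
    moreover have "cscale c (\<lambda>(u, v). K u * G v) + F' \<in> tensor_space A B"
      by (intro sub tensor_space_base K F' step)
    ultimately show ?case by (rule image_eqI)
  qed
  moreover have "nsq1 ^ s * F \<in> tensor_space (norm_power_mult s ` A) B"
    if "F \<in> tensor_space A B" for F
    using that
  proof (induction rule: tensor_space_induct)
    case zero
    then show ?case by (simp add: cfun.subspace_0[OF tensor_space_subspace])
  next
    case (step c K G F)
    then show ?case
      unfolding lin eq[symmetric] by (intro sub tensor_space_base imageI)
  qed
  ultimately have "tensor_space (norm_power_mult s ` A) B = (\<lambda>F. nsq1 ^ s * F) ` tensor_space A B"
    by blast
  then show ?thesis by (simp add: image_image tau_H_def lift_def)
qed

lemma linear_on_space_lift:
  assumes "\<And>F. F \<in> D \<Longrightarrow> polynomial_function F"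
  shows "linear_on_space D (lift s)"
  unfolding linear_on_space_def lift_def
  by (auto simp: distrib_left cscale_mult_right assms poly_intros polynomial_nsq1
      intro!: harmonic_projection_add harmonic_projection_cscale)

lemma linear_on_space_lift_harmonic: "linear_on_space (harmonic_tensor k i) (lift s)"
  by (rule linear_on_space_lift) (blast intro: polynomial_hpoly harmonic_tensor_hpoly)

lemma lift_mem: "F \<in> harmonic_tensor k i \<Longrightarrow> lift s F \<in> harmonic_homogeneous (2 * s + k + i)"
  unfolding lift_def
  using harmonic_projection_hpoly[OF nsq1_power_hpoly[OF harmonic_tensor_hpoly]]
  by (simp add: add.assoc)

subsection \<open>Injectivity of the harmonic projection\<close>

text \<open>For applications read \<open>nsq\<close> as the squared norm of v and \<open>c\<close>
  as that of a frozen u. With Fischer components \<open>g t\<close> of \<open>q\<close>, the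
  right-hand side has component \<open>c\<close> times \<open>g t\<close> plus
  \<open>g (t - 1)\<close> at every positive t, and the left-hand side has none. Starting above the
  top component, where only one of the two terms is left, all \<open>g t\<close> vanish in
  descending order.\<close>

lemma harmonic_shifted_nsq_zero:
  fixes f q :: "'a::euclidean_space \<Rightarrow> complex"
  assumes "f \<in> harmonic_polys" "polynomial_function q" "f = cscale c q + nsq * q"
  shows "q = 0"
proof -
  obtain N g where g: "\<And>s. g s \<in> harmonic_polys" "q = (\<Sum>s\<le>N. nsq ^ s * g s)"
    using fischer_exists[OF assms(2)] by blast
  note sub = subspace_harmonic_polys
  define G where "G t = (if t \<le> N then cscale c (g t) else 0) +
    (case t of 0 \<Rightarrow> - f | Suc t \<Rightarrow> g t)" for t
  have "(\<Sum>t\<le>Suc N. nsq ^ t * G t) =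
      (\<Sum>t\<le>Suc N. nsq ^ t * (if t \<le> N then cscale c (g t) else 0)) +
      (\<Sum>t\<le>Suc N. nsq ^ t * (case t of 0 \<Rightarrow> - f | Suc t \<Rightarrow> g t))"
    unfolding G_def distrib_left sum.distrib ..
  also have "(\<Sum>t\<le>Suc N. nsq ^ t * (if t \<le> N then cscale c (g t) else 0)) = cscale c q"
    unfolding g(2) cfun.scale_sum_right
    by (rule sum.mono_neutral_cong_right) (auto simp: cscale_mult_right)
  also have "(\<Sum>t\<le>Suc N. nsq ^ t * (case t of 0 \<Rightarrow> - f | Suc t \<Rightarrow> g t)) = - f + nsq * q"
    unfolding g(2) nsq_shift ..
  also have "cscale c q + (- f + nsq * q) = 0"
    by (subst assms(3)) simp
  finally have sum0: "(\<Sum>t\<le>Suc N. nsq ^ t * G t) = 0" .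
  have "G t \<in> harmonic_polys" for t
    unfolding G_def using g assms(1)
    by (auto split: nat.split simp del: add_uminus_conv_diff intro!: cfun.subspace_add[OF sub]
        cfun.subspace_scale[OF sub] cfun.subspace_neg[OF sub] cfun.subspace_0[OF sub])
  then have G0: "G t = 0" if "t \<le> Suc N" for t
    using fischer_unique[of "Suc N" G t] sum0 that by blast
  have "g (N - j) = 0" if "j \<le> N" for j
    using that
  proof (induction j)
    case 0
    then show ?case using G0[of "Suc N"] by (simp add: G_def)
  next
    case (Suc j)
    then have "N - j = Suc (N - Suc j)" by simp
    then show ?case using G0[of "N - j"] Suc by (simp add: G_def split: if_splits)
  qed
  then have "g s = 0" if "s \<le> N" for s
    using that by (metis diff_diff_cancel diff_le_self)
  then show "q = 0" unfolding g(2) by (intro sum.neutral) auto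
qed

text \<open>A vanishing projection means that \<open>F\<close> is the squared norm times some
  \<open>Q\<close>. For frozen u this is \<open>harmonic_shifted_nsq_zero\<close> in the variable v.
  Harmonicity in v is what survives multiplication by powers of the squared norm of u.\<close>

lemma harmonic_projection_inj:
  fixes F :: "'a::euclidean_space \<times> 'b::euclidean_space \<Rightarrow> complex"
  assumes "polynomial_function F" "\<And>u. (\<lambda>v. F (u, v)) \<in> harmonic_polys"
    and "harmonic_projection F = 0"
  shows "F = 0"
proof -
  obtain Q where Q: "polynomial_function Q" "F = nsq * Q"
    using harmonic_projection_decompose[OF assms(1)] assms(3) by auto
  have "(\<lambda>v. Q (u, v)) = 0" for u
  proof (rule harmonic_shifted_nsq_zero)
    show "(\<lambda>v. F (u, v)) \<in> harmonic_polys" by fact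
    have "polynomial_function (\<lambda>v::'b. (u, v))"
      using polynomial_function_add[OF polynomial_function_const[of "(u, 0)"]
          polynomial_function_bounded_linear[OF bounded_linear_Pair[OF bounded_linear_zero
            bounded_linear_ident]]] by simp
    then show "polynomial_function (\<lambda>v. Q (u, v))"
      using polynomial_function_compose[of "\<lambda>v. (u, v)" Q] Q(1) by (simp add: o_def)
    show "(\<lambda>v. F (u, v)) = cscale (nsq u) (\<lambda>v. Q (u, v)) + nsq * (\<lambda>v. Q (u, v))"
      by (simp add: fun_eq_iff fapply Q(2) nsq_product nsq1_apply nsq2_apply algebra_simps)
  qed
  then have "Q = 0" by (auto simp: fun_eq_iff fapply)
  then show ?thesis by (simp add: Q)
qed

lemma harmonic_projection_diff:
  assumes "polynomial_function f" "polynomial_function (g :: 'a::euclidean_space \<Rightarrow> complex)"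
  shows "harmonic_projection (f - g) = harmonic_projection f - harmonic_projection g"
  using harmonic_projection_add[OF polynomial_function_minus'[OF assms] assms(2)]
  by (simp add: eq_diff_eq)

definition idx :: "nat \<Rightarrow> (nat \<times> nat \<times> nat) set"
  where "idx n = {(s, k, i). 2 * s + k + i = n}"

lemma finite_idx: "finite (idx n)"
  by (rule finite_subset[of _ "{..n} \<times> {..n} \<times> {..n}"]) (auto simp: idx_def)

text \<open>Freeze v and split by the degree in u. What remains is a Fischer decomposition in the
  first variable alone.\<close>

lemma harmonic_tensor_independent:
  fixes F :: "nat \<times> nat \<times> nat \<Rightarrow> 'a::euclidean_space \<times> 'b::euclidean_space \<Rightarrow> complex"
  assumes F: "\<And>s k i. (s, k, i) \<in> idx n \<Longrightarrow> F (s, k, i) \<in> harmonic_tensor k i"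
    and zero: "(\<Sum>t\<in>idx n. nsq1 ^ fst t * F t) = 0" and t: "(s, k, i) \<in> idx n"
  shows "F (s, k, i) = 0"
proof -
  have "F (s, k, i) (u, v) = 0" for u v
  proof -
    define f where "f t = (\<lambda>u. F t (u, v))" for t
    have f: "f (s, k, i) \<in> harmonic_homogeneous k" if "(s, k, i) \<in> idx n" for s k i
      unfolding f_def by (rule tensor_space_section1[OF F[OF that] subspace_harmonic_homogeneous])
    define m where "m = 2 * s + k"
    have mn: "m \<le> n" "i = n - m" using t by (auto simp: idx_def m_def)
    have "(\<Sum>t\<in>idx n. nsq ^ fst t * f t) = 0"
    proof
      fix u
      have "(\<Sum>t\<in>idx n. nsq1 ^ fst t * F t) (u, v) = 0" by (simp add: zero fapply)
      then show "(\<Sum>t\<in>idx n. nsq ^ fst t * f t) u = 0 u"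
        by (simp add: fapply f_def nsq1_apply)
    qed
    then have "(\<Sum>t\<in>{t\<in>idx n. 2 * fst t + fst (snd t) = m}. nsq ^ fst t * f t) = 0"
      by (rule hpoly_graded[OF finite_idx, rotated])
         (use nsq_power_hpoly[OF harmonic_homogeneousD(1)[OF f]] in auto)
    \<comment> \<open>The degree \<open>m\<close> in u determines \<open>i = n - m\<close>, and then
      \<open>s\<close> determines \<open>k\<close>, so each power of the squared norm occurs
      once.\<close>
    also have "{t\<in>idx n. 2 * fst t + fst (snd t) = m} = (\<lambda>s. (s, m - 2 * s, n - m)) ` {..m div 2}"
    proof (intro equalityI subsetI)
      fix t assume "t \<in> {t\<in>idx n. 2 * fst t + fst (snd t) = m}"
      then obtain s' k' i' where "t = (s', k', i')" "2 * s' + k' + i' = n" "2 * s' + k' = m"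
        by (cases t) (auto simp: idx_def)
      then show "t \<in> (\<lambda>s. (s, m - 2 * s, n - m)) ` {..m div 2}"
        by (intro image_eqI[of _ _ s']) auto
    qed (use mn in \<open>auto simp: idx_def\<close>)
    also have "(\<Sum>t\<in>(\<lambda>s. (s, m - 2 * s, n - m)) ` {..m div 2}. nsq ^ fst t * f t) =
      (\<Sum>s\<le>m div 2. nsq ^ s * f (s, m - 2 * s, n - m))"
      by (subst sum.reindex) (auto simp: inj_on_def)
    finally have "f (s, m - 2 * s, n - m) = 0"
      using mn by (intro fischer_unique_homogeneous[of "m div 2" "\<lambda>s. f (s, m - 2 * s, n - m)"
            "\<lambda>s. m - 2 * s"] f) (auto simp: m_def idx_def)
    then have "f (s, k, i) = 0" using mn by (simp add: m_def)
    then show ?thesis by (simp add: f_def fun_eq_iff fapply)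
  qed
  then show ?thesis by (auto simp: fun_eq_iff fapply)
qed

text \<open>Before projection the sum is harmonic in v, hence it vanishes together with its
  projection, and the terms can be separated without the projection.\<close>

lemma lift_independent:
  fixes F :: "nat \<times> nat \<times> nat \<Rightarrow> 'a::euclidean_space \<times> 'b::euclidean_space \<Rightarrow> complex"
  assumes F: "\<And>s k i. (s, k, i) \<in> idx n \<Longrightarrow> F (s, k, i) \<in> harmonic_tensor k i"
    and zero: "(\<Sum>t\<in>idx n. lift (fst t) (F t)) = 0" and t: "(s, k, i) \<in> idx n"
  shows "F (s, k, i) = 0"
proof (rule harmonic_tensor_independent[OF F _ t])
  have pol: "polynomial_function (nsq1 ^ fst t * F t)" if "t \<in> idx n" for t
    using that F[of "fst t" "fst (snd t)" "snd (snd t)"]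
    by (auto intro!: poly_intros polynomial_nsq1 intro: polynomial_hpoly harmonic_tensor_hpoly)
  show "(\<Sum>t\<in>idx n. nsq1 ^ fst t * F t) = 0"
  proof (rule harmonic_projection_inj)
    show "polynomial_function (\<Sum>t\<in>idx n. nsq1 ^ fst t * F t)"
      using pol by (rule polynomial_function_fun_sum)
    show "harmonic_projection (\<Sum>t\<in>idx n. nsq1 ^ fst t * F t) = 0"
      using zero pol by (subst harmonic_projection_sum) (auto simp: lift_def)
    fix u
    have "(\<lambda>v. (\<Sum>t\<in>idx n. nsq1 ^ fst t * F t) (u, v)) =
        (\<Sum>t\<in>idx n. cscale (nsq u ^ fst t) (\<lambda>v. F t (u, v)))"
      by (simp add: fun_eq_iff fapply nsq1_apply)
    also have "\<dots> \<in> harmonic_polys"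
    proof (intro cfun.subspace_sum cfun.subspace_scale subspace_harmonic_polys)
      fix t assume t: "t \<in> idx n"
      obtain s k i where ski: "t = (s, k, i)" by (cases t) auto
      show "(\<lambda>v. F t (u, v)) \<in> harmonic_polys"
        using tensor_space_section2[OF F[of s k i] subspace_harmonic_homogeneous] t
        unfolding ski by (blast intro: harmonic_homogeneous_polys)
    qed
    finally show "(\<lambda>v. (\<Sum>t\<in>idx n. nsq1 ^ fst t * F t) (u, v)) \<in> harmonic_polys" .
  qed
qed

text \<open>Injectivity is independence of a family with a single nonzero member.\<close>

lemma lift_eq_0:
  assumes "F \<in> harmonic_tensor k i" "lift s F = 0"
  shows "F = 0"
proof -
  define n where "n = 2 * s + k + i"
  have t: "(s, k, i) \<in> idx n" by (simp add: idx_def n_def)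
  define F' where "F' t = (if t = (s, k, i) then F else 0)" for t
  have "lift a 0 = 0" for a by (simp add: lift_def harmonic_projection_zero)
  then have "(\<Sum>t\<in>idx n. lift (fst t) (F' t)) = (\<Sum>t\<in>idx n. 0)"
    using assms(2) by (intro sum.cong) (auto simp: F'_def)
  then have "(\<Sum>t\<in>idx n. lift (fst t) (F' t)) = 0" by simp
  moreover have "F' (s, k, i) \<in> harmonic_tensor k i" for s k i
    using assms(1) cfun.subspace_0[OF tensor_space_subspace] by (auto simp: F'_def)
  ultimately have "F' (s, k, i) = 0" using lift_independent[of n F'] t by blast
  then show ?thesis by (simp add: F'_def)
qed

subsection \<open>The direct sum decomposition\<close>

definition product_span :: "nat \<Rightarrow> ('a::euclidean_space \<times> 'b::euclidean_space \<Rightarrow> complex) set"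
  where "product_span n = cfun.span {(\<lambda>(u, v). K u * G v) |K G a b.
    K \<in> hpoly a \<and> G \<in> hpoly b \<and> a + b = n}"

lemma product_span_base: "K \<in> hpoly a \<Longrightarrow> G \<in> hpoly b \<Longrightarrow> a + b = n \<Longrightarrow>
    (\<lambda>(u, v). K u * G v) \<in> product_span n"
  unfolding product_span_def by (rule cfun.span_base) blast

lemma hpoly_product_span:
  assumes "f \<in> hpoly n"
  shows "f \<in> product_span n"
  using assms
proof (induction rule: hpoly_induct)
  case one
  have eq: "(\<lambda>(u, v). 1 u * 1 v) = (1 :: 'a \<times> 'b \<Rightarrow> complex)" by (auto simp: fun_eq_iff fapply)
  have "(\<lambda>(u, v). 1 u * 1 v) \<in> (product_span 0 :: ('a \<times> 'b \<Rightarrow> complex) set)"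
    by (rule product_span_base[OF hpoly_0 hpoly_0]) simp
  then show ?case by (simp only: eq)
next
  case (mult n c f)
  have "coord c * f \<in> product_span (Suc n)"
    using mult.IH unfolding product_span_def
  proof (induction rule: cfun.span_induct_alt)
    case base
    then show ?case by (simp add: cfun.span_zero)
  next
    case (step z x y)
    then obtain K G a b where KG: "x = (\<lambda>(u, v). K u * G v)" "K \<in> hpoly a" "G \<in> hpoly b" "a + b = n"
      by blast
    have "coord c * x \<in> product_span (Suc n)"
    proof (cases "snd c = 0")
      case True
      then have "coord c * x = (\<lambda>(u, v). (coord (fst c) * K) u * G v)"
        by (auto simp: fun_eq_iff fapply KG coord_def inner_prod_def)
      then show ?thesis
        using product_span_base[OF hpoly_coord_mult[OF KG(2)] KG(3), of "Suc n"] KG by simp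
    next
      case False
      then have "fst c = 0" using \<open>c \<in> Basis\<close> by (auto simp: Basis_prod_def)
      then have "coord c * x = (\<lambda>(u, v). K u * (coord (snd c) * G) v)"
        by (auto simp: fun_eq_iff fapply KG coord_def inner_prod_def)
      then show ?thesis
        using product_span_base[OF KG(2) hpoly_coord_mult[OF KG(3)], of "Suc n"] KG by simp
    qed
    moreover have "coord c * (cscale z x + y) = cscale z (coord c * x) + coord c * y"
      by (simp add: fun_eq_iff fapply algebra_simps)
    ultimately show ?case
      using step unfolding product_span_def by (simp add: cfun.span_add cfun.span_scale)
  qed
  then show ?case .
qed (simp_all add: product_span_def cfun.span_zero cfun.span_add cfun.span_scale)

lemma direct_sum_lift:
  "direct_sum (harmonic_homogeneous n :: ('a::euclidean_space \<times> 'b::euclidean_space \<Rightarrow> complex) set)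
    (idx n) (\<lambda>(s, k, i). lift s ` harmonic_tensor k i)"
proof -
  define U :: "nat \<times> nat \<times> nat \<Rightarrow> ('a \<times> 'b \<Rightarrow> complex) set"
    where "U = (\<lambda>(s, k, i). lift s ` harmonic_tensor k i)"
  have U: "U (s, k, i) = lift s ` harmonic_tensor k i" for s k i by (simp add: U_def)
  define S where "S = {(\<Sum>t\<in>idx n. f t) |f. \<forall>t\<in>idx n. f t \<in> U t}"
  have subU: "cfun.subspace (U t)" for t
    by (cases t) (auto simp: U intro!: subspace_image[OF linear_on_space_lift_harmonic]
        tensor_space_subspace)
  have subS: "cfun.subspace S" unfolding S_def using subU by (rule subspace_sums_family)
  have U_le: "U t \<subseteq> harmonic_homogeneous n" if "t \<in> idx n" for t
    using that lift_mem by (cases t) (auto simp: U idx_def)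
  have US: "x \<in> S" if "t \<in> idx n" "x \<in> U t" for t x
    unfolding S_def using subU that by (intro mem_sums_family[where U = U] finite_idx)
  \<comment> \<open>Modulo multiples of \<open>nsq\<close>, which the projection kills, each factor
    \<open>nsq2\<close> may be traded for \<open>- nsq1\<close>. The exponent \<open>s\<close> grows
    in the process and is therefore arbitrary in the induction on \<open>t\<close>.\<close>
  have 1: "harmonic_projection (nsq1 ^ s * nsq2 ^ t * F) \<in> S"
    if "F \<in> harmonic_tensor k i" "2 * s + 2 * t + k + i = n" for s t k i F
    using that(2)
  proof (induction t arbitrary: s)
    case 0
    then have "(s, k, i) \<in> idx n" by (simp add: idx_def)
    moreover have "harmonic_projection (nsq1 ^ s * nsq2 ^ 0 * F) \<in> U (s, k, i)"
      using that by (auto simp: U lift_def)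
    ultimately show ?case by (rule US)
  next
    case (Suc t)
    have pol: "polynomial_function (nsq1 ^ a * nsq2 ^ t * F)" for a
      using that by (auto intro!: poly_intros polynomial_nsq1 polynomial_nsq2 intro: polynomial_hpoly harmonic_tensor_hpoly)
    have eq: "nsq1 ^ s * nsq2 ^ Suc t * F =
      nsq * (nsq1 ^ s * nsq2 ^ t * F) - nsq1 ^ Suc s * nsq2 ^ t * F"
      unfolding nsq_product by (simp add: fun_eq_iff fapply algebra_simps)
    have "harmonic_projection (nsq1 ^ s * nsq2 ^ Suc t * F) =
        0 - harmonic_projection (nsq1 ^ Suc s * nsq2 ^ t * F)"
      unfolding eq using harmonic_projection_diff[OF polynomial_function_times[OF polynomial_nsq pol] pol]
        harmonic_projection_nsq[OF pol] by (simp del: power_Suc)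
    moreover have "harmonic_projection (nsq1 ^ Suc s * nsq2 ^ t * F) \<in> S"
      using Suc.prems by (intro Suc.IH) simp
    ultimately show ?case
      using cfun.subspace_diff[OF subS cfun.subspace_0[OF subS]] by (simp del: power_Suc)
  qed
  have 2: "harmonic_projection (\<lambda>(u, v). K u * G v) \<in> S"
    if KG: "K \<in> hpoly a" "G \<in> hpoly b" "a + b = n" for K :: "'a \<Rightarrow> complex" and G :: "'b \<Rightarrow> complex" and a b
  proof -
    obtain h where h: "\<And>s. 2 * s \<le> a \<Longrightarrow> h s \<in> harmonic_homogeneous (a - 2 * s)"
      "K = (\<Sum>s\<le>a div 2. nsq ^ s * h s)"
      using fischer_exists_homogeneous[OF KG(1)] by blast
    obtain g where g: "\<And>s. 2 * s \<le> b \<Longrightarrow> g s \<in> harmonic_homogeneous (b - 2 * s)"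
      "G = (\<Sum>s\<le>b div 2. nsq ^ s * g s)"
      using fischer_exists_homogeneous[OF KG(2)] by blast
    define T where "T s t = nsq1 ^ s * nsq2 ^ t * (\<lambda>(u, v). h s u * g t v)" for s t
    have mem: "(\<lambda>(u, v). h s u * g t v) \<in> harmonic_tensor (a - 2 * s) (b - 2 * t)"
      if "s \<le> a div 2" "t \<le> b div 2" for s t
      using that by (intro tensor_space_base h g) auto
    have pol: "polynomial_function (T s t)" if "s \<le> a div 2" "t \<le> b div 2" for s t
      unfolding T_def using mem[OF that]
      by (auto intro!: poly_intros polynomial_nsq1 polynomial_nsq2 intro: polynomial_hpoly harmonic_tensor_hpoly)
    have "(\<lambda>(u, v). K u * G v) = (\<Sum>s\<le>a div 2. \<Sum>t\<le>b div 2. T s t)"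
    proof (rule ext, clarify)
      fix u v
      have "K u * G v = (\<Sum>s\<le>a div 2. \<Sum>t\<le>b div 2. (nsq u ^ s * h s u) * (nsq v ^ t * g t v))"
        unfolding h(2) g(2) fapply sum_product ..
      then show "K u * G v = (\<Sum>s\<le>a div 2. \<Sum>t\<le>b div 2. T s t) (u, v)"
        by (simp add: T_def fapply nsq1_apply nsq2_apply algebra_simps)
    qed
    then have "harmonic_projection (\<lambda>(u, v). K u * G v) =
        harmonic_projection (\<Sum>s\<le>a div 2. \<Sum>t\<le>b div 2. T s t)" by simp
    also have "\<dots> = (\<Sum>s\<le>a div 2. harmonic_projection (\<Sum>t\<le>b div 2. T s t))"
      by (rule harmonic_projection_sum) (auto intro!: polynomial_function_fun_sum pol)
    also have "\<dots> = (\<Sum>s\<le>a div 2. \<Sum>t\<le>b div 2. harmonic_projection (T s t))"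
      by (intro sum.cong refl harmonic_projection_sum pol) auto
    also have "\<dots> \<in> S"
      unfolding T_def using KG(3) by (intro cfun.subspace_sum[OF subS] 1[OF mem]) auto
    finally show ?thesis .
  qed
  have 3: "harmonic_projection f \<in> S" if "f \<in> hpoly n" for f
  proof -
    \<comment> \<open>Polynomiality is carried along because the projection is known to be additive
      only on polynomials.\<close>
    have "polynomial_function f \<and> harmonic_projection f \<in> S"
      using hpoly_product_span[OF that] unfolding product_span_def
    proof (induction rule: cfun.span_induct_alt)
      case base
      then show ?case
        using cfun.subspace_0[OF subS] by (auto simp: harmonic_projection_zero poly_intros)
    next
      case (step c x y)
      then have "polynomial_function x" "harmonic_projection x \<in> S"
        using 2 hpoly_product polynomial_hpoly by blast+
      then show ?case
        using step cfun.subspace_add[OF subS] cfun.subspace_scale[OF subS]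
        by (auto simp: poly_intros harmonic_projection_add harmonic_projection_cscale)
    qed
    then show ?thesis by simp
  qed
  have sum_eq: "harmonic_homogeneous n = S"
  proof
    show "harmonic_homogeneous n \<subseteq> S"
    proof
      fix f :: "'a \<times> 'b \<Rightarrow> complex" assume f: "f \<in> harmonic_homogeneous n"
      then have "harmonic_projection f \<in> S" by (intro 3 harmonic_homogeneousD)
      then show "f \<in> S" using f harmonic_projection_harmonic harmonic_homogeneous_polys by metis
    qed
    show "S \<subseteq> harmonic_homogeneous n"
    proof
      fix x assume "x \<in> S"
      then obtain f where f: "x = (\<Sum>t\<in>idx n. f t)" "\<And>t. t \<in> idx n \<Longrightarrow> f t \<in> U t"
        unfolding S_def by blast
      show "x \<in> harmonic_homogeneous n"
        unfolding f(1) by (rule cfun.subspace_sum[OF subspace_harmonic_homogeneous]) (use f U_le in blast)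
    qed
  qed
  have unique: "\<forall>t\<in>idx n. f t = 0"
    if f: "\<forall>t\<in>idx n. f t \<in> U t" and zero: "(\<Sum>t\<in>idx n. f t) = 0" for f
  proof -
    have "\<forall>t\<in>idx n. \<exists>F. F \<in> harmonic_tensor (fst (snd t)) (snd (snd t)) \<and> f t = lift (fst t) F"
      using f by (fastforce simp: U)
    then obtain F where F: "\<And>t. t \<in> idx n \<Longrightarrow> F t \<in> harmonic_tensor (fst (snd t)) (snd (snd t))"
      "\<And>t. t \<in> idx n \<Longrightarrow> f t = lift (fst t) (F t)"
      unfolding bchoice_iff by blast
    have "(\<Sum>t\<in>idx n. lift (fst t) (F t)) = 0" using zero F(2) by simp
    then have "F (s, k, i) = 0" if "(s, k, i) \<in> idx n" for s k i
      using F(1) that by (intro lift_independent[of n F s k i]) force+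
    then have "f (s, k, i) = 0" if "(s, k, i) \<in> idx n" for s k i
      using F(2)[OF that] that by (simp add: lift_def harmonic_projection_zero)
    then show ?thesis by auto
  qed
  show ?thesis
    unfolding direct_sum_def U_def[symmetric]
  proof (intro conjI allI impI)
    show "harmonic_homogeneous n = {(\<Sum>t\<in>idx n. f t) |f. \<forall>t\<in>idx n. f t \<in> U t}"
      using sum_eq unfolding S_def .
    fix f assume "(\<forall>t\<in>idx n. f t \<in> U t) \<and> (\<Sum>t\<in>idx n. f t) = 0"
    then show "\<forall>t\<in>idx n. f t = 0" using unique by blast
  qed (use finite_idx subU in simp_all)
qed

section \<open>An invariant Hermitian form on homogeneous polynomials\<close>

text \<open>On homogeneous polynomials of degree \<open>k\<close> this is \<open>k!\<close> times the Fischer inner product.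
  The recursion gives invariance under orthogonal maps and definiteness by induction on \<open>k\<close>, the
  latter through Euler's identity.\<close>

fun fip :: "nat \<Rightarrow> ('a::euclidean_space \<Rightarrow> complex) \<Rightarrow> ('a \<Rightarrow> complex) \<Rightarrow> complex" where
  "fip 0 f g = f 0 * cnj (g 0)"
| "fip (Suc k) f g = (\<Sum>b\<in>Basis. fip k (pd b f) (pd b g))"

lemma fip_add_left:
  "polynomial_function f \<Longrightarrow> polynomial_function g \<Longrightarrow> fip k (f + g) h = fip k f h + fip k g h"
  by (induction k arbitrary: f g h) (auto simp: fapply algebra_simps pd_add polynomial_pd sum.distrib)

lemma fip_cscale_left: "polynomial_function f \<Longrightarrow> fip k (cscale c f) h = c * fip k f h"
  by (induction k arbitrary: f h) (auto simp: fapply algebra_simps pd_cscale polynomial_pd sum_distrib_left)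

lemma fip_commute: "fip k g f = cnj (fip k f g)"
proof (induction k arbitrary: f g)
  case (Suc k)
  show ?case unfolding fip.simps cnj_sum by (rule sum.cong[OF refl Suc])
qed simp

lemma fip_add_right:
  "polynomial_function g \<Longrightarrow> polynomial_function h \<Longrightarrow> fip k f (g + h) = fip k f g + fip k f h"
  using fip_add_left[of g h k f] fip_commute[of k f] by (metis complex_cnj_add)

lemma fip_cscale_right: "polynomial_function h \<Longrightarrow> fip k f (cscale c h) = cnj c * fip k f h"
  using fip_cscale_left[of h k c f] fip_commute[of k f] by (metis complex_cnj_mult)

lemma fip_diff_left:
  assumes "polynomial_function f" "polynomial_function g"
  shows "fip k (f - g) h = fip k f h - fip k g h"
  using fip_add_left[OF polynomial_function_minus'[OF assms] assms(2), of k h] by (simp add: eq_diff_eq)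

lemma fip_diff_right:
  assumes "polynomial_function f" "polynomial_function g"
  shows "fip k h (f - g) = fip k h f - fip k h g"
  using fip_add_right[OF polynomial_function_minus'[OF assms] assms(2), of k h] by (simp add: eq_diff_eq)

lemma fip_self_real: "\<exists>r\<ge>0. fip k f f = of_real r"
proof (induction k arbitrary: f)
  case 0
  then show ?case
    by (intro exI[of _ "(Re (f 0))\<^sup>2 + (Im (f 0))\<^sup>2"]) (simp add: complex_mult_cnj)
next
  case (Suc k)
  have r: "Re (fip k h h) \<ge> 0" "fip k h h = of_real (Re (fip k h h))" for h :: "'a \<Rightarrow> complex"
    using Suc[of h] by auto
  have "fip (Suc k) f f = of_real (\<Sum>b\<in>Basis. Re (fip k (pd b f) (pd b f)))"
    unfolding fip.simps of_real_sum by (intro sum.cong refl r(2))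
  moreover have "(\<Sum>b\<in>Basis. Re (fip k (pd b f) (pd b f))) \<ge> 0"
    by (intro sum_nonneg r(1))
  ultimately show ?case by blast
qed

lemma fip_definite:
  fixes f :: "'a::euclidean_space \<Rightarrow> complex"
  shows "f \<in> hpoly k \<Longrightarrow> fip k f f = 0 \<Longrightarrow> f = 0"
proof (induction k arbitrary: f)
  case 0
  then have "f 0 = 0" by simp
  then have "f x = 0" for x using hpoly_0_const[OF 0(1), of x 0] by simp
  then show ?case by (simp add: fun_eq_iff fapply)
next
  case (Suc k)
  have r: "Re (fip k h h) \<ge> 0" "fip k h h = of_real (Re (fip k h h))" for h :: "'a \<Rightarrow> complex"
    using fip_self_real[of k h] by auto
  have "(\<Sum>b\<in>Basis. Re (fip k (pd b f) (pd b f))) = 0"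
    using arg_cong[OF Suc.prems(2), of Re] by simp
  then have "Re (fip k (pd b f) (pd b f)) = 0" if "b \<in> Basis" for b
    using that r(1) by (subst (asm) sum_nonneg_eq_0_iff) auto
  then have "fip k (pd b f) (pd b f) = 0" if "b \<in> Basis" for b
    using that r(2)[of "pd b f"] by (metis of_real_0)
  then have "pd b f = 0" if "b \<in> Basis" for b
    using that Suc.IH[OF pd_hpoly_Suc[OF Suc.prems(1)]] by blast
  then have "cscale (of_nat (Suc k)) f = 0"
    using euler[OF Suc.prems(1)] by simp
  then show ?case unfolding cfun.scale_eq_0_iff of_nat_eq_0_iff by simp
qed

lemma fip_orthogonal:
  fixes f f' :: "'a::euclidean_space \<Rightarrow> complex" and g :: "'a \<Rightarrow> 'a"
  assumes "orthogonal_transformation g"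
  shows "polynomial_function f \<Longrightarrow> polynomial_function f' \<Longrightarrow> fip k (f \<circ> g) (f' \<circ> g) = fip k f f'"
proof (induction k arbitrary: f f')
  case 0
  have "g 0 = 0" by (rule linear_0[OF orthogonal_transformation_linear[OF assms]])
  then show ?case by simp
next
  case (Suc k)
  note lin = orthogonal_transformation_linear[OF assms]
  have "fip (Suc k) (f \<circ> g) (f' \<circ> g) =
      (\<Sum>b\<in>Basis. fip k (pd (g b) f \<circ> g) (pd (g b) f' \<circ> g))"
    using Suc.prems by (simp add: pd_compose lin)
  also have "\<dots> = (\<Sum>b\<in>Basis. fip k (pd (g b) f) (pd (g b) f'))"
    using Suc.prems by (intro sum.cong refl Suc.IH polynomial_pd)
  also have "\<dots> = (\<Sum>b\<in>Basis. fip k (pd b f) (pd b f'))"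
    using Suc.prems
    by (intro trace_orthogonal[OF assms, where \<beta> = "\<lambda>a b. fip k (pd a f) (pd b f')"])
       (simp_all add: pd_direction_add pd_direction_scaleR polynomial_pd fip_add_left fip_add_right
          fip_cscale_left fip_cscale_right)
  finally show ?case unfolding fip.simps .
qed

subsection \<open>Orthogonal projections and representing vectors\<close>

lemma finite_spanning_set:
  fixes W :: "('a::euclidean_space \<Rightarrow> complex) set"
  assumes "cfun.subspace W" "W \<subseteq> hpoly n"
  obtains B where "finite B" "W = cfun.span B"
proof -
  obtain B where B: "B \<subseteq> W" "cfun.independent B" "W \<subseteq> cfun.span B" "card B = cfun.dim W"
    by (rule cfun.basis_exists)
  have "B \<subseteq> cfun.span (hmonos n)" using B(1) assms(2) by (simp add: hpoly_def)
  then have "finite B"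
    using cfun.independent_span_bound[OF finite_hmonos B(2), of n] by simp
  moreover have "W = cfun.span B"
    using B(3) cfun.span_minimal[OF B(1) assms(1)] by (rule subset_antisym)
  ultimately show ?thesis by (rule that)
qed

lemma fip_zero_left: "fip n 0 w = 0" and fip_zero_right: "fip n w 0 = 0"
  using fip_cscale_left[of 0 n 0 w] fip_cscale_right[of 0 n w 0] by (simp_all add: poly_intros)

text \<open>Gram-Schmidt, one spanning vector at a time. The induction hypothesis is used twice, for
  \<open>f\<close> and to make the new vector \<open>b\<close> orthogonal to the span of the old
  ones.\<close>

lemma orthogonal_projection_span:
  fixes f :: "'a::euclidean_space \<Rightarrow> complex"
  assumes "finite B"
  shows "B \<subseteq> hpoly n \<Longrightarrow> f \<in> hpoly n \<Longrightarrow>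
    \<exists>w\<in>cfun.span B. \<forall>w'\<in>cfun.span B. fip n (f - w) w' = 0"
  using assms
proof (induction B arbitrary: f rule: finite_induct)
  case empty
  then show ?case by (simp add: fip_zero_right)
next
  case (insert b B)
  have sp: "cfun.span B \<subseteq> hpoly n"
    using insert.prems(1) by (intro cfun.span_minimal subspace_hpoly) auto
  obtain p where p: "p \<in> cfun.span B" "\<And>w. w \<in> cfun.span B \<Longrightarrow> fip n (b - p) w = 0"
    using insert.IH[of b] insert.prems by auto
  obtain q where q: "q \<in> cfun.span B" "\<And>w. w \<in> cfun.span B \<Longrightarrow> fip n (f - q) w = 0"
    using insert.IH[of f] insert.prems by auto
  define b' where "b' = b - p"
  have h: "b \<in> hpoly n" "p \<in> hpoly n" "q \<in> hpoly n" "b' \<in> hpoly n" "f - q \<in> hpoly n"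
    using insert.prems p q sp by (auto simp: b'_def intro: hpoly_diff)
  note pol = h[THEN polynomial_hpoly]
  have ins: "\<exists>k. w - cscale k b' \<in> cfun.span B" if w: "w \<in> cfun.span (insert b B)" for w
  proof -
    obtain k where k: "w - cscale k b \<in> cfun.span B"
      using w unfolding cfun.span_insert by blast
    have "w - cscale k b' = (w - cscale k b) + cscale k p"
      by (simp add: b'_def cfun.scale_right_diff_distrib)
    then show ?thesis using cfun.span_add[OF k cfun.span_scale[OF p(1)]] by metis
  qed
  have b'B: "fip n b' w = 0" "fip n w b' = 0" if "w \<in> cfun.span B" for w
    using p(2)[OF that] fip_commute[of n w b'] by (simp_all add: b'_def)
  \<comment> \<open>If \<open>b\<close> already lies in the span of \<open>B\<close> then
    \<open>b'\<close> is zero and so is this quotient; the case \<open>True\<close> below deals with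
    it.\<close>
  define c where "c = fip n (f - q) b' / fip n b' b'"
  define w where "w = q + cscale c b'"
  have "w \<in> cfun.span (insert b B)"
    unfolding w_def b'_def using p(1) q(1) cfun.span_mono[of B "insert b B"]
    by (intro cfun.span_add cfun.span_scale cfun.span_diff) (auto intro: cfun.span_base)
  moreover have "fip n (f - w) w' = 0" if w': "w' \<in> cfun.span (insert b B)" for w'
  proof -
    obtain k where k: "w' - cscale k b' \<in> cfun.span B" using ins[OF w'] by blast
    define r where "r = w' - cscale k b'"
    have r: "r \<in> cfun.span B" "polynomial_function r" "w' = r + cscale k b'"
      using k sp polynomial_hpoly by (auto simp: r_def)
    have 1: "fip n (f - w) r = 0"
    proof -
      have eq: "f - w = (f - q) - cscale c b'" by (simp add: w_def)
      show ?thesis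
        unfolding eq using q(2)[OF r(1)] b'B(1)[OF r(1)] pol
        by (simp add: fip_diff_left fip_cscale_left polynomial_function_cscale)
    qed
    have 2: "fip n (f - w) b' = 0"
    proof -
      have eq: "f - w = (f - q) - cscale c b'" by (simp add: w_def)
      have "fip n (f - w) b' = fip n (f - q) b' - c * fip n b' b'"
        unfolding eq using pol by (simp add: fip_diff_left fip_cscale_left polynomial_function_cscale)
      also have "\<dots> = 0"
      proof (cases "fip n b' b' = 0")
        case True
        then have "b' = 0" using h fip_definite by blast
        then show ?thesis by (simp add: fip_zero_right)
      qed (simp add: c_def)
      finally show ?thesis .
    qed
    show ?thesis
      unfolding r(3) using 1 2 r(2) pol
      by (simp add: fip_add_right fip_cscale_right polynomial_function_cscale)
  qed
  ultimately show ?case by blast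
qed

lemma orthogonal_projection:
  fixes f :: "'a::euclidean_space \<Rightarrow> complex"
  assumes "cfun.subspace W" "W \<subseteq> hpoly n" "f \<in> hpoly n"
  obtains w where "w \<in> W" "\<And>w'. w' \<in> W \<Longrightarrow> fip n (f - w) w' = 0"
proof -
  obtain B where B: "finite B" "W = cfun.span B"
    using finite_spanning_set[OF assms(1,2)] by blast
  have "B \<subseteq> hpoly n" using assms(2) B(2) cfun.span_superset by blast
  from orthogonal_projection_span[OF B(1) this assms(3)] show ?thesis
    using that B(2) by blast
qed

definition linear_functional_on :: "('a \<Rightarrow> complex) set \<Rightarrow> (('a \<Rightarrow> complex) \<Rightarrow> complex) \<Rightarrow> bool"
  where "linear_functional_on W \<mu> \<longleftrightarrow>
    (\<forall>f\<in>W. \<forall>g\<in>W. \<mu> (f + g) = \<mu> f + \<mu> g) \<and> (\<forall>c. \<forall>f\<in>W. \<mu> (cscale c f) = c * \<mu> f)"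

lemma linear_functional_onD:
  assumes "linear_functional_on W \<mu>"
  shows "f \<in> W \<Longrightarrow> g \<in> W \<Longrightarrow> \<mu> (f + g) = \<mu> f + \<mu> g"
    and "f \<in> W \<Longrightarrow> \<mu> (cscale c f) = c * \<mu> f"
  using assms by (auto simp: linear_functional_on_def)

lemma representing_vector:
  fixes W :: "('a::euclidean_space \<Rightarrow> complex) set"
  assumes W: "cfun.subspace W" "W \<subseteq> hpoly n" and \<mu>: "linear_functional_on W \<mu>"
  obtains w where "w \<in> W" "\<And>f. f \<in> W \<Longrightarrow> \<mu> f = fip n f w"
proof (cases "\<forall>f\<in>W. \<mu> f = 0")
  case True
  then show ?thesis using that[of 0] cfun.subspace_0[OF W(1)] by (simp add: fip_zero_right)
next
  case False
  then obtain f0 where f0: "f0 \<in> W" "\<mu> f0 \<noteq> 0" by blast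
  define K where "K = {f\<in>W. \<mu> f = 0}"
  note \<mu>D = linear_functional_onD[OF \<mu>]
  have \<mu>diff: "\<mu> (f - g) = \<mu> f - \<mu> g" if "f \<in> W" "g \<in> W" for f g
    using \<mu>D(1)[OF cfun.subspace_diff[OF W(1) that] that(2)] by (simp add: eq_diff_eq)
  have "\<mu> 0 = 0" using \<mu>D(2)[of 0 0] cfun.subspace_0[OF W(1)] by simp
  then have K: "cfun.subspace K"
    unfolding cfun.subspace_def K_def using cfun.subspace_0[OF W(1)] cfun.subspace_add[OF W(1)]
      cfun.subspace_scale[OF W(1)] by (auto simp: \<mu>D)
  have "K \<subseteq> hpoly n" using W by (auto simp: K_def)
  then obtain p where p: "p \<in> K" "\<And>w. w \<in> K \<Longrightarrow> fip n (f0 - p) w = 0"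
    using orthogonal_projection[OF K, of n f0] f0(1) W(2) by blast
  define v where "v = f0 - p"
  have v: "v \<in> W" "\<mu> v \<noteq> 0"
    using p(1) f0 cfun.subspace_diff[OF W(1)] by (auto simp: v_def K_def \<mu>diff)
  have "v \<noteq> 0" using v(2) \<open>\<mu> 0 = 0\<close> by auto
  have hv: "v \<in> hpoly n" using v W by blast
  then have vv: "fip n v v \<noteq> 0" using fip_definite \<open>v \<noteq> 0\<close> by blast
  \<comment> \<open>The multiple of \<open>v\<close> with \<open>fip n v w = \<mu> v\<close>; the
    conjugate appears because the form is conjugate linear in its second argument.\<close>
  define w where "w = cscale (cnj (\<mu> v / fip n v v)) v"
  have "w \<in> W" unfolding w_def using v cfun.subspace_scale[OF W(1)] by blast
  moreover have "\<mu> f = fip n f w" if f: "f \<in> W" for f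
  proof -
    define t where "t = \<mu> f / \<mu> v"
    have "f - cscale t v \<in> K"
      using f v cfun.subspace_diff[OF W(1)] cfun.subspace_scale[OF W(1)]
      by (auto simp: K_def \<mu>diff \<mu>D t_def)
    then have "fip n (f - cscale t v) v = 0"
      using p(2) fip_commute[of n _ v] by (metis complex_cnj_zero v_def)
    then have "fip n f v = t * fip n v v"
      using f W(2) hv by (subst (asm) fip_diff_left)
        (auto simp: fip_cscale_left polynomial_hpoly poly_intros)
    then show ?thesis
      using vv v hv by (simp add: w_def fip_cscale_right polynomial_hpoly t_def)
  qed
  ultimately show ?thesis using that by blast
qed

section \<open>Spherical subspaces\<close>

definition isometry_group :: "('a::euclidean_space \<Rightarrow> 'a) set \<Rightarrow> bool"
  where "isometry_group \<Gamma> \<longleftrightarrow> (\<lambda>x. x) \<in> \<Gamma> \<and> (\<forall>\<gamma>\<in>\<Gamma>. orthogonal_transformation \<gamma>) \<and>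
    (\<forall>\<gamma>\<in>\<Gamma>. \<exists>\<delta>\<in>\<Gamma>. \<forall>x. \<gamma> (\<delta> x) = x \<and> \<delta> (\<gamma> x) = x)"

lemma isometry_groupD:
  assumes "isometry_group \<Gamma>"
  shows "(\<lambda>x. x) \<in> \<Gamma>" "\<gamma> \<in> \<Gamma> \<Longrightarrow> orthogonal_transformation \<gamma>"
  using assms by (auto simp: isometry_group_def)

lemma isometry_group_inverse:
  assumes "isometry_group \<Gamma>" "\<gamma> \<in> \<Gamma>"
  obtains \<delta> where "\<delta> \<in> \<Gamma>" "\<And>x. \<gamma> (\<delta> x) = x" "\<And>x. \<delta> (\<gamma> x) = x"
  using assms unfolding isometry_group_def by blast

text \<open>The last clause says that the functions fixed by the stabiliser of \<open>x0\<close>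
  form at most a line. The spanning function \<open>z\<close> may lie outside \<open>C\<close>, so a
  candidate such as a projected power can be named without first placing it in
  \<open>C\<close>.\<close>

definition spherical :: "('a \<Rightarrow> 'a) set \<Rightarrow> 'a \<Rightarrow> ('a \<Rightarrow> complex) set \<Rightarrow> bool"
  where "spherical \<Gamma> x0 C \<longleftrightarrow> cfun.subspace C \<and> (\<forall>\<gamma>\<in>\<Gamma>. \<forall>f\<in>C. f \<circ> \<gamma> \<in> C) \<and>
    (\<forall>f\<in>C. (\<forall>\<gamma>\<in>\<Gamma>. f (\<gamma> x0) = 0) \<longrightarrow> f = 0) \<and>
    (\<exists>z. \<forall>f\<in>C. (\<forall>\<gamma>\<in>\<Gamma>. \<gamma> x0 = x0 \<longrightarrow> f \<circ> \<gamma> = f) \<longrightarrow> (\<exists>c. f = cscale c z))"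

lemma sphericalD:
  assumes "spherical \<Gamma> x0 C"
  shows "cfun.subspace C" "f \<in> C \<Longrightarrow> \<gamma> \<in> \<Gamma> \<Longrightarrow> f \<circ> \<gamma> \<in> C"
    and "f \<in> C \<Longrightarrow> (\<And>\<gamma>. \<gamma> \<in> \<Gamma> \<Longrightarrow> f (\<gamma> x0) = 0) \<Longrightarrow> f = 0"
    and "\<exists>z. \<forall>f\<in>C. (\<forall>\<gamma>\<in>\<Gamma>. \<gamma> x0 = x0 \<longrightarrow> f \<circ> \<gamma> = f) \<longrightarrow> (\<exists>c. f = cscale c z)"
  using assms by (auto simp: spherical_def)

lemma spherical_functional:
  fixes C :: "('a::euclidean_space \<Rightarrow> complex) set"
  assumes \<Gamma>: "isometry_group \<Gamma>" and C: "spherical \<Gamma> x0 C" "C \<subseteq> hpoly n"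
    and \<mu>: "linear_functional_on C \<mu>"
    and inv: "\<And>\<gamma> f. \<gamma> \<in> \<Gamma> \<Longrightarrow> \<gamma> x0 = x0 \<Longrightarrow> f \<in> C \<Longrightarrow> \<mu> (f \<circ> \<gamma>) = \<mu> f"
  shows "\<exists>c. \<forall>f\<in>C. \<mu> f = c * f x0"
proof -
  note sub = sphericalD(1)[OF C(1)]
  obtain z0 where "\<forall>f\<in>C. (\<forall>\<gamma>\<in>\<Gamma>. \<gamma> x0 = x0 \<longrightarrow> f \<circ> \<gamma> = f) \<longrightarrow> (\<exists>c. f = cscale c z0)"
    by (rule exE[OF sphericalD(4)[OF C(1)]])
  note z0 = this[rule_format]
  \<comment> \<open>Used twice, for \<open>\<mu>\<close> and for the evaluation at
    \<open>x0\<close>: both representing vectors lie on the line of \<open>z0\<close>, hence they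
    can be compared.\<close>
  have represented: "\<exists>w\<in>C. (\<forall>f\<in>C. \<nu> f = fip n f w) \<and> (\<exists>c. w = cscale c z0)"
    if \<nu>: "linear_functional_on C \<nu>"
      "\<And>\<gamma> f. \<gamma> \<in> \<Gamma> \<Longrightarrow> \<gamma> x0 = x0 \<Longrightarrow> f \<in> C \<Longrightarrow> \<nu> (f \<circ> \<gamma>) = \<nu> f" for \<nu>
  proof -
    obtain w where w: "w \<in> C" "\<And>f. f \<in> C \<Longrightarrow> \<nu> f = fip n f w"
      using representing_vector[OF sub C(2) \<nu>(1)] by blast
    have pol: "polynomial_function f" if "f \<in> C" for f
      using that C(2) polynomial_hpoly by blast
    have "w \<circ> \<gamma> = w" if g: "\<gamma> \<in> \<Gamma>" "\<gamma> x0 = x0" for \<gamma>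
    proof -
      obtain \<delta> where d: "\<delta> \<in> \<Gamma>" "\<And>x. \<gamma> (\<delta> x) = x" "\<And>x. \<delta> (\<gamma> x) = x"
        using isometry_group_inverse[OF \<Gamma> g(1)] by blast
      have dx: "\<delta> x0 = x0" using d(3)[of x0] g(2) by simp
      have wg: "w \<circ> \<gamma> \<in> C" using w g sphericalD(2)[OF C(1)] by blast
      have eq: "fip n f (w \<circ> \<gamma>) = fip n f w" if f: "f \<in> C" for f
      proof -
        have fd: "f \<circ> \<delta> \<in> C" using f d sphericalD(2)[OF C(1)] by blast
        have "fip n f (w \<circ> \<gamma>) = fip n ((f \<circ> \<delta>) \<circ> \<gamma>) (w \<circ> \<gamma>)"
          using d by (simp add: comp_def)
        also have "\<dots> = fip n (f \<circ> \<delta>) w"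
          by (rule fip_orthogonal[OF isometry_groupD(2)[OF \<Gamma> g(1)] pol[OF fd] pol[OF w(1)]])
        also have "\<dots> = fip n f w"
          using \<nu>(2)[OF d(1) dx f] w(2)[OF fd] w(2)[OF f] by simp
        finally show ?thesis .
      qed
      \<comment> \<open>Both terms represent the same functional on \<open>C\<close>, so their
        difference is orthogonal to \<open>C\<close> and in particular to itself.\<close>
      define r where "r = (w \<circ> \<gamma>) - w"
      have r: "r \<in> C" unfolding r_def by (rule cfun.subspace_diff[OF sub wg w(1)])
      have "fip n r r = fip n r (w \<circ> \<gamma>) - fip n r w"
        by (subst (2) r_def) (rule fip_diff_right[OF pol[OF wg] pol[OF w(1)]])
      then have "fip n r r = 0" by (simp only: eq[OF r] diff_self)
      then have "r = 0" using r C(2) fip_definite by blast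
      then show ?thesis by (simp add: r_def)
    qed
    then have "\<exists>c. w = cscale c z0" by (intro z0[OF w(1)])
    then show ?thesis using w by (intro bexI[of _ w]) auto
  qed
  obtain w c where w: "\<And>f. f \<in> C \<Longrightarrow> \<mu> f = fip n f w" "w = cscale c z0" "w \<in> C"
    using represented[OF \<mu> inv] by blast
  have "linear_functional_on C (\<lambda>f. f x0)" by (simp add: linear_functional_on_def fapply)
  then obtain z d where z: "\<And>f. f \<in> C \<Longrightarrow> f x0 = fip n f z" "z = cscale d z0" "z \<in> C"
    using represented[of "\<lambda>f. f x0"] by auto
  show ?thesis
  proof (cases "d = 0")
    \<comment> \<open>Evaluation at \<open>x0\<close> vanishes on \<open>C\<close>. As
      \<open>C\<close> is invariant, its functions then vanish on the whole orbit, so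
      \<open>C\<close> is zero and any constant will do.\<close>
    case True
    then have ev0: "f x0 = 0" if "f \<in> C" for f
      using z(1)[OF that] by (simp add: z(2) fip_zero_right)
    have "f = 0" if f: "f \<in> C" for f
    proof (rule sphericalD(3)[OF C(1) f])
      fix \<gamma> assume "\<gamma> \<in> \<Gamma>"
      then show "f (\<gamma> x0) = 0" using ev0[OF sphericalD(2)[OF C(1) f]] by simp
    qed
    then have "\<mu> f = 0" if "f \<in> C" for f
      using that w(1) fip_zero_left by metis
    then show ?thesis by auto
  next
    case False
    have "w = cscale (c / d) z" using False by (simp add: w z(2))
    then have "\<mu> f = cnj (c / d) * f x0" if "f \<in> C" for f
      using w(1)[OF that] z(1)[OF that] z(3) C(2) polynomial_hpoly
      by (metis fip_cscale_right subsetD)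
    then show ?thesis by blast
  qed
qed

text \<open>Replaces group elements by the maps with which they compose. An element acts through its
  inverse, so the two sides are matched by existence in both directions.\<close>

definition acts_by :: "'g set \<Rightarrow> ('g \<Rightarrow> ('a \<Rightarrow> complex) \<Rightarrow> 'a \<Rightarrow> complex) \<Rightarrow> ('a \<Rightarrow> 'a) set \<Rightarrow> bool"
  where "acts_by G \<rho> \<Gamma> \<longleftrightarrow> (\<forall>g\<in>G. \<exists>\<gamma>\<in>\<Gamma>. \<forall>f. \<rho> g f = f \<circ> \<gamma>) \<and> (\<forall>\<gamma>\<in>\<Gamma>. \<exists>g\<in>G. \<forall>f. \<rho> g f = f \<circ> \<gamma>)"

lemma subrepresentation_iff:
  assumes "acts_by G \<rho> \<Gamma>"
  shows "subrepresentation G \<rho> W \<longleftrightarrow> cfun.subspace W \<and> (\<forall>\<gamma>\<in>\<Gamma>. \<forall>f\<in>W. f \<circ> \<gamma> \<in> W)"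
  using assms unfolding subrepresentation_def acts_by_def by metis

lemma spherical_irreducible:
  fixes C :: "('a::euclidean_space \<Rightarrow> complex) set"
  assumes act: "acts_by G \<rho> \<Gamma>" and \<Gamma>: "isometry_group \<Gamma>"
    and C: "spherical \<Gamma> x0 C" "C \<subseteq> hpoly n" "C \<noteq> {0}"
  shows "irreducible_subrep G \<rho> C"
  unfolding irreducible_subrep_def
proof (intro conjI allI impI)
  show "subrepresentation G \<rho> C"
    using C(1) by (simp add: subrepresentation_iff[OF act] spherical_def)
next
  show "C \<noteq> {0}" by fact
next
  note sub = sphericalD(1)[OF C(1)]
  fix U assume U: "subrepresentation G \<rho> U \<and> U \<subseteq> C"
  then have subU: "cfun.subspace U" and invU: "\<And>\<gamma> f. \<gamma> \<in> \<Gamma> \<Longrightarrow> f \<in> U \<Longrightarrow> f \<circ> \<gamma> \<in> U" and UC: "U \<subseteq> C"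
    by (auto simp: subrepresentation_iff[OF act])
  have Un: "U \<subseteq> hpoly n" using UC C(2) by blast
  have polC: "polynomial_function f" if "f \<in> C" for f using that C(2) polynomial_hpoly by blast
  have "\<forall>f\<in>C. \<exists>w. w \<in> U \<and> (\<forall>w'\<in>U. fip n (f - w) w' = 0)"
  proof
    fix f assume "f \<in> C"
    then have "f \<in> hpoly n" using C(2) by blast
    then show "\<exists>w. w \<in> U \<and> (\<forall>w'\<in>U. fip n (f - w) w' = 0)"
      using orthogonal_projection[OF subU Un] by metis
  qed
  then obtain P where P: "\<And>f. f \<in> C \<Longrightarrow> P f \<in> U" "\<And>f w. f \<in> C \<Longrightarrow> w \<in> U \<Longrightarrow> fip n (f - P f) w = 0"
    unfolding bchoice_iff by blast
  \<comment> \<open>Uniqueness of the orthogonal projection. Additivity, homogeneity and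
    equivariance of \<open>P\<close> follow by checking that the expected value satisfies the
    orthogonality condition.\<close>
  have Peq: "P f = w" if f: "f \<in> C" and w: "w \<in> U" "\<And>w'. w' \<in> U \<Longrightarrow> fip n (f - w) w' = 0" for f w
  proof -
    define r where "r = w - P f"
    have r: "r \<in> U" unfolding r_def using w(1) P(1)[OF f] by (rule cfun.subspace_diff[OF subU])
    have C': "f \<in> C" "w \<in> C" "P f \<in> C" using f w P UC by auto
    have "r = (f - P f) - (f - w)" by (simp add: r_def)
    then have "fip n r r = fip n (f - P f) r - fip n (f - w) r"
      using C' polC by (metis fip_diff_left polynomial_function_minus')
    then have "fip n r r = 0" using P(2)[OF f r] w(2)[OF r] by simp
    then have "r = 0" using r Un fip_definite by blast
    then show ?thesis by (simp add: r_def)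
  qed
  have Padd: "P (f + g) = P f + P g" if fg: "f \<in> C" "g \<in> C" for f g
  proof (rule Peq)
    show "f + g \<in> C" using cfun.subspace_add[OF sub fg] .
    show "P f + P g \<in> U" using cfun.subspace_add[OF subU P(1) P(1)] fg by blast
    fix w assume w: "w \<in> U"
    have eq: "f + g - (P f + P g) = (f - P f) + (g - P g)" by simp
    have "P f \<in> C" "P g \<in> C" using P(1) fg UC by blast+
    then show "fip n (f + g - (P f + P g)) w = 0"
      unfolding eq using fg P(2)[OF _ w] polC by (simp add: fip_add_left polynomial_function_minus')
  qed
  have Pscale: "P (cscale c f) = cscale c (P f)" if f: "f \<in> C" for c f
  proof (rule Peq)
    show "cscale c f \<in> C" using cfun.subspace_scale[OF sub f] .
    show "cscale c (P f) \<in> U" using cfun.subspace_scale[OF subU P(1)[OF f]] .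
    fix w assume w: "w \<in> U"
    have "P f \<in> C" using P(1) f UC by blast
    then show "fip n (cscale c f - cscale c (P f)) w = 0"
      using f P(2)[OF f w] polC
      by (simp add: fip_cscale_left polynomial_function_minus' flip: cfun.scale_right_diff_distrib)
  qed
  have Pinv: "P (f \<circ> \<gamma>) = P f \<circ> \<gamma>" if f: "f \<in> C" and g: "\<gamma> \<in> \<Gamma>" for f \<gamma>
  proof (rule Peq)
    show "f \<circ> \<gamma> \<in> C" using sphericalD(2)[OF C(1) f g] .
    show "P f \<circ> \<gamma> \<in> U" using invU[OF g P(1)[OF f]] .
    fix w assume w: "w \<in> U"
    obtain \<delta> where d: "\<delta> \<in> \<Gamma>" "\<And>x. \<gamma> (\<delta> x) = x" "\<And>x. \<delta> (\<gamma> x) = x"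
      using isometry_group_inverse[OF \<Gamma> g] by blast
    have Pf: "P f \<in> C" using P(1) f UC by blast
    have wd: "w \<circ> \<delta> \<in> U" using invU[OF d(1) w] .
    have "(f \<circ> \<gamma>) - (P f \<circ> \<gamma>) = (f - P f) \<circ> \<gamma>" by (simp add: fun_eq_iff fapply)
    moreover have "w = (w \<circ> \<delta>) \<circ> \<gamma>" using d by (simp add: comp_def)
    ultimately have "fip n ((f \<circ> \<gamma>) - (P f \<circ> \<gamma>)) w = fip n ((f - P f) \<circ> \<gamma>) ((w \<circ> \<delta>) \<circ> \<gamma>)"
      by simp
    also have "\<dots> = fip n (f - P f) (w \<circ> \<delta>)"
      using polC f Pf wd UC
      by (intro fip_orthogonal isometry_groupD(2)[OF \<Gamma> g] polynomial_function_minus') auto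
    also have "\<dots> = 0" using P(2)[OF f wd] .
    finally show "fip n ((f \<circ> \<gamma>) - (P f \<circ> \<gamma>)) w = 0" .
  qed
  have "\<exists>c. \<forall>f\<in>C. P f x0 = c * f x0"
  proof (rule spherical_functional[OF \<Gamma> C(1,2)])
    show "linear_functional_on C (\<lambda>f. P f x0)"
      by (simp add: linear_functional_on_def Padd Pscale fapply)
    show "P (f \<circ> \<gamma>) x0 = P f x0" if "\<gamma> \<in> \<Gamma>" "\<gamma> x0 = x0" "f \<in> C" for \<gamma> f
      using that by (simp only: Pinv comp_apply)
  qed
  then obtain c where c: "\<And>f. f \<in> C \<Longrightarrow> P f x0 = c * f x0" by blast
  have Pc: "P f = cscale c f" if f: "f \<in> C" for f
  proof -
    have "P f - cscale c f = 0"
    proof (rule sphericalD(3)[OF C(1)])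
      show "P f - cscale c f \<in> C"
        using P(1) f UC by (intro cfun.subspace_diff[OF sub] cfun.subspace_scale[OF sub]) auto
      fix \<gamma> assume g: "\<gamma> \<in> \<Gamma>"
      have "P f (\<gamma> x0) = P (f \<circ> \<gamma>) x0" by (simp only: Pinv[OF f g] comp_apply)
      also have "\<dots> = c * f (\<gamma> x0)" using c[OF sphericalD(2)[OF C(1) f g]] by simp
      finally show "(P f - cscale c f) (\<gamma> x0) = 0" by (simp add: fapply)
    qed
    then show ?thesis by simp
  qed
  show "U = {0} \<or> U = C"
  proof (cases "U = {0}")
    case False
    then obtain u where u: "u \<in> U" "u \<noteq> 0" using cfun.subspace_0[OF subU] by blast
    \<comment> \<open>A nonzero element of \<open>U\<close> forces the scalar to be 1; then every
      element of \<open>C\<close> equals its projection and lies in \<open>U\<close>.\<close>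
    have "P u = u" using u UC by (intro Peq) (auto simp: fip_zero_left)
    then have "cscale c u = cscale 1 u" using Pc[of u] u UC by auto
    then have "c = 1" using u(2) unfolding cfun.scale_cancel_right by blast
    then have "f \<in> U" if "f \<in> C" for f using P(1)[OF that] Pc[OF that] by simp
    then show ?thesis using UC by blast
  qed simp
qed

text \<open>Following the equivalence by evaluation at \<open>x0\<close> gives an invariant
  functional, and equivariance spreads the comparison over the orbit. Equality off the orbit cannot
  be expected: 1 and the squared norm agree on the unit sphere. The degrees are compared later by
  harmonicity.\<close>

lemma spherical_equivalent:
  fixes C C' :: "('a::euclidean_space \<Rightarrow> complex) set"
  assumes act: "acts_by G \<rho> \<Gamma>" and \<Gamma>: "isometry_group \<Gamma>"
    and C: "spherical \<Gamma> x0 C" "C \<subseteq> hpoly n" "C \<noteq> {0}" and C': "spherical \<Gamma> x0 C'"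
    and eqv: "equivalent_subreps G \<rho> C C'"
  obtains f f' where "f \<in> C" "f' \<in> C'" "f \<noteq> 0" "f' \<noteq> 0" "\<forall>\<gamma>\<in>\<Gamma>. f (\<gamma> x0) = f' (\<gamma> x0)"
proof -
  note sub = sphericalD(1)[OF C(1)]
  obtain \<phi> where \<phi>: "bij_betw \<phi> C C'" "\<And>f g. f \<in> C \<Longrightarrow> g \<in> C \<Longrightarrow> \<phi> (f + g) = \<phi> f + \<phi> g"
    "\<And>c f. f \<in> C \<Longrightarrow> \<phi> (cscale c f) = cscale c (\<phi> f)"
    "\<And>g f. g \<in> G \<Longrightarrow> f \<in> C \<Longrightarrow> \<phi> (\<rho> g f) = \<rho> g (\<phi> f)"
    using eqv unfolding equivalent_subreps_def by blast
  have \<phi>\<Gamma>: "\<phi> (f \<circ> \<gamma>) = \<phi> f \<circ> \<gamma>" if "\<gamma> \<in> \<Gamma>" "f \<in> C" for \<gamma> f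
  proof -
    obtain g where "g \<in> G" "\<And>f. \<rho> g f = f \<circ> \<gamma>" using act \<open>\<gamma> \<in> \<Gamma>\<close> unfolding acts_by_def by blast
    then show ?thesis using \<phi>(4)[of g f] that by simp
  qed
  have \<phi>C: "\<phi> f \<in> C'" if "f \<in> C" for f using \<phi>(1) that by (auto simp: bij_betw_def)
  have "\<exists>c. \<forall>f\<in>C. \<phi> f x0 = c * f x0"
  proof (rule spherical_functional[OF \<Gamma> C(1,2)])
    show "linear_functional_on C (\<lambda>f. \<phi> f x0)"
      by (simp add: linear_functional_on_def \<phi> fapply)
    show "\<phi> (f \<circ> \<gamma>) x0 = \<phi> f x0" if "\<gamma> \<in> \<Gamma>" "\<gamma> x0 = x0" "f \<in> C" for \<gamma> f
      using that by (simp only: \<phi>\<Gamma> comp_apply)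
  qed
  then obtain c where c: "\<And>f. f \<in> C \<Longrightarrow> \<phi> f x0 = c * f x0" by blast
  obtain f0 where f0: "f0 \<in> C" "f0 \<noteq> 0" using C(3) cfun.subspace_0[OF sub] by blast
  have "\<phi> 0 = 0" using \<phi>(3)[of 0 0] cfun.subspace_0[OF sub] by simp
  then have ne: "\<phi> f0 \<noteq> 0"
    using \<phi>(1) f0 cfun.subspace_0[OF sub] unfolding bij_betw_def inj_on_def by metis
  have orbit: "cscale c f0 (\<gamma> x0) = \<phi> f0 (\<gamma> x0)" if g: "\<gamma> \<in> \<Gamma>" for \<gamma>
    using c[OF sphericalD(2)[OF C(1) f0(1) g]] \<phi>\<Gamma>[OF g f0(1)] by (simp add: fapply)
  \<comment> \<open>Otherwise \<open>\<phi> f0\<close> would vanish on the orbit and hence be zero,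
    against injectivity.\<close>
  have "cscale c f0 \<noteq> 0"
  proof
    assume "cscale c f0 = 0"
    then have "\<phi> f0 = 0"
      using orbit by (intro sphericalD(3)[OF C' \<phi>C[OF f0(1)]]) (metis zero_fun_apply)
    then show False using ne by simp
  qed
  then show ?thesis
    using that[of "cscale c f0" "\<phi> f0"] ne orbit \<phi>C[OF f0(1)] cfun.subspace_scale[OF sub f0(1)] by blast
qed

subsection \<open>Products\<close>

definition product_group :: "('a \<Rightarrow> 'a) set \<Rightarrow> ('b \<Rightarrow> 'b) set \<Rightarrow> ('a \<times> 'b \<Rightarrow> 'a \<times> 'b) set"
  where "product_group \<Gamma> \<Delta> = {map_prod \<gamma> \<delta> |\<gamma> \<delta>. \<gamma> \<in> \<Gamma> \<and> \<delta> \<in> \<Delta>}"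

lemma orthogonal_transformation_map_prod:
  assumes "orthogonal_transformation \<gamma>" "orthogonal_transformation \<delta>"
  shows "orthogonal_transformation (map_prod \<gamma> \<delta>)"
  using assms unfolding orthogonal_transformation_def linear_iff
  by (auto simp: inner_prod_def)

lemma isometry_group_product:
  assumes "isometry_group \<Gamma>" "isometry_group \<Delta>"
  shows "isometry_group (product_group \<Gamma> \<Delta>)"
  unfolding isometry_group_def
proof (intro conjI ballI)
  have "(\<lambda>x. x) = map_prod (\<lambda>x. x) (\<lambda>x. x)" by auto
  then show "(\<lambda>x. x) \<in> product_group \<Gamma> \<Delta>"
    using isometry_groupD(1)[OF assms(1)] isometry_groupD(1)[OF assms(2)]
    unfolding product_group_def by blast
next
  fix g assume "g \<in> product_group \<Gamma> \<Delta>"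
  then obtain \<gamma> \<delta> where g: "g = map_prod \<gamma> \<delta>" "\<gamma> \<in> \<Gamma>" "\<delta> \<in> \<Delta>" by (auto simp: product_group_def)
  then show "orthogonal_transformation g"
    using assms by (auto intro: orthogonal_transformation_map_prod isometry_groupD)
  obtain \<gamma>' where 1: "\<gamma>' \<in> \<Gamma>" "\<And>x. \<gamma> (\<gamma>' x) = x" "\<And>x. \<gamma>' (\<gamma> x) = x"
    using isometry_group_inverse[OF assms(1) g(2)] by blast
  obtain \<delta>' where 2: "\<delta>' \<in> \<Delta>" "\<And>x. \<delta> (\<delta>' x) = x" "\<And>x. \<delta>' (\<delta> x) = x"
    using isometry_group_inverse[OF assms(2) g(3)] by blast
  show "\<exists>h\<in>product_group \<Gamma> \<Delta>. \<forall>x. g (h x) = x \<and> h (g x) = x"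
    using 1 2 g by (intro bexI[of _ "map_prod \<gamma>' \<delta>'"]) (auto simp: product_group_def)
qed

lemma spherical_tensor_space:
  fixes A :: "('a::euclidean_space \<Rightarrow> complex) set" and B :: "('b::euclidean_space \<Rightarrow> complex) set"
  assumes \<Gamma>: "isometry_group \<Gamma>" "isometry_group \<Delta>"
    and A: "spherical \<Gamma> x0 A" and B: "spherical \<Delta> y0 B"
  shows "spherical (product_group \<Gamma> \<Delta>) (x0, y0) (tensor_space A B)"
proof -
  note sec1 = tensor_space_section1[OF _ sphericalD(1)[OF A]]
  note sec2 = tensor_space_section2[OF _ sphericalD(1)[OF B]]
  note sub = tensor_space_subspace
  have mem: "map_prod \<gamma> \<delta> \<in> product_group \<Gamma> \<Delta>" if "\<gamma> \<in> \<Gamma>" "\<delta> \<in> \<Delta>" for \<gamma> \<delta>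
    using that by (auto simp: product_group_def)
  have inv: "F \<circ> map_prod \<gamma> \<delta> \<in> tensor_space A B"
    if "F \<in> tensor_space A B" "\<gamma> \<in> \<Gamma>" "\<delta> \<in> \<Delta>" for F \<gamma> \<delta>
    using that(1)
  proof (induction rule: tensor_space_induct)
    case zero
    have "0 \<circ> map_prod \<gamma> \<delta> = (0 :: 'a \<times> 'b \<Rightarrow> complex)" by (auto simp: fun_eq_iff fapply)
    then show ?case using cfun.subspace_0[OF sub] by metis
  next
    case (step c K G F)
    have "(cscale c (\<lambda>(u, v). K u * G v) + F) \<circ> map_prod \<gamma> \<delta> =
        cscale c (\<lambda>(u, v). (K \<circ> \<gamma>) u * (G \<circ> \<delta>) v) + (F \<circ> map_prod \<gamma> \<delta>)"
      by (auto simp: fun_eq_iff fapply)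
    moreover have "\<dots> \<in> tensor_space A B"
      by (intro cfun.subspace_add[OF sub] cfun.subspace_scale[OF sub] tensor_space_base
          sphericalD(2)[OF A] sphericalD(2)[OF B] step that)
    ultimately show ?case by (simp only:)
  qed
  have sep: "F = 0" if F: "F \<in> tensor_space A B"
    and vanish: "\<And>g. g \<in> product_group \<Gamma> \<Delta> \<Longrightarrow> F (g (x0, y0)) = 0" for F
  proof -
    have v0: "F (\<gamma> x0, \<delta> y0) = 0" if "\<gamma> \<in> \<Gamma>" "\<delta> \<in> \<Delta>" for \<gamma> \<delta>
      using vanish[OF mem[OF that]] by simp
    \<comment> \<open>With the second variable frozen on its orbit the first factor gives zero for
      all u; then the second factor applies for each frozen u.\<close>
    have "(\<lambda>u. F (u, \<delta> y0)) = 0" if "\<delta> \<in> \<Delta>" for \<delta>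
      using v0 that by (intro sphericalD(3)[OF A sec1[OF F]]) auto
    then have "F (u, \<delta> y0) = 0" if "\<delta> \<in> \<Delta>" for u \<delta>
      using that by (auto simp: fun_eq_iff fapply)
    then have "(\<lambda>v. F (u, v)) = 0" for u
      by (intro sphericalD(3)[OF B sec2[OF F]]) auto
    then show ?thesis by (auto simp: fun_eq_iff fapply)
  qed
  obtain z where "\<forall>f\<in>A. (\<forall>\<gamma>\<in>\<Gamma>. \<gamma> x0 = x0 \<longrightarrow> f \<circ> \<gamma> = f) \<longrightarrow> (\<exists>c. f = cscale c z)"
    by (rule exE[OF sphericalD(4)[OF A]])
  note z = this[rule_format]
  obtain z' where "\<forall>f\<in>B. (\<forall>\<delta>\<in>\<Delta>. \<delta> y0 = y0 \<longrightarrow> f \<circ> \<delta> = f) \<longrightarrow> (\<exists>c. f = cscale c z')"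
    by (rule exE[OF sphericalD(4)[OF B]])
  note z' = this[rule_format]
  have one_dim: "\<exists>c. F = cscale c (\<lambda>(u, v). z u * z' v)" if F: "F \<in> tensor_space A B"
    and fixed: "\<And>g. g \<in> product_group \<Gamma> \<Delta> \<Longrightarrow> g (x0, y0) = (x0, y0) \<Longrightarrow> F \<circ> g = F" for F
  proof (cases "F = 0")
    case True
    then show ?thesis by (intro exI[of _ 0]) simp
  next
    case False
    have fix1: "F (\<gamma> u, v) = F (u, v)" if "\<gamma> \<in> \<Gamma>" "\<gamma> x0 = x0" for \<gamma> u v
      using fixed[OF mem[OF that(1) isometry_groupD(1)[OF \<Gamma>(2)]]] that(2)
      by (auto simp: fun_eq_iff)
    have fix2: "F (u, \<delta> v) = F (u, v)" if "\<delta> \<in> \<Delta>" "\<delta> y0 = y0" for \<delta> u v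
      using fixed[OF mem[OF isometry_groupD(1)[OF \<Gamma>(1)] that(1)]] that(2)
      by (auto simp: fun_eq_iff)
    \<comment> \<open>Being fixed under the first stabiliser puts every section in u on the line of
      \<open>z\<close>, with a coefficient depending on v. A point \<open>u1\<close> with
      \<open>z u1\<close> nonzero then expresses this coefficient by a section in v, which lies on
      the line of \<open>z'\<close>.\<close>
    have "\<exists>c. (\<lambda>u. F (u, v)) = cscale c z" for v
      using fix1 by (intro z sec1[OF F]) (auto simp: fun_eq_iff)
    then obtain c where c: "\<And>v. (\<lambda>u. F (u, v)) = cscale (c v) z" by metis
    have Fc: "F (u, v) = c v * z u" for u v
      using fun_cong[OF c[of v], of u] by (simp add: fapply)
    obtain u1 v1 where "F (u1, v1) \<noteq> 0" using False by (auto simp: fun_eq_iff fapply)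
    then have z1: "z u1 \<noteq> 0" using Fc by auto
    have "\<exists>d. (\<lambda>v. F (u1, v)) = cscale d z'"
      using fix2 by (intro z' sec2[OF F]) (auto simp: fun_eq_iff)
    then obtain d where d: "(\<lambda>v. F (u1, v)) = cscale d z'" by blast
    have "c v = d * z' v / z u1" for v
      using fun_cong[OF d, of v] z1 by (simp add: Fc fapply field_simps)
    then show ?thesis
      by (intro exI[of _ "d / z u1"]) (auto simp: fun_eq_iff fapply Fc)
  qed
  show ?thesis
    unfolding spherical_def
  proof (intro conjI ballI impI)
    show "\<exists>z. \<forall>F\<in>tensor_space A B.
        (\<forall>g\<in>product_group \<Gamma> \<Delta>. g (x0, y0) = (x0, y0) \<longrightarrow> F \<circ> g = F) \<longrightarrow> (\<exists>c. F = cscale c z)"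
      using one_dim by blast
  qed (use sub inv sep in \<open>auto simp: product_group_def\<close>)
qed

section \<open>Direct sums of tensor products\<close>

lemma direct_sumD:
  assumes "direct_sum V I U"
  shows "finite I" "\<And>i. i \<in> I \<Longrightarrow> cfun.subspace (U i)"
    and "V = {(\<Sum>i\<in>I. f i) |f. \<forall>i\<in>I. f i \<in> U i}"
    and "\<And>f. (\<And>i. i \<in> I \<Longrightarrow> f i \<in> U i) \<Longrightarrow> (\<Sum>i\<in>I. f i) = 0 \<Longrightarrow> \<forall>i\<in>I. f i = 0"
proof -
  have *: "finite I \<and> (\<forall>i\<in>I. cfun.subspace (U i)) \<and>
    V = {(\<Sum>i\<in>I. f i) |f. \<forall>i\<in>I. f i \<in> U i} \<and>
    (\<forall>f. (\<forall>i\<in>I. f i \<in> U i) \<and> (\<Sum>i\<in>I. f i) = 0 \<longrightarrow> (\<forall>i\<in>I. f i = 0))"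
    using assms unfolding direct_sum_def .
  show "finite I" by (rule conjunct1[OF *])
  show "cfun.subspace (U i)" if "i \<in> I" for i
    by (rule bspec[OF conjunct1[OF conjunct2[OF *]] that])
  show "V = {(\<Sum>i\<in>I. f i) |f. \<forall>i\<in>I. f i \<in> U i}"
    by (rule conjunct1[OF conjunct2[OF conjunct2[OF *]]])
  show "\<forall>i\<in>I. f i = 0" if "\<And>i. i \<in> I \<Longrightarrow> f i \<in> U i" "(\<Sum>i\<in>I. f i) = 0" for f
    by (rule mp[OF spec[OF conjunct2[OF conjunct2[OF conjunct2[OF *]]]]]) (use that in blast)
qed

lemma direct_sum_tensor_space:
  assumes A: "direct_sum A I P" and B: "direct_sum B J Q"
  shows "direct_sum (tensor_space A B) (I \<times> J) (\<lambda>(i, j). tensor_space (P i) (Q j))"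
proof -
  note sub = tensor_space_subspace
  note finI = direct_sumD(1)[OF A] direct_sumD(1)[OF B]
  then have fin: "finite (I \<times> J)" by simp
  note subP = direct_sumD(2)[OF A] and A_eq = direct_sumD(3)[OF A] and uA = direct_sumD(4)[OF A]
  note subQ = direct_sumD(2)[OF B] and B_eq = direct_sumD(3)[OF B] and uB = direct_sumD(4)[OF B]
  have PA: "P i \<subseteq> A" if "i \<in> I" for i
    by (rule subsetI, subst A_eq, rule mem_sums_family[OF finI(1) subP that])
  have QB: "Q j \<subseteq> B" if "j \<in> J" for j
    by (rule subsetI, subst B_eq, rule mem_sums_family[OF finI(2) subQ that])
  define T where "T = (\<lambda>(i, j). tensor_space (P i) (Q j))"
  have subT: "cfun.subspace (T p)" for p by (cases p) (simp add: T_def sub)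
  define S where "S = {(\<Sum>p\<in>I \<times> J. f p) |f. \<forall>p\<in>I \<times> J. f p \<in> T p}"
  have subS: "cfun.subspace S" unfolding S_def using subT by (rule subspace_sums_family)
  have "tensor_space A B \<subseteq> S"
  proof
    fix F assume "F \<in> tensor_space A B"
    then show "F \<in> S"
    proof (induction rule: tensor_space_induct)
      case zero
      then show ?case using cfun.subspace_0[OF subS] .
    next
      case (step c K G F)
      obtain f where f: "K = (\<Sum>i\<in>I. f i)" "\<forall>i\<in>I. f i \<in> P i" using step(1) A_eq by blast
      obtain g where g: "G = (\<Sum>j\<in>J. g j)" "\<forall>j\<in>J. g j \<in> Q j" using step(2) B_eq by blast
      have "(\<lambda>(u, v). K u * G v) = (\<Sum>p\<in>I \<times> J. (\<lambda>(u, v). f (fst p) u * g (snd p) v))"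
        by (auto simp: fun_eq_iff fapply f(1) g(1) sum_product sum.cartesian_product')
      moreover have "\<forall>p\<in>I \<times> J. (\<lambda>(u, v). f (fst p) u * g (snd p) v) \<in> T p"
        using f(2) g(2) by (auto simp: T_def intro!: tensor_space_base)
      ultimately have "(\<lambda>(u, v). K u * G v) \<in> S"
        unfolding S_def
        by (intro CollectI exI[of _ "\<lambda>p. (\<lambda>(u, v). f (fst p) u * g (snd p) v)"]) simp
      then show ?case
        using step cfun.subspace_add[OF subS] cfun.subspace_scale[OF subS] by blast
    qed
  qed
  moreover have "S \<subseteq> tensor_space A B"
  proof
    fix F assume "F \<in> S"
    then obtain f where f: "F = (\<Sum>p\<in>I \<times> J. f p)" "\<And>p. p \<in> I \<times> J \<Longrightarrow> f p \<in> T p"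
      unfolding S_def by blast
    show "F \<in> tensor_space A B"
      unfolding f(1)
    proof (rule cfun.subspace_sum[OF sub])
      fix p assume p: "p \<in> I \<times> J"
      then show "f p \<in> tensor_space A B"
        using f(2)[OF p] tensor_space_mono[OF PA QB, of "fst p" "snd p"] by (auto simp: T_def)
    qed
  qed
  moreover have "f p = 0"
    if f: "\<And>p. p \<in> I \<times> J \<Longrightarrow> f p \<in> T p" and zero: "(\<Sum>p\<in>I \<times> J. f p) = 0" and p: "p \<in> I \<times> J" for f p
  proof -
    have mem: "f (i, j) \<in> tensor_space (P i) (Q j)" if "i \<in> I" "j \<in> J" for i j
      using f[of "(i, j)"] that by (simp add: T_def)
    have "f (i, j) (u, v) = 0" if ij: "i \<in> I" "j \<in> J" for i j u v
    proof -
      \<comment> \<open>For frozen v the inner sums over \<open>j\<close> lie in the different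
        \<open>P i\<close> and add up to zero, so each vanishes. Freezing u afterwards separates the
        terms in the \<open>Q j\<close>.\<close>
      have "(\<lambda>u. \<Sum>j\<in>J. f (i, j) (u, v)) = 0" if "i \<in> I" for i v
      proof -
        have "\<forall>i\<in>I. (\<Sum>j\<in>J. (\<lambda>u. f (i, j) (u, v))) = 0"
        proof (rule uA)
          show "(\<Sum>j\<in>J. (\<lambda>u. f (i, j) (u, v))) \<in> P i" if "i \<in> I" for i
            using that by (intro cfun.subspace_sum subP tensor_space_section1[OF mem])
          show "(\<Sum>i\<in>I. \<Sum>j\<in>J. (\<lambda>u. f (i, j) (u, v))) = 0"
          proof
            fix u
            have "(\<Sum>p\<in>I \<times> J. f p) (u, v) = 0" by (simp add: zero fapply)
            then show "(\<Sum>i\<in>I. \<Sum>j\<in>J. (\<lambda>u. f (i, j) (u, v))) u = 0 u"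
              by (simp add: fapply sum.cartesian_product')
          qed
        qed
        then show ?thesis using that by (auto simp: fun_eq_iff fapply)
      qed
      then have s0: "(\<Sum>j\<in>J. f (i, j) (u, v)) = 0" for v
        using ij by (auto simp: fun_eq_iff fapply)
      have "\<forall>j\<in>J. (\<lambda>v. f (i, j) (u, v)) = 0"
      proof (rule uB)
        show "(\<lambda>v. f (i, j) (u, v)) \<in> Q j" if "j \<in> J" for j
          using that ij by (intro tensor_space_section2[OF mem] subQ)
        show "(\<Sum>j\<in>J. (\<lambda>v. f (i, j) (u, v))) = 0"
          using s0 by (auto simp: fun_eq_iff fapply)
      qed
      then show ?thesis using ij by (auto simp: fun_eq_iff fapply)
    qed
    then show ?thesis using p by (auto simp: fun_eq_iff fapply)
  qed
  ultimately have S: "tensor_space A B = S" and unique: "\<And>f p. (\<And>p. p \<in> I \<times> J \<Longrightarrow> f p \<in> T p) \<Longrightarrow>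
      (\<Sum>p\<in>I \<times> J. f p) = 0 \<Longrightarrow> p \<in> I \<times> J \<Longrightarrow> f p = 0" by blast+
  show ?thesis
    unfolding direct_sum_def T_def[symmetric]
  proof (intro conjI ballI allI impI)
    show "tensor_space A B = {(\<Sum>p\<in>I \<times> J. f p) |f. \<forall>p\<in>I \<times> J. f p \<in> T p}"
      using S unfolding S_def .
    show "f p = 0" if "(\<forall>p\<in>I \<times> J. f p \<in> T p) \<and> (\<Sum>p\<in>I \<times> J. f p) = 0" "p \<in> I \<times> J" for f p
      using that by (intro unique[of f]) blast+
  qed (rule fin subT)+
qed

subsection \<open>Transport along equivariant maps\<close>

lemma direct_sum_image:
  assumes D: "direct_sum D J T" "cfun.subspace D" and L: "linear_on_space D L"
    and inj: "\<And>f. f \<in> D \<Longrightarrow> L f = 0 \<Longrightarrow> f = 0"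
  shows "direct_sum (L ` D) J (\<lambda>j. L ` T j)"
proof -
  note fin = direct_sumD(1)[OF D(1)] and subT = direct_sumD(2)[OF D(1)]
    and D_eq = direct_sumD(3)[OF D(1)] and uD = direct_sumD(4)[OF D(1)]
  have TD: "T j \<subseteq> D" if "j \<in> J" for j
    by (rule subsetI, subst D_eq, rule mem_sums_family[OF fin subT that])
  have Lsum: "L (\<Sum>j\<in>J. f j) = (\<Sum>j\<in>J. L (f j))" if "\<And>j. j \<in> J \<Longrightarrow> f j \<in> T j" for f
    using that TD by (intro linear_on_space_sum[OF L D(2)]) blast
  have eq: "L ` D = {(\<Sum>j\<in>J. g j) |g. \<forall>j\<in>J. g j \<in> L ` T j}"
  proof (intro equalityI subsetI)
    fix x assume "x \<in> L ` D"
    then obtain f where "\<forall>j\<in>J. f j \<in> T j" "x = L (\<Sum>j\<in>J. f j)" using D_eq by blast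
    then show "x \<in> {(\<Sum>j\<in>J. g j) |g. \<forall>j\<in>J. g j \<in> L ` T j}"
      using Lsum by (intro CollectI exI[of _ "\<lambda>j. L (f j)"]) auto
  next
    fix x assume "x \<in> {(\<Sum>j\<in>J. g j) |g. \<forall>j\<in>J. g j \<in> L ` T j}"
    then obtain g where g: "x = (\<Sum>j\<in>J. g j)" "\<forall>j\<in>J. \<exists>f. f \<in> T j \<and> g j = L f" by blast
    then obtain f where f: "\<forall>j\<in>J. f j \<in> T j \<and> g j = L (f j)" unfolding bchoice_iff by blast
    have "x = L (\<Sum>j\<in>J. f j)" using f by (simp add: g(1) Lsum)
    moreover have "(\<Sum>j\<in>J. f j) \<in> D" using f D_eq by blast
    ultimately show "x \<in> L ` D" by blast
  qed
  have unique: "\<forall>j\<in>J. g j = 0" if g: "\<forall>j\<in>J. g j \<in> L ` T j" "(\<Sum>j\<in>J. g j) = 0" for g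
  proof -
    have "\<forall>j\<in>J. \<exists>f. f \<in> T j \<and> g j = L f" using g(1) by blast
    then obtain f where f: "\<forall>j\<in>J. f j \<in> T j \<and> g j = L (f j)" unfolding bchoice_iff by blast
    have "L (\<Sum>j\<in>J. f j) = 0" using f g(2) by (simp add: Lsum)
    moreover have "(\<Sum>j\<in>J. f j) \<in> D" using f D_eq by blast
    ultimately have "(\<Sum>j\<in>J. f j) = 0" using inj by blast
    then have "\<forall>j\<in>J. f j = 0" using f by (intro uD) blast+
    then show ?thesis using f linear_on_space_zero[OF L D(2)] by simp
  qed
  show ?thesis
    unfolding direct_sum_def
  proof (intro conjI ballI allI impI)
    fix j assume "j \<in> J"
    then show "cfun.subspace (L ` T j)" by (intro subspace_image[OF L] subT TD)
  next
    fix g j assume "(\<forall>j\<in>J. g j \<in> L ` T j) \<and> (\<Sum>j\<in>J. g j) = 0" "j \<in> J"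
    then show "g j = 0" using unique by blast
  qed (fact fin eq)+
qed

text \<open>The constituents arise indexed by pairs, while
  \<open>multiplicity_free_decomposition\<close> numbers them by initial segments of the natural
  numbers.\<close>

lemma direct_sum_reindex:
  assumes "direct_sum V J T" "bij_betw b I J"
  shows "direct_sum V I (T \<circ> b)"
proof -
  have J: "J = b ` I" "inj_on b I" using assms(2) by (auto simp: bij_betw_def)
  note fin = direct_sumD(1)[OF assms(1)] and subT = direct_sumD(2)[OF assms(1)]
    and V_eq = direct_sumD(3)[OF assms(1)] and u = direct_sumD(4)[OF assms(1)]
  have sumb: "(\<Sum>j\<in>J. f j) = (\<Sum>i\<in>I. f (b i))" for f :: "_ \<Rightarrow> 'a \<Rightarrow> complex"
    unfolding J(1) by (simp add: sum.reindex[OF J(2)])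
  have inv: "(\<Sum>i\<in>I. f i) = (\<Sum>j\<in>J. f (the_inv_into I b j))" for f :: "_ \<Rightarrow> 'a \<Rightarrow> complex"
    unfolding sumb by (intro sum.cong) (auto simp: the_inv_into_f_f[OF J(2)])
  have mem: "\<forall>j\<in>J. f (the_inv_into I b j) \<in> T j" if "\<forall>i\<in>I. f i \<in> (T \<circ> b) i" for f
    using that by (auto simp: J(1) the_inv_into_f_f[OF J(2)])
  show ?thesis
    unfolding direct_sum_def
  proof (intro conjI ballI allI impI)
    show "finite I" using fin J finite_imageD by blast
    show "cfun.subspace ((T \<circ> b) i)" if "i \<in> I" for i using that subT J(1) by auto
    show "V = {(\<Sum>i\<in>I. f i) |f. \<forall>i\<in>I. f i \<in> (T \<circ> b) i}"
    proof (intro equalityI subsetI)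
      fix x assume "x \<in> V"
      then obtain f where "x = (\<Sum>j\<in>J. f j)" "\<forall>j\<in>J. f j \<in> T j" using V_eq by blast
      then show "x \<in> {(\<Sum>i\<in>I. f i) |f. \<forall>i\<in>I. f i \<in> (T \<circ> b) i}"
        using sumb[of f] J(1) by (intro CollectI exI[of _ "\<lambda>i. f (b i)"]) auto
    next
      fix x assume "x \<in> {(\<Sum>i\<in>I. f i) |f. \<forall>i\<in>I. f i \<in> (T \<circ> b) i}"
      then obtain f where "x = (\<Sum>i\<in>I. f i)" "\<forall>i\<in>I. f i \<in> (T \<circ> b) i" by blast
      then show "x \<in> V" unfolding V_eq using inv[of f] mem[of f] by blast
    qed
    fix f i assume f: "(\<forall>i\<in>I. f i \<in> (T \<circ> b) i) \<and> (\<Sum>i\<in>I. f i) = 0" and i: "i \<in> I"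
    have "\<forall>j\<in>J. f (the_inv_into I b j) = 0"
      using f mem[of f] inv[of f] by (intro u) auto
    then show "f i = 0" using i by (auto simp: J(1) the_inv_into_f_f[OF J(2)])
  qed
qed

lemma equivalent_subreps_image:
  assumes act: "acts_by G \<rho> \<Gamma>" and L: "linear_on_space W L" and W: "cfun.subspace W"
    and inj: "\<And>f. f \<in> W \<Longrightarrow> L f = 0 \<Longrightarrow> f = 0"
    and equi: "\<And>\<gamma> f. \<gamma> \<in> \<Gamma> \<Longrightarrow> f \<in> W \<Longrightarrow> L (f \<circ> \<gamma>) = L f \<circ> \<gamma>"
  shows "equivalent_subreps G \<rho> W (L ` W)"
  unfolding equivalent_subreps_def
proof (intro exI[of _ L] conjI ballI allI)
  have "inj_on L W"
  proof (rule inj_onI)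
    fix f g assume fg: "f \<in> W" "g \<in> W" and eq: "L f = L g"
    have "L (f - g) = 0" using linear_on_space_diff[OF L W fg] eq by simp
    then have "f - g = 0" by (rule inj[OF cfun.subspace_diff[OF W fg]])
    then show "f = g" by simp
  qed
  then show "bij_betw L W (L ` W)" by (simp add: bij_betw_def)
  show "L (\<rho> g f) = \<rho> g (L f)" if g: "g \<in> G" and f: "f \<in> W" for g f
  proof -
    obtain \<gamma> where "\<gamma> \<in> \<Gamma>" "\<And>f. \<rho> g f = f \<circ> \<gamma>" using act g unfolding acts_by_def by blast
    then show ?thesis using equi f by simp
  qed
  show "L (f + g) = L f + L g" if "f \<in> W" "g \<in> W" for f g
    using linear_on_spaceD(1)[OF L that] .
  show "L (cscale c f) = cscale c (L f)" if "f \<in> W" for c f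
    using linear_on_spaceD(2)[OF L that] .
qed

lemma equivalent_subreps_sym:
  assumes "equivalent_subreps G \<rho> W W'" "subrepresentation G \<rho> W"
  shows "equivalent_subreps G \<rho> W' W"
proof -
  obtain \<phi> where \<phi>: "bij_betw \<phi> W W'" "\<And>f g. f \<in> W \<Longrightarrow> g \<in> W \<Longrightarrow> \<phi> (f + g) = \<phi> f + \<phi> g"
    "\<And>c f. f \<in> W \<Longrightarrow> \<phi> (cscale c f) = cscale c (\<phi> f)"
    "\<And>g f. g \<in> G \<Longrightarrow> f \<in> W \<Longrightarrow> \<phi> (\<rho> g f) = \<rho> g (\<phi> f)"
    using assms(1) unfolding equivalent_subreps_def by blast
  define \<psi> where "\<psi> = the_inv_into W \<phi>"
  have W: "cfun.subspace W" "\<And>g f. g \<in> G \<Longrightarrow> f \<in> W \<Longrightarrow> \<rho> g f \<in> W"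
    using assms(2) by (auto simp: subrepresentation_def)
  have \<psi>\<phi>: "\<psi> (\<phi> f) = f" if "f \<in> W" for f
    using that \<phi>(1) by (simp add: \<psi>_def bij_betw_def the_inv_into_f_f)
  have ex: "\<exists>f\<in>W. h = \<phi> f" if "h \<in> W'" for h
    using that \<phi>(1) by (auto simp: bij_betw_def)
  show ?thesis
    unfolding equivalent_subreps_def
  proof (intro exI[of _ \<psi>] conjI ballI allI)
    show "bij_betw \<psi> W' W" unfolding \<psi>_def using \<phi>(1) by (rule bij_betw_the_inv_into)
  next
    fix h h' assume "h \<in> W'" "h' \<in> W'"
    then obtain f f' where f: "f \<in> W" "f' \<in> W" "h = \<phi> f" "h' = \<phi> f'" using ex by blast
    then show "\<psi> (h + h') = \<psi> h + \<psi> h'"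
      using \<psi>\<phi>[OF cfun.subspace_add[OF W(1) f(1,2)]] by (simp add: \<phi>(2) \<psi>\<phi>)
  next
    fix c h assume "h \<in> W'"
    then obtain f where f: "f \<in> W" "h = \<phi> f" using ex by blast
    then show "\<psi> (cscale c h) = cscale c (\<psi> h)"
      using \<psi>\<phi>[OF cfun.subspace_scale[OF W(1) f(1), of c]] by (simp add: \<phi>(3) \<psi>\<phi>)
  next
    fix g h assume "g \<in> G" "h \<in> W'"
    then obtain f where f: "f \<in> W" "h = \<phi> f" using ex by blast
    then show "\<psi> (\<rho> g h) = \<rho> g (\<psi> h)"
      using \<psi>\<phi>[OF W(2)[OF \<open>g \<in> G\<close> f(1)]] \<open>g \<in> G\<close> by (simp add: \<phi>(4) \<psi>\<phi>)
  qed
qed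

lemma equivalent_subreps_trans:
  assumes "equivalent_subreps G \<rho> W W'" "equivalent_subreps G \<rho> W' W''"
  shows "equivalent_subreps G \<rho> W W''"
proof -
  obtain \<phi> where \<phi>: "bij_betw \<phi> W W'" "\<And>f g. f \<in> W \<Longrightarrow> g \<in> W \<Longrightarrow> \<phi> (f + g) = \<phi> f + \<phi> g"
    "\<And>c f. f \<in> W \<Longrightarrow> \<phi> (cscale c f) = cscale c (\<phi> f)"
    "\<And>g f. g \<in> G \<Longrightarrow> f \<in> W \<Longrightarrow> \<phi> (\<rho> g f) = \<rho> g (\<phi> f)"
    using assms(1) unfolding equivalent_subreps_def by blast
  obtain \<psi> where \<psi>: "bij_betw \<psi> W' W''" "\<And>f g. f \<in> W' \<Longrightarrow> g \<in> W' \<Longrightarrow> \<psi> (f + g) = \<psi> f + \<psi> g"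
    "\<And>c f. f \<in> W' \<Longrightarrow> \<psi> (cscale c f) = cscale c (\<psi> f)"
    "\<And>g f. g \<in> G \<Longrightarrow> f \<in> W' \<Longrightarrow> \<psi> (\<rho> g f) = \<rho> g (\<psi> f)"
    using assms(2) unfolding equivalent_subreps_def by blast
  have mem: "\<phi> f \<in> W'" if "f \<in> W" for f using \<phi>(1) that by (auto simp: bij_betw_def)
  show ?thesis
    unfolding equivalent_subreps_def
    using bij_betw_trans[OF \<phi>(1) \<psi>(1)] \<phi> \<psi> mem
    by (intro exI[of _ "\<psi> \<circ> \<phi>"]) simp
qed

lemma irreducible_subrep_image:
  assumes act: "acts_by G \<rho> \<Gamma>" and L: "linear_on_space W L"
    and inj: "\<And>f. f \<in> W \<Longrightarrow> L f = 0 \<Longrightarrow> f = 0"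
    and equi: "\<And>\<gamma> f. \<gamma> \<in> \<Gamma> \<Longrightarrow> f \<in> W \<Longrightarrow> L (f \<circ> \<gamma>) = L f \<circ> \<gamma>"
    and irr: "irreducible_subrep G \<rho> W"
  shows "irreducible_subrep G \<rho> (L ` W)"
  unfolding irreducible_subrep_def
proof (intro conjI allI impI)
  have W: "cfun.subspace W" "\<And>\<gamma> f. \<gamma> \<in> \<Gamma> \<Longrightarrow> f \<in> W \<Longrightarrow> f \<circ> \<gamma> \<in> W" "W \<noteq> {0}"
    using irr by (auto simp: irreducible_subrep_def subrepresentation_iff[OF act])
  have L0: "L 0 = 0" by (rule linear_on_space_zero[OF L W(1)])
  show "subrepresentation G \<rho> (L ` W)"
    unfolding subrepresentation_iff[OF act]
  proof (intro conjI ballI)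
    show "cfun.subspace (L ` W)" by (rule subspace_image[OF L W(1)]) simp
    fix \<gamma> h assume g: "\<gamma> \<in> \<Gamma>" and "h \<in> L ` W"
    then obtain f where f: "f \<in> W" "h = L f" by blast
    show "h \<circ> \<gamma> \<in> L ` W" using equi[OF g f(1)] W(2)[OF g f(1)] f(2) by (metis imageI)
  qed
  show "L ` W \<noteq> {0}"
  proof
    assume "L ` W = {0}"
    then have "f = 0" if "f \<in> W" for f using that by (intro inj[OF that]) blast
    then show False using W(3) cfun.subspace_0[OF W(1)] by blast
  qed
  fix U assume U: "subrepresentation G \<rho> U \<and> U \<subseteq> L ` W"
  then have U': "cfun.subspace U" "\<And>\<gamma> f. \<gamma> \<in> \<Gamma> \<Longrightarrow> f \<in> U \<Longrightarrow> f \<circ> \<gamma> \<in> U"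
    by (auto simp: subrepresentation_iff[OF act])
  define V where "V = {f\<in>W. L f \<in> U}"
  have "subrepresentation G \<rho> V"
    unfolding subrepresentation_iff[OF act] cfun.subspace_def V_def
    using cfun.subspace_0[OF W(1)] cfun.subspace_0[OF U'(1)] cfun.subspace_add[OF W(1)]
      cfun.subspace_add[OF U'(1)] cfun.subspace_scale[OF W(1)] cfun.subspace_scale[OF U'(1)]
      linear_on_spaceD[OF L] W(2) U'(2)
    by (simp add: L0 equi del: o_apply)
  moreover have "V \<subseteq> W" by (auto simp: V_def)
  ultimately have "V = {0} \<or> V = W" using irr by (simp add: irreducible_subrep_def)
  moreover have "U = L ` V" using U by (auto simp: V_def)
  ultimately show "U = {0} \<or> U = L ` W" using L0 by auto
qed

section \<open>Rotations\<close>

definition rotations :: "(real^'n \<Rightarrow> real^'n) set"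
  where "rotations = {(*v) A |A. A \<in> SO}"

lemma rotations_iff: "\<gamma> \<in> rotations \<longleftrightarrow> orthogonal_transformation \<gamma> \<and> det (matrix \<gamma>) = 1"
proof
  assume "\<gamma> \<in> rotations"
  then obtain A where "\<gamma> = (*v) A" "rotation_matrix A" by (auto simp: rotations_def SO_def)
  then show "orthogonal_transformation \<gamma> \<and> det (matrix \<gamma>) = 1"
    by (simp add: orthogonal_transformation_matrix rotation_matrix_def matrix_vector_mul_linear)
next
  assume \<gamma>: "orthogonal_transformation \<gamma> \<and> det (matrix \<gamma>) = 1"
  then have "\<gamma> = (*v) (matrix \<gamma>)"
    by (auto simp: fun_eq_iff orthogonal_transformation_linear)
  moreover have "matrix \<gamma> \<in> SO"
    using \<gamma> by (simp add: SO_def rotation_matrix_def orthogonal_transformation_matrix)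
  ultimately show "\<gamma> \<in> rotations" unfolding rotations_def by blast
qed

lemma SO_transpose:
  assumes "A \<in> SO"
  shows "transpose A \<in> SO" "A ** transpose A = mat 1" "transpose A ** A = mat 1"
  using assms by (auto simp: SO_def rotation_matrix_def orthogonal_matrix_def)

lemma isometry_group_rotations: "isometry_group (rotations :: (real^'n \<Rightarrow> real^'n) set)"
  unfolding isometry_group_def
proof (intro conjI ballI)
  have "det (matrix (\<lambda>x::real^'n. x)) = 1"
    using matrix_of_matrix_vector_mul[of "mat 1 :: real^'n^'n"] by simp
  then show "(\<lambda>x. x) \<in> (rotations :: (real^'n \<Rightarrow> real^'n) set)"
    by (simp add: rotations_iff)
next
  fix \<gamma> :: "real^'n \<Rightarrow> real^'n" assume g: "\<gamma> \<in> rotations"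
  then show "orthogonal_transformation \<gamma>" by (simp add: rotations_iff)
  obtain A where A: "\<gamma> = (*v) A" "A \<in> SO" using g by (auto simp: rotations_def)
  have "(*v) (transpose A) \<in> rotations" using SO_transpose(1)[OF A(2)] by (auto simp: rotations_def)
  moreover have "A *v (transpose A *v x) = x" "transpose A *v (A *v x) = x" for x
    by (simp_all only: matrix_vector_mul_assoc SO_transpose(2,3)[OF A(2)] matrix_vector_mul_lid)
  ultimately show "\<exists>\<delta>\<in>rotations. \<forall>x. \<gamma> (\<delta> x) = x \<and> \<delta> (\<gamma> x) = x"
    unfolding A(1) by blast
qed

lemma rotations_transitive:
  fixes a b :: "real^'n"
  assumes "CARD('n) \<ge> 2" "norm a = norm b"
  shows "\<exists>\<gamma>\<in>rotations. \<gamma> a = b"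
  using rotation_exists[OF assms] by (metis rotations_iff)

section \<open>Reflections, and rotations fixing a point\<close>

definition reflection :: "'a::real_inner \<Rightarrow> 'a \<Rightarrow> 'a"
  where "reflection w x = x - (2 * (x \<bullet> w)) *\<^sub>R w"

lemma orthogonal_reflection:
  assumes "norm w = 1"
  shows "orthogonal_transformation (reflection w)"
proof -
  have "w \<bullet> w = 1" using assms by (simp add: norm_eq_1)
  then show ?thesis
    unfolding orthogonal_transformation_def linear_iff reflection_def
    by (auto simp: inner_diff_left inner_diff_right inner_add_left algebra_simps inner_commute)
qed

text \<open>An orthogonal map taking \<open>w\<close> to \<open>w'\<close> conjugates one reflection
  into the other. Equality suffices: a product of two reflections then has as determinant the square
  of a number of modulus 1.\<close>

lemma det_reflection_eq:
  fixes w w' :: "real^'n"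
  assumes "norm w = 1" "norm w' = 1"
  shows "det (matrix (reflection w)) = det (matrix (reflection w'))"
proof -
  obtain g :: "real^'n \<Rightarrow> real^'n" where g: "orthogonal_transformation g" "g w = w'"
    using orthogonal_transformation_exists_1[OF assms] by blast
  have lin: "linear g" "linear (reflection w)" "linear (reflection w')"
    using g assms by (auto intro: orthogonal_transformation_linear orthogonal_reflection)
  have "g x \<bullet> w' = x \<bullet> w" for x
    using g by (auto simp: orthogonal_transformation_def)
  then have "reflection w' \<circ> g = g \<circ> reflection w"
    using lin(1) g(2) by (auto simp: fun_eq_iff reflection_def linear_diff linear_cmul)
  then have "matrix (reflection w') ** matrix g = matrix g ** matrix (reflection w)"
    using lin by (simp flip: matrix_compose)
  then have "det (matrix (reflection w')) * det (matrix g) = det (matrix g) * det (matrix (reflection w))"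
    by (metis det_mul)
  moreover have "det (matrix g) \<noteq> 0" using orthogonal_transformation_det[OF g(1)] by auto
  ultimately show ?thesis by simp
qed

text \<open>The rotation is a product of two reflections; the second one is only needed to correct the
  determinant, and there is room for it in dimension at least three.\<close>

lemma stabiliser_transitive:
  fixes e x y :: "real^'n"
  assumes 3: "CARD('n) \<ge> 3" and eq: "x \<bullet> e = y \<bullet> e" "norm x = norm y"
  shows "\<exists>\<gamma>\<in>rotations. \<gamma> e = e \<and> \<gamma> x = y"
proof (cases "x = y")
  case True
  then show ?thesis
    by (intro bexI[of _ "\<lambda>x. x"] isometry_groupD(1)[OF isometry_group_rotations]) simp
next
  case False
  \<comment> \<open>The reflection along \<open>d\<close> exchanges \<open>x\<close> and
    \<open>y\<close>, which have the same norm, and fixes \<open>e\<close>, since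
    \<open>x - y\<close> is orthogonal to \<open>e\<close>.\<close>
  define d where "d = (x - y) /\<^sub>R norm (x - y)"
  have nd: "norm d = 1" using False by (simp add: d_def)
  \<comment> \<open>In dimension at least three some direction \<open>w\<close> is orthogonal to
    both \<open>e\<close> and \<open>y\<close>; reflecting along it leaves the two prescribed values
    alone.\<close>
  have "dim {e, y} \<le> card {e, y}" by (rule dim_le_card') simp
  also have "\<dots> \<le> 2" by (simp add: card_insert_le_m1)
  finally have "dim {e, y} < DIM(real^'n)" using 3 by simp
  then obtain w0 where w0: "w0 \<noteq> 0" "\<And>v. v \<in> span {e, y} \<Longrightarrow> orthogonal w0 v"
    using orthogonal_to_subspace_exists by blast
  define w where "w = w0 /\<^sub>R norm w0"
  have nw: "norm w = 1" using w0 by (simp add: w_def)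
  have w: "e \<bullet> w = 0" "y \<bullet> w = 0"
    using w0(2)[of e] w0(2)[of y] by (auto simp: w_def orthogonal_def inner_commute span_base)
  define \<gamma> where "\<gamma> = reflection w \<circ> reflection d"
  have lin: "linear (reflection w)" "linear (reflection d)"
    using nd nw by (auto intro: orthogonal_transformation_linear orthogonal_reflection)
  have "orthogonal_transformation \<gamma>"
    unfolding \<gamma>_def by (intro orthogonal_transformation_compose orthogonal_reflection nd nw)
  moreover have "det (matrix \<gamma>) = 1"
  proof -
    have "det (matrix \<gamma>) = det (matrix (reflection d)) * det (matrix (reflection d))"
      unfolding \<gamma>_def matrix_compose[OF lin(2,1)] det_mul det_reflection_eq[OF nw nd] ..
    also have "\<bar>det (matrix (reflection d))\<bar> = 1"
      by (rule orthogonal_transformation_det[OF orthogonal_reflection[OF nd]])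
    then have "det (matrix (reflection d)) * det (matrix (reflection d)) = 1"
      by (metis abs_mult_self_eq mult_1)
    finally show ?thesis .
  qed
  ultimately have "\<gamma> \<in> rotations" by (simp add: rotations_iff)
  moreover have "\<gamma> e = e"
  proof -
    have "e \<bullet> d = 0" using eq(1) by (simp add: d_def inner_diff_right inner_commute)
    then show ?thesis by (simp add: \<gamma>_def reflection_def w)
  qed
  moreover have "\<gamma> x = y"
  proof -
    have "x \<bullet> x = y \<bullet> y" using eq(2) by (simp add: norm_eq)
    then have n: "(norm (x - y))\<^sup>2 = 2 * (x \<bullet> (x - y))"
      unfolding power2_norm_eq_inner by (simp add: algebra_simps inner_commute)
    have "reflection d x = x - (2 * (x \<bullet> (x - y)) / (norm (x - y))\<^sup>2) *\<^sub>R (x - y)"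
      by (simp add: reflection_def d_def power2_eq_square divide_inverse mult_ac)
    also have "\<dots> = y" unfolding n[symmetric] using False by simp
    finally show ?thesis by (simp add: \<gamma>_def reflection_def w)
  qed
  ultimately show ?thesis by blast
qed

section \<open>Decomposition of the harmonic polynomials of one variable group\<close>

lemma hpoly_sphere_zero:
  assumes f: "f \<in> hpoly k" and zero: "\<And>x. norm x = 1 \<Longrightarrow> f x = 0"
  shows "f = 0"
proof
  fix x
  have pos: "f x = 0" if "x \<noteq> 0" for x
    using hpoly_scaleR[OF f, of "norm x" "x /\<^sub>R norm x"] zero[of "x /\<^sub>R norm x"] that by simp
  \<comment> \<open>The origin is reached by scaling a nonzero point with 0. This includes degree 0,
    where \<open>0 ^ k\<close> is 1 and \<open>f\<close> is constant.\<close>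
  obtain e :: 'a where "e \<in> Basis" using nonempty_Basis by blast
  then have "f e = 0" by (intro pos) auto
  then have "f 0 = 0" using hpoly_scaleR[OF f, of 0 e] by simp
  then show "f x = 0 x" using pos by (cases "x = 0") (auto simp: fapply)
qed

lemma card_1_eq_scaleR:
  fixes e x :: "real^'n"
  assumes "CARD('n) = 1" "norm e = 1"
  shows "x = (x \<bullet> e) *\<^sub>R e"
proof -
  obtain i :: 'n where i: "UNIV = {i}" using assms(1) card_1_singletonE by blast
  have inn: "a \<bullet> b = a $ i * b $ i" for a b :: "real^'n" by (simp add: inner_vec_def i)
  have "e $ i * e $ i = 1" using assms(2) inn[of e e] by (simp add: norm_eq_1)
  moreover have "j = i" for j using i by auto
  ultimately have "x $ j = (x \<bullet> e) * e $ j" for j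
    using mult.assoc[of "x $ i" "e $ i" "e $ i"] by (metis inn mult_1_right)
  then show ?thesis by (simp add: vec_eq_iff)
qed

lemma card_1_hpoly:
  fixes e :: "real^'n"
  assumes "CARD('n) = 1" "norm e = 1" "f \<in> hpoly k"
  shows "f = cscale (f e) (coord e ^ k)"
proof
  fix x
  have "f x = f ((x \<bullet> e) *\<^sub>R e)" using card_1_eq_scaleR[OF assms(1,2)] by metis
  then show "f x = cscale (f e) (coord e ^ k) x"
    by (simp add: hpoly_scaleR[OF assms(3)] fapply coord_def)
qed

text \<open>On the line the squared norm is the square of the coordinate. From degree 2 on every
  homogeneous polynomial is a multiple of it, so its harmonic projection is zero.\<close>

lemma card_1_degree:
  fixes f :: "real^'n \<Rightarrow> complex"
  assumes "CARD('n) = 1" "f \<in> harmonic_homogeneous k" "f \<noteq> 0"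
  shows "k \<le> 1"
proof (rule ccontr)
  assume "\<not> k \<le> 1"
  moreover define m where "m = k - 2"
  ultimately have k: "k = Suc (Suc m)" by simp
  obtain e :: "real^'n" where "e \<in> Basis" using nonempty_Basis by blast
  then have e: "norm e = 1" by simp
  have nsq: "nsq = coord e * coord e"
  proof
    fix x
    have "x \<bullet> x = ((x \<bullet> e) *\<^sub>R e) \<bullet> ((x \<bullet> e) *\<^sub>R e)"
      using card_1_eq_scaleR[OF assms(1) e] by metis
    then show "nsq x = (coord e * coord e) x"
      using e by (simp add: nsq_def coord_def fapply norm_eq_1 flip: of_real_mult)
  qed
  have "f = cscale (f e) (coord e ^ k)"
    by (rule card_1_hpoly[OF assms(1) e harmonic_homogeneousD(1)[OF assms(2)]])
  also have "\<dots> = nsq * cscale (f e) (coord e ^ m)"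
    by (simp add: k nsq cscale_mult_right mult.assoc)
  finally have "harmonic_projection f = 0"
    using harmonic_projection_nsq[of "cscale (f e) (coord e ^ m)"] by (simp add: poly_intros)
  then show False
    using harmonic_projection_harmonic[OF harmonic_homogeneous_polys[OF assms(2)]] assms(3) by simp
qed

text \<open>In dimension at least two the orbit is the unit sphere. On the line it is the point
  \<open>e\<close> alone, but there a homogeneous polynomial is determined by its value at
  \<open>e\<close>.\<close>

lemma harmonic_orbit_zero:
  fixes f :: "real^'n \<Rightarrow> complex"
  assumes e: "norm e = 1" and f: "f \<in> hpoly k" and zero: "\<And>\<gamma>. \<gamma> \<in> rotations \<Longrightarrow> f (\<gamma> e) = 0"
  shows "f = 0"
proof (cases "CARD('n) = 1")
  case True
  have "f e = 0" using zero[OF isometry_groupD(1)[OF isometry_group_rotations]] .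
  then show ?thesis using card_1_hpoly[OF True e f] by simp
next
  case False
  have "CARD('n) \<ge> 1" using one_le_card_finite[where 'a = 'n] by simp
  then have 2: "CARD('n) \<ge> 2" using False by linarith
  show ?thesis
  proof (rule hpoly_sphere_zero[OF f])
    fix x :: "real^'n" assume "norm x = 1"
    then obtain \<gamma> where "\<gamma> \<in> rotations" "\<gamma> e = x" using rotations_transitive[OF 2, of e x] e by auto
    then show "f x = 0" using zero by blast
  qed
qed

text \<open>If the degrees differ by an even number, \<open>f'\<close> equals \<open>f\<close> times
  a positive power of the squared norm, and a harmonic polynomial of this kind is zero. If they
  differ by an odd number, antipodal points give opposite signs.\<close>

lemma harmonic_sphere_degree_less:
  fixes f f' :: "'a::euclidean_space \<Rightarrow> complex"
  assumes f: "f \<in> harmonic_homogeneous k" and f': "f' \<in> harmonic_homogeneous k'"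
    and eq: "\<And>x. norm x = 1 \<Longrightarrow> f x = f' x" and less: "k < k'"
  shows "f = 0"
proof (rule hpoly_sphere_zero[OF harmonic_homogeneousD(1)[OF f]])
  fix x :: 'a assume x: "norm x = 1"
  show "f x = 0"
  proof (cases "even (k' - k)")
    case True
    then obtain m where "k' - k = 2 * m" by (elim evenE)
    \<comment> \<open>\<open>m\<close> is positive because the degrees differ; splitting off one
      factor \<open>nsq\<close> prepares for \<open>harmonic_nsq_mult_zero\<close>.\<close>
    moreover define j where "j = m - 1"
    ultimately have j: "k' = 2 * Suc j + k" using less by (cases m) auto
    have "nsq ^ Suc j * f - f' = 0"
    proof (rule hpoly_sphere_zero)
      show "nsq ^ Suc j * f - f' \<in> hpoly k'"
        using nsq_power_hpoly[OF harmonic_homogeneousD(1)[OF f], of "Suc j"]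
          harmonic_homogeneousD(1)[OF f'] unfolding j by (rule hpoly_diff)
      show "(nsq ^ Suc j * f - f') x = 0" if "norm x = 1" for x
        using eq[OF that] that by (simp add: fapply nsq_def norm_eq_1)
    qed
    then have "- f' + nsq * (nsq ^ j * f) = 0" by (simp add: mult.assoc)
    moreover have "- f' \<in> harmonic_polys"
      by (rule cfun.subspace_neg[OF subspace_harmonic_polys harmonic_homogeneous_polys[OF f']])
    moreover have "polynomial_function (nsq ^ j * f)"
      by (intro polynomial_function_times polynomial_function_power polynomial_nsq
          harmonic_homogeneousD(3)[OF f])
    ultimately have "- f' = 0" by (intro harmonic_nsq_mult_zero[of "- f'" "nsq ^ j * f"])
    then show ?thesis using eq[OF x] by (simp add: fapply)
  next
    case False
    have m: "norm (- x) = 1" using x by simp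
    have "f (- x) = (-1) ^ k * f x" "f' (- x) = (-1) ^ k' * f' x"
      using hpoly_scaleR[OF harmonic_homogeneousD(1)[OF f], of "-1" x]
        hpoly_scaleR[OF harmonic_homogeneousD(1)[OF f'], of "-1" x] by simp_all
    then have "(-1) ^ k * f x = (-1) ^ k' * f x" using eq[OF x] eq[OF m] by metis
    moreover have "(-1) ^ k' = - ((-1) ^ k :: complex)"
      using False less by (auto simp: minus_one_power_iff)
    ultimately show ?thesis by (cases "even k") auto
  qed
qed

lemma harmonic_sphere_degree:
  fixes f f' :: "real^'n \<Rightarrow> complex"
  assumes 2: "CARD('n) \<ge> 2" and e: "norm e = 1"
    and f: "f \<in> harmonic_homogeneous k" and f': "f' \<in> harmonic_homogeneous k'"
    and eq: "\<And>\<gamma>. \<gamma> \<in> rotations \<Longrightarrow> f (\<gamma> e) = f' (\<gamma> e)" and "f \<noteq> 0"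
  shows "k = k'"
proof -
  have eq': "f x = f' x" if x: "norm x = 1" for x
  proof -
    obtain \<gamma> where "\<gamma> \<in> rotations" "\<gamma> e = x" using rotations_transitive[OF 2, of e x] e x by auto
    then show ?thesis using eq by blast
  qed
  have "f' \<noteq> 0"
  proof
    assume "f' = 0"
    then have "f = 0" using eq'
      by (intro hpoly_sphere_zero[OF harmonic_homogeneousD(1)[OF f]]) (simp add: fapply)
    then show False using \<open>f \<noteq> 0\<close> by simp
  qed
  then show ?thesis
    using harmonic_sphere_degree_less[OF f f' eq'] harmonic_sphere_degree_less[OF f' f eq'[symmetric]]
      \<open>f \<noteq> 0\<close> by (meson linorder_cases)
qed

subsection \<open>Zonal functions in dimension at least three\<close>

text \<open>The restriction to the plane through \<open>x\<close> and \<open>y\<close> is a binary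
  form of degree \<open>k\<close>, and the witness lists its coefficients.\<close>

lemma hpoly_plane:
  assumes "f \<in> hpoly k"
  shows "\<exists>c. \<forall>a b. f (a *\<^sub>R x + b *\<^sub>R y) = (\<Sum>j\<le>k. of_real a ^ (k - j) * of_real b ^ j * c j)"
  using assms
proof (induction rule: hpoly_induct)
  case one
  then show ?case by (intro exI[of _ "\<lambda>_. 1"]) (simp add: fapply)
next
  case (mult k d f)
  then obtain c where c: "\<And>a b. f (a *\<^sub>R x + b *\<^sub>R y) = (\<Sum>j\<le>k. of_real a ^ (k - j) * of_real b ^ j * c j)"
    by blast
  \<comment> \<open>Coefficients of the product with the linear form
    \<open>a * (x \<bullet> d) + b * (y \<bullet> d)\<close>: its first part keeps the exponent of
    \<open>b\<close>, its second raises it by one. The guard removes the index \<open>Suc k\<close>,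
    which the first part does not reach.\<close>
  define C where "C j = (if j \<le> k then of_real (x \<bullet> d) * c j else 0) +
    (case j of 0 \<Rightarrow> 0 | Suc i \<Rightarrow> of_real (y \<bullet> d) * c i)" for j
  have "(coord d * f) (a *\<^sub>R x + b *\<^sub>R y) =
      (\<Sum>j\<le>Suc k. of_real a ^ (Suc k - j) * of_real b ^ j * C j)" for a b
  proof -
    let ?S = "\<lambda>g. (\<Sum>j\<le>Suc k. of_real a ^ (Suc k - j) * of_real b ^ j * g j) :: complex"
    have "?S C = ?S (\<lambda>j. if j \<le> k then of_real (x \<bullet> d) * c j else 0) +
        ?S (\<lambda>j. case j of 0 \<Rightarrow> 0 | Suc i \<Rightarrow> of_real (y \<bullet> d) * c i)"
      unfolding C_def distrib_left sum.distrib ..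
    also have "?S (\<lambda>j. if j \<le> k then of_real (x \<bullet> d) * c j else 0) =
        of_real (a * (x \<bullet> d)) * (\<Sum>j\<le>k. of_real a ^ (k - j) * of_real b ^ j * c j)"
      unfolding sum_distrib_left
      by (rule sum.mono_neutral_cong_right) (auto simp: Suc_diff_le)
    also have "?S (\<lambda>j. case j of 0 \<Rightarrow> 0 | Suc i \<Rightarrow> of_real (y \<bullet> d) * c i) =
        of_real (b * (y \<bullet> d)) * (\<Sum>j\<le>k. of_real a ^ (k - j) * of_real b ^ j * c j)"
      unfolding sum_distrib_left
      by (subst sum.atMost_Suc_shift) (auto intro!: sum.cong simp: mult_ac)
    finally show ?thesis
      by (simp add: fapply c coord_def inner_add_left algebra_simps del: sum.atMost_Suc)
  qed
  then show ?case by blast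
next
  case (add k f g)
  then obtain c c' where "\<And>a b. f (a *\<^sub>R x + b *\<^sub>R y) = (\<Sum>j\<le>k. of_real a ^ (k - j) * of_real b ^ j * c j)"
    "\<And>a b. g (a *\<^sub>R x + b *\<^sub>R y) = (\<Sum>j\<le>k. of_real a ^ (k - j) * of_real b ^ j * c' j)"
    by blast
  then show ?case
    by (intro exI[of _ "\<lambda>j. c j + c' j"]) (simp add: fapply algebra_simps sum.distrib)
next
  case (zero k)
  then show ?case by (intro exI[of _ "\<lambda>_. 0"]) (simp add: fapply)
next
  case (cscale k f z)
  then obtain c where "\<And>a b. f (a *\<^sub>R x + b *\<^sub>R y) = (\<Sum>j\<le>k. of_real a ^ (k - j) * of_real b ^ j * c j)"
    by blast
  then show ?case
    by (intro exI[of _ "\<lambda>j. z * c j"]) (simp add: fapply algebra_simps sum_distrib_left)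
qed

lemma harmonic_projection_nsq_diff_power:
  fixes g q :: "'a::euclidean_space \<Rightarrow> complex"
  assumes "polynomial_function g" "polynomial_function q"
  shows "harmonic_projection ((nsq - g) ^ i * q) = cscale ((-1) ^ i) (harmonic_projection (g ^ i * q))"
  using assms(2)
proof (induction i arbitrary: q)
  case 0
  then show ?case by simp
next
  case (Suc i)
  define r where "r = (nsq - g) ^ i * q"
  have r: "polynomial_function r"
    unfolding r_def using assms(1) Suc.prems by (auto intro!: poly_intros polynomial_nsq)
  have "(nsq - g) ^ Suc i * q = nsq * r - g * r"
    by (simp add: r_def algebra_simps)
  then have "harmonic_projection ((nsq - g) ^ Suc i * q) = 0 - harmonic_projection (g * r)"
    using harmonic_projection_diff[OF polynomial_function_times[OF polynomial_nsq r]
        polynomial_function_times[OF assms(1) r]] harmonic_projection_nsq[OF r] by simp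
  also have "g * r = (nsq - g) ^ i * (g * q)"
    by (simp add: r_def mult_ac)
  also have "harmonic_projection ((nsq - g) ^ i * (g * q)) =
      cscale ((-1) ^ i) (harmonic_projection (g ^ i * (g * q)))"
    using assms(1) Suc.prems by (intro Suc.IH polynomial_function_times)
  also have "g ^ i * (g * q) = g ^ Suc i * q" by (simp add: mult_ac)
  finally show ?case by simp
qed

text \<open>A function fixed by the stabiliser depends only on the height
  \<open>x \<bullet> e\<close> and the norm, hence is known from its restriction to one plane
  through \<open>e\<close>. Only even powers of the distance from the axis occur there, and the
  square of this distance is \<open>nsq\<close> minus the squared height. Modulo \<open>nsq\<close>
  all terms are therefore multiples of the same power of the height, and \<open>f\<close>, being
  harmonic, equals its own projection.\<close>

lemma zonal_multiple:
  fixes e :: "real^'n" and f :: "real^'n \<Rightarrow> complex"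
  assumes 3: "CARD('n) \<ge> 3" and e: "norm e = 1" and f: "f \<in> harmonic_homogeneous k"
    and fixed: "\<And>\<gamma>. \<gamma> \<in> rotations \<Longrightarrow> \<gamma> e = e \<Longrightarrow> f \<circ> \<gamma> = f"
  shows "\<exists>c. f = cscale c (harmonic_projection (coord e ^ k))"
proof -
  have "dim {e} < DIM(real^'n)" using dim_le_card'[of "{e}"] 3 by simp
  then obtain w where w: "w \<noteq> 0" "\<And>v. v \<in> span {e} \<Longrightarrow> orthogonal w v"
    using orthogonal_to_subspace_exists by blast
  define e2 where "e2 = w /\<^sub>R norm w"
  have e2: "norm e2 = 1" "e \<bullet> e2 = 0" "e2 \<bullet> e = 0"
    using w(1) w(2)[of e] by (auto simp: e2_def orthogonal_def inner_commute span_base)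
  have ee: "e \<bullet> e = 1" "e2 \<bullet> e2 = 1" using e e2 by (simp_all add: norm_eq_1)
  have f_eq: "f x = f y" if xy: "x \<bullet> e = y \<bullet> e" "norm x = norm y" for x y
  proof -
    obtain \<gamma> where g: "\<gamma> \<in> rotations" "\<gamma> e = e" "\<gamma> x = y"
      using stabiliser_transitive[OF 3 xy] by blast
    show ?thesis using fun_cong[OF fixed[OF g(1,2)], of x] g(3) by simp
  qed
  obtain c where c: "\<And>a b. f (a *\<^sub>R e + b *\<^sub>R e2) =
      (\<Sum>j\<le>k. of_real a ^ (k - j) * of_real b ^ j * c j)"
    using hpoly_plane[OF harmonic_homogeneousD(1)[OF f], of e e2] by blast
  \<comment> \<open>The points \<open>e + t e2\<close> and \<open>e - t e2\<close> have the same
    height and norm, so the binary form at \<open>a = 1\<close> is even in \<open>t\<close>.\<close>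
  have odd: "c j = 0" if j: "odd j" "j \<le> k" for j
  proof -
    have "(\<Sum>j\<le>k. of_real t ^ j * (c j - (-1) ^ j * c j)) = 0" for t :: real
    proof -
      have "f (1 *\<^sub>R e + t *\<^sub>R e2) = f (1 *\<^sub>R e + (- t) *\<^sub>R e2)"
        by (rule f_eq) (simp_all add: e2 ee inner_simps norm_eq_sqrt_inner)
      then have "(\<Sum>j\<le>k. of_real t ^ j * c j) = (\<Sum>j\<le>k. of_real (- t) ^ j * c j)"
        unfolding c by simp
      also have "\<dots> = (\<Sum>j\<le>k. of_real t ^ j * ((-1) ^ j * c j))"
        unfolding of_real_minus power_minus[of "of_real t"] by (simp only: mult_ac)
      finally have "(\<Sum>j\<le>k. of_real t ^ j * c j) = (\<Sum>j\<le>k. of_real t ^ j * ((-1) ^ j * c j))" .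
      then show ?thesis by (simp add: right_diff_distrib sum_subtractf)
    qed
    from complex_polyfun_eq_0[OF this j(2)] j(1) show ?thesis by simp
  qed
  \<comment> \<open>The monomial in \<open>a\<close> and \<open>b\<close> rewritten as a polynomial
    on the whole space, with \<open>nsq - coord e ^ 2\<close> in place of the square of
    \<open>b\<close>.\<close>
  define q where "q j = (if even j then cscale (c j) ((nsq - coord e ^ 2) ^ (j div 2) * coord e ^ (k - j)) else 0)" for j
  have pol: "polynomial_function (q j)" for j
    by (auto simp: q_def intro!: poly_intros polynomial_nsq)
  have "f = (\<Sum>j\<le>k. q j)"
  proof
    fix x
    \<comment> \<open>\<open>a\<close> and \<open>b\<close> are the coordinates of a point of the
      plane with the same height and norm as \<open>x\<close>; by Cauchy-Schwarz the root is taken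
      of a nonnegative number.\<close>
    define a where "a = x \<bullet> e"
    define b where "b = sqrt (x \<bullet> x - a\<^sup>2)"
    have "a\<^sup>2 \<le> x \<bullet> x"
      using Cauchy_Schwarz_ineq[of x e] by (simp add: a_def ee)
    then have b: "b\<^sup>2 = x \<bullet> x - a\<^sup>2" by (simp add: b_def)
    have "f x = f (a *\<^sub>R e + b *\<^sub>R e2)"
    proof (rule f_eq)
      show "x \<bullet> e = (a *\<^sub>R e + b *\<^sub>R e2) \<bullet> e" by (simp add: inner_simps ee e2 a_def)
      have "(a *\<^sub>R e + b *\<^sub>R e2) \<bullet> (a *\<^sub>R e + b *\<^sub>R e2) = a\<^sup>2 + b\<^sup>2"
        by (simp add: inner_simps ee e2 power2_eq_square)
      then show "norm x = norm (a *\<^sub>R e + b *\<^sub>R e2)"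
        unfolding norm_eq_sqrt_inner b by simp
    qed
    also have "\<dots> = (\<Sum>j\<le>k. q j x)"
      unfolding c
    proof (rule sum.cong[OF refl])
      fix j assume "j \<in> {..k}"
      then show "of_real a ^ (k - j) * of_real b ^ j * c j = q j x"
      proof (cases "even j")
        case True
        then have "of_real b ^ j = (of_real (b\<^sup>2) :: complex) ^ (j div 2)"
          by (simp flip: power_mult)
        then show ?thesis
          using True by (simp add: q_def fapply nsq_def coord_def b a_def)
      next
        case False
        then show ?thesis using odd[of j] \<open>j \<in> {..k}\<close> by (simp add: q_def fapply)
      qed
    qed
    finally show "f x = (\<Sum>j\<le>k. q j) x" by (simp add: fapply)
  qed
  then have "harmonic_projection f = (\<Sum>j\<le>k. harmonic_projection (q j))"
    using pol by (simp add: harmonic_projection_sum)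
  also have "\<dots> = (\<Sum>j\<le>k. cscale (if even j then c j * (-1) ^ (j div 2) else 0)
      (harmonic_projection (coord e ^ k)))"
  proof (rule sum.cong[OF refl])
    fix j assume j: "j \<in> {..k}"
    show "harmonic_projection (q j) = cscale (if even j then c j * (-1) ^ (j div 2) else 0)
      (harmonic_projection (coord e ^ k))"
    proof (cases "even j")
      case True
      define i where "i = j div 2"
      have ji: "j = 2 * i" using True by (simp add: i_def)
      have "harmonic_projection (q j) =
          cscale (c j) (harmonic_projection ((nsq - coord e ^ 2) ^ i * coord e ^ (k - j)))"
        using True by (simp add: q_def i_def harmonic_projection_cscale poly_intros polynomial_nsq)
      also have "harmonic_projection ((nsq - coord e ^ 2) ^ i * coord e ^ (k - j)) =
          cscale ((-1) ^ i) (harmonic_projection ((coord e ^ 2) ^ i * coord e ^ (k - j)))"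
        by (intro harmonic_projection_nsq_diff_power poly_intros)
      also have "(coord e ^ 2) ^ i * coord e ^ (k - j) = coord e ^ k"
        using j ji by (simp flip: power_mult power_add)
      finally show ?thesis using True by (simp add: i_def)
    next
      case False
      then show ?thesis by (simp add: q_def harmonic_projection_zero)
    qed
  qed
  also have "\<dots> = cscale (\<Sum>j\<le>k. if even j then c j * (-1) ^ (j div 2) else 0)
      (harmonic_projection (coord e ^ k))"
    by (simp only: cfun.scale_sum_left)
  finally show ?thesis
    using harmonic_projection_harmonic[OF harmonic_homogeneous_polys[OF f]] by metis
qed

subsection \<open>Spherical pieces\<close>

text \<open>The plane is excluded because a rotation fixing \<open>e\<close> is the identity there:
  for positive \<open>k\<close> all functions are fixed, and they form a space of dimension
  two.\<close>

lemma spherical_harmonic: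
  fixes e :: "real^'n"
  assumes "CARD('n) \<noteq> 2" "norm e = 1"
  shows "spherical rotations e (harmonic_homogeneous k)"
  unfolding spherical_def
proof (intro conjI ballI impI)
  show "cfun.subspace (harmonic_homogeneous k)" by (rule subspace_harmonic_homogeneous)
  show "f \<circ> \<gamma> \<in> harmonic_homogeneous k"
    if "\<gamma> \<in> rotations" "f \<in> harmonic_homogeneous k" for \<gamma> :: "real^'n \<Rightarrow> real^'n" and f
    using that by (intro harmonic_homogeneous_compose_orthogonal) (auto simp: rotations_iff)
  show "f = 0" if "f \<in> harmonic_homogeneous k" "\<forall>\<gamma>\<in>rotations. f (\<gamma> e) = 0" for f
    using that harmonic_orbit_zero[OF assms(2)] harmonic_homogeneousD(1) by blast
  show "\<exists>z. \<forall>f\<in>harmonic_homogeneous k. (\<forall>\<gamma>\<in>rotations. \<gamma> e = e \<longrightarrow> f \<circ> \<gamma> = f) \<longrightarrow> (\<exists>c. f = cscale c z)"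
  proof (cases "CARD('n) = 1")
    case True
    then show ?thesis
      using card_1_hpoly[OF True assms(2)] harmonic_homogeneousD(1) by blast
  next
    case False
    have "CARD('n) \<ge> 1" using one_le_card_finite[where 'a = 'n] by simp
    then have 3: "CARD('n) \<ge> 3" using False assms(1) by linarith
    show ?thesis using zonal_multiple[OF 3 assms(2)] by blast
  qed
qed

lemma spherical_line:
  assumes "(\<lambda>x. x) \<in> \<Gamma>" "\<And>\<gamma>. \<gamma> \<in> \<Gamma> \<Longrightarrow> \<exists>\<omega>. h \<circ> \<gamma> = cscale \<omega> h" "h x0 \<noteq> 0"
  shows "spherical \<Gamma> x0 (range (\<lambda>c. cscale c h))"
  unfolding spherical_def
proof (intro conjI ballI impI)
  show "cfun.subspace (range (\<lambda>c. cscale c h))"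
    using cfun.subspace_span[of "{h}"] by (simp add: cfun.span_singleton)
next
  fix \<gamma> f assume g: "\<gamma> \<in> \<Gamma>" and "f \<in> range (\<lambda>c. cscale c h)"
  then obtain c where "f = cscale c h" by blast
  moreover obtain \<omega> where "h \<circ> \<gamma> = cscale \<omega> h" using assms(2)[OF g] by blast
  then have "h (\<gamma> x) = \<omega> * h x" for x by (auto simp: fun_eq_iff fapply)
  ultimately have "f \<circ> \<gamma> = cscale (c * \<omega>) h" by (simp add: fun_eq_iff fapply)
  then show "f \<circ> \<gamma> \<in> range (\<lambda>c. cscale c h)" by blast
next
  fix f assume "f \<in> range (\<lambda>c. cscale c h)" and v: "\<forall>\<gamma>\<in>\<Gamma>. f (\<gamma> x0) = 0"
  then obtain c where "f = cscale c h" by blast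
  moreover have "f x0 = 0" using bspec[OF v assms(1)] .
  ultimately show "f = 0" using assms(3) by (simp add: fapply)
qed (auto intro!: exI[of _ h])

section \<open>The plane: lines spanned by powers of a complex coordinate\<close>

definition zlin :: "complex \<Rightarrow> 'a::euclidean_space \<Rightarrow> 'a \<Rightarrow> 'a \<Rightarrow> complex"
  where "zlin \<iota> e1 e2 = coord e1 + cscale \<iota> (coord e2)"

text \<open>With \<open>\<iota>\<close> equal to \<open>\<i>\<close> or \<open>- \<i>\<close> these
  are powers of a complex coordinate or of its conjugate. The gradient \<open>p\<close> of the
  linear form is isotropic, as its square is \<open>1 + \<iota> * \<iota>\<close>, and this square
  is a factor of the Laplacian of every power.\<close>

lemma zlin_power_harmonic:
  fixes e1 e2 :: "'a::euclidean_space"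
  assumes "norm e1 = 1" "norm e2 = 1" "e1 \<bullet> e2 = 0" "\<iota> * \<iota> = -1"
  shows "zlin \<iota> e1 e2 ^ k \<in> harmonic_homogeneous k"
proof -
  define g where "g = zlin \<iota> e1 e2"
  define p where "p b = of_real (b \<bullet> e1) + \<iota> * of_real (b \<bullet> e2)" for b
  have g: "g \<in> hpoly 1" unfolding g_def zlin_def by (intro hpoly_add hpoly_cscale hpoly_coord)
  have pg: "polynomial_function g" using g by (rule polynomial_hpoly)
  have pdg: "pd b g = cscale (p b) 1" for b
    unfolding g_def zlin_def
    by (simp add: pd_add pd_cscale poly_intros) (simp add: p_def fun_eq_iff fapply)
  have pdpow: "pd b (g ^ Suc m) = cscale (of_nat (Suc m) * p b) (g ^ m)" for b m
  proof (induction m)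
    case 0
    show ?case by (simp add: pdg)
  next
    case (Suc m)
    have "pd b (g ^ Suc (Suc m)) = pd b g * g ^ Suc m + g * pd b (g ^ Suc m)"
      by (subst power_Suc) (rule pd_times[OF pg polynomial_function_power[OF pg]])
    also have "\<dots> = cscale (of_nat (Suc (Suc m)) * p b) (g ^ Suc m)"
      unfolding Suc pdg by (simp add: fun_eq_iff fapply algebra_simps)
    finally show ?case .
  qed
  have psum: "(\<Sum>b\<in>Basis. p b * p b) = 0"
  proof -
    have s: "(\<Sum>b\<in>Basis. (b \<bullet> x) * (b \<bullet> y)) = x \<bullet> y" for x y :: 'a
      by (subst (3) euclidean_inner) (simp add: inner_commute)
    have "(\<Sum>b\<in>Basis. p b * p b) = of_real (\<Sum>b\<in>Basis. (b \<bullet> e1) * (b \<bullet> e1)) +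
        2 * \<iota> * of_real (\<Sum>b\<in>Basis. (b \<bullet> e1) * (b \<bullet> e2)) +
        \<iota> * \<iota> * of_real (\<Sum>b\<in>Basis. (b \<bullet> e2) * (b \<bullet> e2))"
      by (simp add: p_def algebra_simps sum.distrib sum_distrib_left)
    then show ?thesis unfolding s assms(3,4) using assms(1,2) by (simp add: norm_eq_1)
  qed
  have "laplacian (g ^ k) = 0"
  proof (cases k)
    case 0
    then show ?thesis by (simp add: laplacian_eq)
  next
    case (Suc m)
    show ?thesis
    proof (cases m)
      case 0
      then show ?thesis using laplacian_hpoly_low[OF g] Suc by simp
    next
      case (Suc l)
      have "pd b (pd b (g ^ k)) = cscale (of_nat k * of_nat m * (p b * p b)) (g ^ l)" for b
        unfolding \<open>k = Suc m\<close> pdpow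
        unfolding \<open>m = Suc l\<close> pd_cscale[OF polynomial_function_power[OF pg]] pdpow
        by (simp add: mult_ac)
      then have "laplacian (g ^ k) = cscale (of_nat k * of_nat m * (\<Sum>b\<in>Basis. p b * p b)) (g ^ l)"
        by (simp only: laplacian_eq sum_distrib_left cfun.scale_sum_left)
      then show ?thesis by (simp add: psum)
    qed
  qed
  moreover have "g ^ k \<in> hpoly k" using hpoly_power[OF g, of k] by simp
  ultimately show ?thesis by (simp add: harmonic_homogeneous_eq g_def)
qed

text \<open>The squares of the two differences that should vanish add up to the sum of the squared
  entries, which is 2, minus twice the determinant.\<close>

lemma card_2_matrix:
  fixes A :: "real^'n^'n"
  assumes U: "UNIV = {i, j}" "i \<noteq> j" and A: "A \<in> SO"
  shows "A $ j $ j = A $ i $ i" "A $ j $ i = - (A $ i $ j)"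
proof -
  have fin: "finite {j}" "i \<notin> {j}" using U(2) by auto
  have "det A = A$i$i * A$j$j - A$i$j * A$j$i"
    unfolding det_def U(1) unfolding sum_over_permutations_insert[OF fin] unfolding permutes_sing
    using U(2) by (simp add: sign_swap_id sign_id swap_id_eq)
  then have d: "A$i$i * A$j$j - A$i$j * A$j$i = 1"
    using A by (simp add: SO_def rotation_matrix_def)
  have s: "(\<Sum>l\<in>UNIV. h l) = h i + h j" for h :: "'n \<Rightarrow> real" unfolding U(1) using U(2) by simp
  have "(transpose A ** A) $ l $ l = 1" for l
    using SO_transpose(3)[OF A] by (simp add: mat_def)
  then have "A$i$l * A$i$l + A$j$l * A$j$l = 1" for l
    by (simp add: matrix_matrix_mult_def transpose_def s)
  from this[of i] this[of j]
  have "(A$i$i - A$j$j)\<^sup>2 + (A$i$j + A$j$i)\<^sup>2 = 0"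
    using d by (simp add: power2_eq_square algebra_simps)
  then show "A $ j $ j = A $ i $ i" "A $ j $ i = - (A $ i $ j)"
    by (auto simp: sum_power2_eq_zero_iff)
qed

text \<open>In the plane, harmonic polynomials of degree \<open>k\<close> are spanned by the powers of \<open>z\<close> and of its
  conjugate, since every polynomial reduces to these modulo the square of the norm.\<close>

lemma hpoly_card_2:
  fixes e1 e2 :: "real^'n" and f :: "real^'n \<Rightarrow> complex"
  assumes e: "norm e1 = 1" "norm e2 = 1" "e1 \<bullet> e2 = 0"
    and expand: "\<And>x::real^'n. x = (x \<bullet> e1) *\<^sub>R e1 + (x \<bullet> e2) *\<^sub>R e2"
  shows "f \<in> hpoly k \<Longrightarrow> \<exists>c d Q. polynomial_function Q \<and>
    f = cscale c (zlin \<i> e1 e2 ^ k) + cscale d (zlin (- \<i>) e1 e2 ^ k) + nsq * Q"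
proof (induction rule: hpoly_induct)
  case one
  show ?case
    by (intro exI[of _ 1] exI[of _ 0]) (simp add: poly_intros)
next
  case (mult k b f)
  define z where "z = zlin \<i> e1 e2"
  define w where "w = zlin (- \<i>) e1 e2"
  have zx: "z x = of_real (x \<bullet> e1) + \<i> * of_real (x \<bullet> e2)"
    and wx: "w x = of_real (x \<bullet> e1) - \<i> * of_real (x \<bullet> e2)" for x
    by (simp_all add: z_def w_def zlin_def fapply coord_def)
  have pz: "polynomial_function z" "polynomial_function w"
    unfolding z_def w_def zlin_def by (intro poly_intros)+
  have inn: "x \<bullet> y = (x \<bullet> e1) * (y \<bullet> e1) + (x \<bullet> e2) * (y \<bullet> e2)" for x y
  proof -
    have "x \<bullet> y = ((x \<bullet> e1) *\<^sub>R e1 + (x \<bullet> e2) *\<^sub>R e2) \<bullet> y"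
      by (subst expand[of x]) (rule refl)
    also have "\<dots> = (x \<bullet> e1) * (e1 \<bullet> y) + (x \<bullet> e2) * (e2 \<bullet> y)"
      by (simp add: inner_add_left)
    finally show ?thesis by (simp only: inner_commute[of e1 y] inner_commute[of e2 y])
  qed
  have zw: "z * w = nsq"
  proof
    fix x
    have "z x * w x = of_real ((x \<bullet> e1) * (x \<bullet> e1) + (x \<bullet> e2) * (x \<bullet> e2))"
      unfolding zx wx by (simp add: algebra_simps)
    then show "(z * w) x = nsq x" by (simp add: fapply nsq_def inn[of x x])
  qed
  define \<alpha> where "\<alpha> = (of_real (b \<bullet> e1) - \<i> * of_real (b \<bullet> e2)) / 2"
  define \<beta> where "\<beta> = (of_real (b \<bullet> e1) + \<i> * of_real (b \<bullet> e2)) / 2"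
  have b: "coord b = cscale \<alpha> z + cscale \<beta> w"
  proof
    fix x
    have "coord b x = of_real (x \<bullet> e1) * of_real (b \<bullet> e1) + of_real (x \<bullet> e2) * of_real (b \<bullet> e2)"
      by (simp add: coord_def inn[of x b])
    also have "\<dots> = \<alpha> * z x + \<beta> * w x"
      unfolding zx wx \<alpha>_def \<beta>_def by (simp add: field_simps)
    finally show "coord b x = (cscale \<alpha> z + cscale \<beta> w) x" by (simp add: fapply)
  qed
  obtain c d Q where Q: "polynomial_function Q" "f = cscale c (z ^ k) + cscale d (w ^ k) + nsq * Q"
    using mult.IH unfolding z_def w_def by blast
  have pb: "polynomial_function (coord b)" by (rule polynomial_function_coord)
  show ?case
  proof (cases k)
    \<comment> \<open>Both zeroth powers are 1, so the two constants of \<open>f\<close> only enter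
      through their sum.\<close>
    case 0
    have "coord b * f = cscale (\<alpha> * (c + d)) (z ^ Suc k) + cscale (\<beta> * (c + d)) (w ^ Suc k) +
        nsq * (coord b * Q)"
      unfolding Q(2) 0 unfolding b by (simp add: fun_eq_iff fapply algebra_simps)
    then show ?thesis
      using polynomial_function_times[OF pb Q(1)] unfolding z_def w_def by blast
  next
    case (Suc m)
    \<comment> \<open>Collects the mixed products: in each a factor \<open>z * w\<close> can be
      split off, which is \<open>nsq\<close>.\<close>
    define R where "R = cscale (\<alpha> * d) (w ^ m) + cscale (\<beta> * c) (z ^ m) + coord b * Q"
    have "coord b * f = cscale (\<alpha> * c) (z ^ Suc k) + cscale (\<beta> * d) (w ^ Suc k) + nsq * R"
      unfolding Q(2) R_def Suc zw[symmetric] unfolding b by (simp add: fun_eq_iff fapply algebra_simps)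
    moreover have "polynomial_function R"
      unfolding R_def using pz Q(1) by (intro poly_intros)
    ultimately show ?thesis unfolding z_def w_def by blast
  qed
next
  case (add k f g)
  then obtain c d Q c' d' Q' where "polynomial_function Q" "polynomial_function Q'"
    "f = cscale c (zlin \<i> e1 e2 ^ k) + cscale d (zlin (- \<i>) e1 e2 ^ k) + nsq * Q"
    "g = cscale c' (zlin \<i> e1 e2 ^ k) + cscale d' (zlin (- \<i>) e1 e2 ^ k) + nsq * Q'"
    by blast
  then show ?case
    by (intro exI[of _ "c + c'"] exI[of _ "d + d'"] exI[of _ "Q + Q'"])
       (simp add: poly_intros cfun.scale_left_distrib distrib_left)
next
  case (zero k)
  show ?case by (intro exI[of _ 0]) (simp add: poly_intros)
next
  case (cscale k f a)
  then obtain c d Q where "polynomial_function Q"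
    "f = cscale c (zlin \<i> e1 e2 ^ k) + cscale d (zlin (- \<i>) e1 e2 ^ k) + nsq * Q"
    by blast
  then show ?case
    by (intro exI[of _ "a * c"] exI[of _ "a * d"] exI[of _ "cscale a Q"])
       (simp add: poly_intros cfun.scale_right_distrib cscale_mult_right)
qed

lemma direct_sum_single:
  assumes "cfun.subspace V"
  shows "direct_sum V {..<1::nat} (\<lambda>_. V)"
proof -
  have one: "{..<1::nat} = {0}" by auto
  show ?thesis
    unfolding direct_sum_def one
  proof (intro conjI ballI allI impI)
    show "V = {(\<Sum>i\<in>{0::nat}. f i) |f. \<forall>i\<in>{0}. f i \<in> V}"
    proof (intro equalityI subsetI)
      fix x assume "x \<in> V"
      then show "x \<in> {(\<Sum>i\<in>{0::nat}. f i) |f. \<forall>i\<in>{0}. f i \<in> V}"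
        by (intro CollectI exI[of _ "\<lambda>_. x"]) simp
    qed auto
  qed (use assms in auto)
qed

lemma spherical_pieces_card_2:
  assumes 2: "CARD('n) = 2"
  shows "\<exists>e::real^'n. norm e = 1 \<and> (\<forall>k. \<exists>N P. direct_sum (harmonic_homogeneous k) {..<N::nat} P \<and>
    (\<forall>j<N. spherical rotations e (P j) \<and> P j \<noteq> {0}))"
proof -
  obtain i j :: 'n where U: "UNIV = {i, j}" "i \<noteq> j"
    using 2 by (auto simp: card_2_iff)
  define e1 e2 :: "real^'n" where "e1 = axis i 1" and "e2 = axis j 1"
  have xe: "x \<bullet> e1 = x $ i" "x \<bullet> e2 = x $ j" for x by (simp_all add: e1_def e2_def inner_axis)
  have e: "norm e1 = 1" "norm e2 = 1" "e1 \<bullet> e2 = 0"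
    using U(2) by (simp_all add: e1_def e2_def inner_axis_axis)
  have expand: "x = (x \<bullet> e1) *\<^sub>R e1 + (x \<bullet> e2) *\<^sub>R e2" for x :: "real^'n"
  proof -
    have "l = i \<or> l = j" for l using U by auto
    then show ?thesis using U(2) unfolding xe by (auto simp: vec_eq_iff e1_def e2_def axis_def)
  qed
  define z where "z \<iota> = zlin \<iota> e1 e2" for \<iota>
  have zx: "z \<iota> x = of_real (x $ i) + \<iota> * of_real (x $ j)" for \<iota> x
    by (simp add: z_def zlin_def fapply coord_def xe)
  \<comment> \<open>By \<open>card_2_matrix\<close> a rotation of the plane is multiplication of the
    complex coordinate by a number \<open>\<omega>\<close> read off from the first row, so its
    powers are eigenfunctions.\<close>
  have rot: "\<exists>\<omega>. (z \<iota> ^ k) \<circ> \<gamma> = cscale \<omega> (z \<iota> ^ k)" if g: "\<gamma> \<in> rotations" and "\<iota> * \<iota> = -1" for \<gamma> \<iota> k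
  proof -
    obtain A where A: "\<gamma> = (*v) A" "A \<in> SO" using g by (auto simp: rotations_def)
    have s: "(\<Sum>l\<in>UNIV. h l) = h i + h j" for h :: "'n \<Rightarrow> real" unfolding U(1) using U(2) by simp
    define \<omega> where "\<omega> = of_real (A$i$i) - \<iota> * of_real (A$i$j)"
    have "z \<iota> (\<gamma> x) = \<omega> * z \<iota> x" for x
    proof -
      have "z \<iota> (\<gamma> x) = of_real (A$i$i * x$i + A$i$j * x$j) + \<iota> * of_real (A$i$i * x$j - A$i$j * x$i)"
        unfolding zx A(1) using card_2_matrix[OF U A(2)] by (simp add: matrix_vector_mult_def s)
      also have "\<dots> = of_real (A$i$i) * (of_real (x$i) + \<iota> * of_real (x$j)) - \<iota> * of_real (A$i$j) * of_real (x$i)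
          - (\<iota> * \<iota>) * of_real (A$i$j) * of_real (x$j)"
        unfolding \<open>\<iota> * \<iota> = -1\<close> by (simp add: algebra_simps)
      also have "\<dots> = \<omega> * z \<iota> x" unfolding zx \<omega>_def by (simp add: algebra_simps)
      finally show ?thesis .
    qed
    then show ?thesis
      by (intro exI[of _ "\<omega> ^ k"]) (simp add: fun_eq_iff fapply power_mult_distrib)
  qed
  have ze: "(z \<iota> ^ k) e1 \<noteq> 0" for \<iota> k
    using U(2) by (simp add: fapply zx e1_def axis_def)
  define L where "L \<iota> k = range (\<lambda>c. cscale c (z \<iota> ^ k))" for \<iota> k
  have sph: "spherical rotations e1 (L \<iota> k)" if "\<iota> * \<iota> = -1" for \<iota> k
    unfolding L_def using isometry_groupD(1)[OF isometry_group_rotations] rot[OF _ that] ze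
    by (rule spherical_line)
  have subL: "cfun.subspace (L \<iota> k)" for \<iota> k
    using cfun.subspace_span[of "{z \<iota> ^ k}"] by (simp add: cfun.span_singleton L_def)
  have L0: "L \<iota> k \<noteq> {0}" for \<iota> k
  proof
    assume "L \<iota> k = {0}"
    then have "cscale 1 (z \<iota> ^ k) = 0" unfolding L_def by blast
    then show False using ze[of \<iota> k] by (simp add: fapply)
  qed
  have harm: "z \<iota> ^ k \<in> harmonic_homogeneous k" if "\<iota> * \<iota> = -1" for \<iota> k
    unfolding z_def using e that by (rule zlin_power_harmonic)
  have LH: "L \<iota> k \<subseteq> harmonic_homogeneous k" if "\<iota> * \<iota> = -1" for \<iota> k
    unfolding L_def using cfun.subspace_scale[OF subspace_harmonic_homogeneous harm[OF that]] by blast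
  have span: "\<exists>c d. f = cscale c (z \<i> ^ k) + cscale d (z (- \<i>) ^ k)"
    if f: "f \<in> harmonic_homogeneous k" for f k
  proof -
    obtain c d Q where Q: "polynomial_function Q"
      "f = cscale c (z \<i> ^ k) + cscale d (z (- \<i>) ^ k) + nsq * Q"
      using hpoly_card_2[OF e expand harmonic_homogeneousD(1)[OF f]] unfolding z_def by blast
    have "cscale c (z \<i> ^ k) + cscale d (z (- \<i>) ^ k) \<in> harmonic_polys"
      using harm by (intro cfun.subspace_add[OF subspace_harmonic_polys]
          cfun.subspace_scale[OF subspace_harmonic_polys] harmonic_homogeneous_polys[of _ k]) auto
    from harmonic_projection_eqI[OF this Q(1)] have
      "f = cscale c (z \<i> ^ k) + cscale d (z (- \<i>) ^ k)"
      using harmonic_projection_harmonic[OF harmonic_homogeneous_polys[OF f]] Q(2) by simp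
    then show ?thesis by blast
  qed
  have indep: "c = 0 \<and> d = 0" if k: "k > 0" and zero: "cscale c (z \<i> ^ k) + cscale d (z (- \<i>) ^ k) = 0" for c d k
  proof -
    have v: "c * z \<i> x ^ k + d * z (- \<i>) x ^ k = 0" for x
      using fun_cong[OF zero, of x] by (simp add: fapply)
    have 1: "c + d = 0" using v[of e1] U(2) by (simp add: zx e1_def axis_def)
    \<comment> \<open>At this angle the k-th powers of the coordinate and its conjugate are
      \<open>\<i>\<close> and \<open>- \<i>\<close>, which gives \<open>c = d\<close>; the point
      \<open>e1\<close> has given \<open>c + d = 0\<close>.\<close>
    define \<theta> where "\<theta> = pi / (2 * real k)"
    define x :: "real^'n" where "x = cos \<theta> *\<^sub>R e1 + sin \<theta> *\<^sub>R e2"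
    have "x $ i = cos \<theta>" "x $ j = sin \<theta>" using U(2) by (auto simp: x_def e1_def e2_def axis_def)
    then have zc: "z \<i> x = cis \<theta>" "z (- \<i>) x = cis (- \<theta>)"
      by (simp_all add: zx complex_eq_iff)
    have k\<theta>: "real k * \<theta> = pi / 2" using k by (simp add: \<theta>_def)
    have "z \<i> x ^ k = cis (real k * \<theta>)" "z (- \<i>) x ^ k = cis (- (real k * \<theta>))"
      unfolding zc using Complex.DeMoivre[of \<theta> k] Complex.DeMoivre[of "- \<theta>" k] by simp_all
    then have "z \<i> x ^ k = cis (pi / 2)" "z (- \<i>) x ^ k = cis (- (pi / 2))"
      unfolding k\<theta> .
    then have "z \<i> x ^ k = \<i>" "z (- \<i>) x ^ k = - \<i>"
      by (simp_all add: complex_eq_iff)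
    then have "(c - d) * \<i> = 0" using v[of x] by (simp add: algebra_simps)
    then show ?thesis using 1 by (simp add: add_eq_0_iff)
  qed
  have "\<exists>N P. direct_sum (harmonic_homogeneous k) {..<N::nat} P \<and>
    (\<forall>l<N. spherical rotations e1 (P l) \<and> P l \<noteq> {0})" for k
  proof (cases "k = 0")
    \<comment> \<open>In degree 0 the two lines coincide, so there is a single piece.\<close>
    case True
    have "harmonic_homogeneous k = L \<i> k"
    proof
      show "harmonic_homogeneous k \<subseteq> L \<i> k"
      proof
        fix f :: "real^'n \<Rightarrow> complex" assume "f \<in> harmonic_homogeneous k"
        then obtain c d where "f = cscale c (z \<i> ^ k) + cscale d (z (- \<i>) ^ k)" using span by blast
        then have "f = cscale (c + d) (z \<i> ^ k)" by (simp add: True cfun.scale_left_distrib)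
        then show "f \<in> L \<i> k" by (auto simp: L_def)
      qed
    qed (rule LH, simp)
    then have ds: "direct_sum (harmonic_homogeneous k) {..<1} (\<lambda>_::nat. L \<i> k)"
      using direct_sum_single[OF subL, of \<i> k] by simp
    show ?thesis
    proof (intro exI conjI allI impI)
      show "direct_sum (harmonic_homogeneous k) {..<1} (\<lambda>_::nat. L \<i> k)" by (rule ds)
      show "spherical rotations e1 (L \<i> k)" by (rule sph) simp
      show "L \<i> k \<noteq> {0}" by (rule L0)
    qed
  next
    case False
    define P where "P l = (if l = 0 then L \<i> k else L (- \<i>) k)" for l :: nat
    have two: "{..<2::nat} = {0, 1}" by auto
    have "direct_sum (harmonic_homogeneous k) {..<2} P"
      unfolding direct_sum_def
    proof (intro conjI ballI allI impI)
      show "cfun.subspace (P l)" for l by (simp add: P_def subL)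
      show "harmonic_homogeneous k = {(\<Sum>l\<in>{..<2}. f l) |f. \<forall>l\<in>{..<2}. f l \<in> P l}"
      proof (intro equalityI subsetI)
        fix f :: "real^'n \<Rightarrow> complex" assume "f \<in> harmonic_homogeneous k"
        then obtain c d where f: "f = cscale c (z \<i> ^ k) + cscale d (z (- \<i>) ^ k)" using span by blast
        show "f \<in> {(\<Sum>l\<in>{..<2}. f l) |f. \<forall>l\<in>{..<2}. f l \<in> P l}"
          unfolding two f
          by (intro CollectI exI[of _ "\<lambda>l. if l = 0 then cscale c (z \<i> ^ k) else cscale d (z (- \<i>) ^ k)"])
             (auto simp: P_def L_def)
      next
        fix f assume "f \<in> {(\<Sum>l\<in>{..<2}. f l) |f. \<forall>l\<in>{..<2}. f l \<in> P l}"
        then obtain h h' where "f = h + h'" "h \<in> L \<i> k" "h' \<in> L (- \<i>) k"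
          unfolding two by (auto simp: P_def)
        then show "f \<in> harmonic_homogeneous k"
          using LH[of \<i> k] LH[of "- \<i>" k] by (auto intro!: cfun.subspace_add[OF subspace_harmonic_homogeneous])
      qed
      fix f l assume f: "(\<forall>l\<in>{..<2}. f l \<in> P l) \<and> (\<Sum>l\<in>{..<2}. f l) = 0" and l: "l \<in> {..<2::nat}"
      then obtain c d where cd: "f 0 = cscale c (z \<i> ^ k)" "f 1 = cscale d (z (- \<i>) ^ k)"
        unfolding two by (auto simp: P_def L_def)
      have "cscale c (z \<i> ^ k) + cscale d (z (- \<i>) ^ k) = 0" using f cd unfolding two by simp
      then have "c = 0 \<and> d = 0" using indep False by blast
      then show "f l = 0" using l cd unfolding two by auto
    qed simp
    moreover have "spherical rotations e1 (P l) \<and> P l \<noteq> {0}" for l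
      using sph[of \<i> k] sph[of "- \<i>" k] L0 by (simp add: P_def)
    ultimately show ?thesis by blast
  qed
  then show ?thesis using e(1) by blast
qed

text \<open>One base point serves all degrees, because \<open>spherical_equivalent\<close> compares
  pieces of different degrees along one orbit.\<close>

lemma spherical_pieces:
  "\<exists>e::real^'n. norm e = 1 \<and> (\<forall>k. \<exists>N P. direct_sum (harmonic_homogeneous k) {..<N::nat} P \<and>
    (\<forall>j<N. spherical rotations e (P j) \<and> P j \<noteq> {0}))"
proof (cases "CARD('n) = 2")
  case True
  then show ?thesis by (rule spherical_pieces_card_2)
next
  case False
  obtain e :: "real^'n" where "e \<in> Basis" using nonempty_Basis by blast
  then have e: "norm e = 1" by simp
  have "\<exists>N P. direct_sum (harmonic_homogeneous k) {..<N::nat} P \<and>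
    (\<forall>j<N. spherical rotations e (P j) \<and> P j \<noteq> {0})" for k
  proof (cases "harmonic_homogeneous k = {0 :: real^'n \<Rightarrow> complex}")
    \<comment> \<open>This happens on the line from degree 2 on. A zero space has no irreducible
      constituents, hence the empty family.\<close>
    case True
    then have "direct_sum (harmonic_homogeneous k) {..<0} (\<lambda>_::nat. {0 :: real^'n \<Rightarrow> complex})"
      by (auto simp: direct_sum_def)
    then show ?thesis by (intro exI[of _ 0] exI[of _ "\<lambda>_. {0}"]) simp
  next
    case nz: False
    have "direct_sum (harmonic_homogeneous k) {..<1} (\<lambda>_::nat. harmonic_homogeneous k :: (real^'n \<Rightarrow> complex) set)"
      by (rule direct_sum_single[OF subspace_harmonic_homogeneous])
    then show ?thesis
      using spherical_harmonic[OF False e] nz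
      by (intro exI[of _ 1] exI[of _ "\<lambda>_. harmonic_homogeneous k"]) auto
  qed
  then show ?thesis using e by blast
qed

section \<open>The multiplicity free decomposition\<close>

lemma lift_compose:
  fixes F :: "'a::euclidean_space \<times> 'b::euclidean_space \<Rightarrow> complex" and \<gamma> :: "'a \<Rightarrow> 'a" and \<delta> :: "'b \<Rightarrow> 'b"
  assumes "polynomial_function F" "orthogonal_transformation \<gamma>" "orthogonal_transformation \<delta>"
  shows "lift s (F \<circ> map_prod \<gamma> \<delta>) = lift s F \<circ> map_prod \<gamma> \<delta>"
proof -
  have eq: "nsq1 ^ s * (F \<circ> map_prod \<gamma> \<delta>) = (nsq1 ^ s * F) \<circ> map_prod \<gamma> \<delta>"
    by (auto simp: fun_eq_iff fapply nsq1_def nsq_orthogonal[OF assms(2)])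
  show ?thesis
    unfolding lift_def eq using assms
    by (intro harmonic_projection_orthogonal orthogonal_transformation_map_prod poly_intros polynomial_nsq1)
qed

lemma acts_by_block_action:
  "acts_by (SO \<times> SO) block_action
    (product_group rotations rotations :: ((real^'p) \<times> (real^'q) \<Rightarrow> _) set)"
proof -
  have inv: "matrix_inv A = transpose A" if "A \<in> SO" for A :: "real^'n^'n"
  proof -
    have "A ** matrix_inv A = mat 1 \<and> matrix_inv A ** A = mat 1"
      unfolding matrix_inv_def by (rule someI[of _ "transpose A"]) (simp add: SO_transpose(2,3)[OF that])
    then have "transpose A ** (A ** matrix_inv A) = transpose A" by simp
    then show ?thesis by (simp only: matrix_mul_assoc SO_transpose(3)[OF that] matrix_mul_lid)
  qed
  have act: "block_action (A, B) f = f \<circ> map_prod ((*v) (transpose A)) ((*v) (transpose B))"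
    if "A \<in> SO" "B \<in> SO" for A :: "real^'p^'p" and B :: "real^'q^'q" and f
    using that by (auto simp: block_action_def inv fun_eq_iff)
  show ?thesis
    unfolding acts_by_def
  proof (intro conjI ballI)
    fix g :: "(real^'p^'p) \<times> (real^'q^'q)" assume "g \<in> SO \<times> SO"
    then obtain A B where g: "g = (A, B)" "A \<in> SO" "B \<in> SO" by blast
    have "map_prod ((*v) (transpose A)) ((*v) (transpose B)) \<in> product_group rotations rotations"
      using SO_transpose(1)[OF g(2)] SO_transpose(1)[OF g(3)]
      unfolding product_group_def rotations_def by blast
    then show "\<exists>\<gamma>\<in>product_group rotations rotations. \<forall>f. block_action g f = f \<circ> \<gamma>"
      using act[OF g(2,3)] unfolding g(1) by blast
  next
    fix \<gamma> :: "(real^'p) \<times> (real^'q) \<Rightarrow> _" assume "\<gamma> \<in> product_group rotations rotations"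
    then obtain A B where g: "\<gamma> = map_prod ((*v) A) ((*v) B)" "A \<in> SO" "B \<in> SO"
      unfolding product_group_def rotations_def by blast
    have "block_action (transpose A, transpose B) f = f \<circ> \<gamma>" for f
      unfolding g(1) using act[OF SO_transpose(1)[OF g(2)] SO_transpose(1)[OF g(3)]] by simp
    then show "\<exists>g\<in>SO \<times> SO. \<forall>f. block_action g f = f \<circ> \<gamma>"
      using SO_transpose(1)[OF g(2)] SO_transpose(1)[OF g(3)] by blast
  qed
qed

text \<open>Freezing one variable at an orbit point where \<open>F\<close> is nonzero leaves nonzero
  harmonic functions of the other variable that agree on its orbit. In a factor of dimension at
  least two this fixes the degree. On a line the degree is at most 1 and is fixed by its parity,
  through the total degree \<open>n\<close>; for this the other factor must not be a line as
  well.\<close>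

lemma harmonic_tensor_orbit_degrees:
  fixes F F' :: "(real^'p) \<times> (real^'q) \<Rightarrow> complex"
  assumes card: "CARD('p) + CARD('q) \<ge> 3" and e: "norm e = 1" "norm e' = 1"
    and t: "(s, k, i) \<in> idx n" "(s', k', i') \<in> idx n"
    and F: "F \<in> harmonic_tensor k i" and F': "F' \<in> harmonic_tensor k' i'" and "F \<noteq> 0"
    and eq: "\<And>\<gamma> \<delta>. \<gamma> \<in> rotations \<Longrightarrow> \<delta> \<in> rotations \<Longrightarrow> F (\<gamma> e, \<delta> e') = F' (\<gamma> e, \<delta> e')"
  shows "(s, k, i) = (s', k', i') \<and> F = F'"
proof -
  note sub = subspace_harmonic_homogeneous
  have sep: "X = 0" if X: "X \<in> harmonic_tensor a b"
    and zero: "\<And>\<gamma> \<delta>. \<gamma> \<in> rotations \<Longrightarrow> \<delta> \<in> rotations \<Longrightarrow> X (\<gamma> e, \<delta> e') = 0" for X a b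
  proof -
    have "(\<lambda>u. X (u, \<delta> e')) = 0" if "\<delta> \<in> rotations" for \<delta>
      using zero that harmonic_homogeneousD(1)[OF tensor_space_section1[OF X sub]]
      by (intro harmonic_orbit_zero[OF e(1)])
    then have "X (u, \<delta> e') = 0" if "\<delta> \<in> rotations" for u \<delta>
      using that by (auto simp: fun_eq_iff fapply)
    then have "(\<lambda>v. X (u, v)) = 0" for u
      using harmonic_homogeneousD(1)[OF tensor_space_section2[OF X sub]]
      by (intro harmonic_orbit_zero[OF e(2)])
    then show ?thesis by (auto simp: fun_eq_iff fapply)
  qed
  obtain \<gamma>0 \<delta>0 where g0: "\<gamma>0 \<in> rotations" "\<delta>0 \<in> rotations" "F (\<gamma>0 e, \<delta>0 e') \<noteq> 0"
    using sep[OF F] \<open>F \<noteq> 0\<close> by blast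
  define f where "f = (\<lambda>u. F (u, \<delta>0 e'))"
  define f' where "f' = (\<lambda>u. F' (u, \<delta>0 e'))"
  define h where "h = (\<lambda>v. F (\<gamma>0 e, v))"
  define h' where "h' = (\<lambda>v. F' (\<gamma>0 e, v))"
  have f: "f \<in> harmonic_homogeneous k" "f' \<in> harmonic_homogeneous k'"
    unfolding f_def f'_def by (rule tensor_space_section1[OF F sub] tensor_space_section1[OF F' sub])+
  have h: "h \<in> harmonic_homogeneous i" "h' \<in> harmonic_homogeneous i'"
    unfolding h_def h'_def by (rule tensor_space_section2[OF F sub] tensor_space_section2[OF F' sub])+
  have val: "f (\<gamma>0 e) \<noteq> 0" "f' (\<gamma>0 e) \<noteq> 0" "h (\<delta>0 e') \<noteq> 0" "h' (\<delta>0 e') \<noteq> 0"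
    using g0 eq[OF g0(1,2)] by (simp_all add: f_def f'_def h_def h'_def)
  then have ne: "f \<noteq> 0" "f' \<noteq> 0" "h \<noteq> 0" "h' \<noteq> 0" by (auto simp: fapply)
  have feq: "f (\<gamma> e) = f' (\<gamma> e)" if "\<gamma> \<in> rotations" for \<gamma>
    using eq[OF that g0(2)] by (simp add: f_def f'_def)
  have heq: "h (\<delta> e') = h' (\<delta> e')" if "\<delta> \<in> rotations" for \<delta>
    using eq[OF g0(1) that] by (simp add: h_def h'_def)
  have p: "k = k'" if "CARD('p) \<ge> 2"
    by (rule harmonic_sphere_degree[OF that e(1) f _ ne(1)]) (rule feq)
  have q: "i = i'" if "CARD('q) \<ge> 2"
    by (rule harmonic_sphere_degree[OF that e(2) h _ ne(3)]) (rule heq)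
  have p1: "k \<le> 1 \<and> k' \<le> 1" if "CARD('p) = 1"
    using card_1_degree[OF that f(1) ne(1)] card_1_degree[OF that f(2) ne(2)] by simp
  have q1: "i \<le> 1 \<and> i' \<le> 1" if "CARD('q) = 1"
    using card_1_degree[OF that h(1) ne(3)] card_1_degree[OF that h(2) ne(4)] by simp
  have sum: "2 * s + k + i = n" "2 * s' + k' + i' = n" using t by (auto simp: idx_def)
  have "CARD('p) \<ge> 1" "CARD('q) \<ge> 1"
    using one_le_card_finite[where 'a = 'p] one_le_card_finite[where 'a = 'q] by simp_all
  then consider "CARD('p) \<ge> 2" "CARD('q) \<ge> 2" | "CARD('p) = 1" "CARD('q) \<ge> 2" | "CARD('p) \<ge> 2" "CARD('q) = 1"
    using card by linarith
  then have ski: "s = s' \<and> k = k' \<and> i = i'"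
  proof cases
    case 1
    then show ?thesis using p q sum by simp
  next
    case 2
    then show ?thesis using p1 q sum by presburger
  next
    case 3
    then show ?thesis using p q1 sum by presburger
  qed
  have "F - F' = 0"
  proof (rule sep)
    show "F - F' \<in> harmonic_tensor k i"
      using F F' ski by (intro cfun.subspace_diff[OF tensor_space_subspace]) auto
    show "(F - F') (\<gamma> e, \<delta> e') = 0" if "\<gamma> \<in> rotations" "\<delta> \<in> rotations" for \<gamma> \<delta>
      using eq[OF that] by (simp add: fapply)
  qed
  then show ?thesis using ski by simp
qed

lemma direct_sum_disjoint:
  assumes "direct_sum V J T" "p \<in> J" "p' \<in> J" "p \<noteq> p'" "f \<in> T p" "f \<in> T p'"
  shows "f = 0"
proof -
  note fin = direct_sumD(1)[OF assms(1)] and sub = direct_sumD(2)[OF assms(1)]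
  \<comment> \<open>Zero written as \<open>f\<close> in one summand plus \<open>- f\<close> in
    another.\<close>
  define h where "h q = (if q = p then f else 0) + (if q = p' then - f else 0)" for q
  have "h q \<in> T q" if "q \<in> J" for q
    using that assms cfun.subspace_0[OF sub] cfun.subspace_neg[OF sub] by (auto simp: h_def)
  moreover have "(\<Sum>q\<in>J. h q) = 0"
    using fin assms by (simp add: h_def sum.distrib)
  ultimately have "h p = 0" using direct_sumD(4)[OF assms(1), of h] assms(2) by blast
  then show ?thesis using assms(4) by (simp add: h_def)
qed

lemma tensor_space_nonzero:
  assumes "cfun.subspace A" "cfun.subspace B" "A \<noteq> {0}" "B \<noteq> {0}"
  shows "tensor_space A B \<noteq> {0}"
proof -
  obtain K where K: "K \<in> A" "K \<noteq> 0" using assms(3) cfun.subspace_0[OF assms(1)] by blast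
  obtain G where G: "G \<in> B" "G \<noteq> 0" using assms(4) cfun.subspace_0[OF assms(2)] by blast
  obtain u v where uv: "K u \<noteq> 0" "G v \<noteq> 0" using K(2) G(2) by (auto simp: fun_eq_iff fapply)
  show ?thesis
  proof
    assume "tensor_space A B = {0}"
    then have "(\<lambda>(u, v). K u * G v) = 0" using tensor_space_base[OF K(1) G(1)] by simp
    from fun_cong[OF this, of "(u, v)"] show False using uv by (simp add: fapply)
  qed
qed

theorem corollary7:
  fixes n :: nat
  assumes "CARD('p::finite) + CARD('q::finite) \<ge> 3"
  shows "multiplicity_free_decomposition (SO \<times> SO) block_action
    (harmonic_homogeneous n :: ((real^'p) \<times> (real^'q) \<Rightarrow> complex) set)
    {(s, k, i). 2 * s + k + i = n}
    (\<lambda>(s, k, i). tau_H ` tensor_space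
       (norm_power_mult s ` (harmonic_homogeneous k :: (real^'p \<Rightarrow> complex) set))
       (harmonic_homogeneous i :: (real^'q \<Rightarrow> complex) set))"
proof -
  let ?\<Gamma> = "product_group rotations rotations :: ((real^'p) \<times> (real^'q) \<Rightarrow> _) set"
  let ?G = "SO \<times> SO :: ((real^'p^'p) \<times> (real^'q^'q)) set"
  note act = acts_by_block_action[where 'p = 'p and 'q = 'q]
  have \<Gamma>: "isometry_group ?\<Gamma>" by (intro isometry_group_product isometry_group_rotations)
  obtain e :: "real^'p" where e: "norm e = 1" and "\<forall>k. \<exists>N P. direct_sum (harmonic_homogeneous k) {..<N::nat} P \<and>
      (\<forall>j<N. spherical rotations e (P j) \<and> P j \<noteq> {0})"
    using spherical_pieces by blast
  then obtain N1 P1 where P1: "\<And>k. direct_sum (harmonic_homogeneous k) {..<N1 k::nat} (P1 k)"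
    "\<And>k j. j < N1 k \<Longrightarrow> spherical rotations e (P1 k j) \<and> P1 k j \<noteq> {0}"
    by metis
  obtain e' :: "real^'q" where e': "norm e' = 1" and "\<forall>k. \<exists>N P. direct_sum (harmonic_homogeneous k) {..<N::nat} P \<and>
      (\<forall>j<N. spherical rotations e' (P j) \<and> P j \<noteq> {0})"
    using spherical_pieces by blast
  then obtain N2 P2 where P2: "\<And>k. direct_sum (harmonic_homogeneous k) {..<N2 k::nat} (P2 k)"
    "\<And>k j. j < N2 k \<Longrightarrow> spherical rotations e' (P2 k j) \<and> P2 k j \<noteq> {0}"
    by metis
  \<comment> \<open>The constituents before lifting: tensor products of the spherical pieces of the
    two factors, for each pair of degrees.\<close>
  define J where "J k i = {..<N1 k} \<times> {..<N2 i}" for k i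
  define C where "C k i = (\<lambda>(a, b). tensor_space (P1 k a) (P2 i b))" for k i
  have dsC: "direct_sum (harmonic_tensor k i) (J k i) (C k i)" for k i
    unfolding J_def C_def by (rule direct_sum_tensor_space[OF P1(1) P2(1)])
  have C_sub: "C k i p \<subseteq> harmonic_tensor k i" if "p \<in> J k i" for k i p
    by (rule subsetI, subst direct_sumD(3)[OF dsC],
        rule mem_sums_family[where U = "C k i", OF direct_sumD(1)[OF dsC] direct_sumD(2)[OF dsC] that])
  have C_sph: "spherical ?\<Gamma> (e, e') (C k i p)" and C_nz: "C k i p \<noteq> {0}" if p: "p \<in> J k i" for k i p
  proof -
    obtain a b where ab: "p = (a, b)" "a < N1 k" "b < N2 i" using p by (auto simp: J_def)
    have C: "C k i p = tensor_space (P1 k a) (P2 i b)" by (simp add: C_def ab(1))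
    note sph = conjunct1[OF P1(2)[OF ab(2)]] conjunct1[OF P2(2)[OF ab(3)]]
    show "spherical ?\<Gamma> (e, e') (C k i p)"
      unfolding C by (rule spherical_tensor_space[OF isometry_group_rotations isometry_group_rotations sph])
    show "C k i p \<noteq> {0}"
      unfolding C
      by (rule tensor_space_nonzero[OF sphericalD(1)[OF sph(1)] sphericalD(1)[OF sph(2)]
            conjunct2[OF P1(2)[OF ab(2)]] conjunct2[OF P2(2)[OF ab(3)]]])
  qed
  have C_hp: "C k i p \<subseteq> hpoly (k + i)" if "p \<in> J k i" for k i p
    using C_sub[OF that] harmonic_tensor_hpoly by blast
  have C_irr: "irreducible_subrep ?G block_action (C k i p)" if "p \<in> J k i" for k i p
    by (rule spherical_irreducible[OF act \<Gamma> C_sph C_hp C_nz]) (rule that)+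
  have lin: "linear_on_space (C k i p) (lift s)" if "p \<in> J k i" for s k i p
    using linear_on_space_subset[OF linear_on_space_lift_harmonic C_sub[OF that]] .
  have inj: "f = 0" if "p \<in> J k i" "f \<in> C k i p" "lift s f = 0" for s k i p f
    using lift_eq_0 C_sub that by blast
  have equi: "lift s (f \<circ> \<gamma>) = lift s f \<circ> \<gamma>" if "\<gamma> \<in> ?\<Gamma>" "f \<in> harmonic_tensor k i" for s k i f \<gamma>
    using that polynomial_hpoly[OF harmonic_tensor_hpoly[OF that(2)]]
    by (auto simp: product_group_def rotations_iff intro!: lift_compose)
  have equiC: "lift s (f \<circ> \<gamma>) = lift s f \<circ> \<gamma>" if "p \<in> J k i" "\<gamma> \<in> ?\<Gamma>" "f \<in> C k i p" for s k i p f \<gamma>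
    using equi[OF that(2)] C_sub[OF that(1)] that(3) by blast
  have irr: "irreducible_subrep ?G block_action (lift s ` C k i p)" if "p \<in> J k i" for s k i p
    by (rule irreducible_subrep_image[OF act lin[OF that] inj[OF that] equiC[OF that] C_irr[OF that]])
  have ineq: "(s, k, i) = (s', k', i') \<and> p = p'"
    if t: "(s, k, i) \<in> idx n" "(s', k', i') \<in> idx n" and p: "p \<in> J k i" "p' \<in> J k' i'"
      and eqv: "equivalent_subreps ?G block_action (lift s ` C k i p) (lift s' ` C k' i' p')"
    for s k i s' k' i' p p'
  proof -
    note subC = sphericalD(1)[OF C_sph[OF p(1)]] sphericalD(1)[OF C_sph[OF p(2)]]
    \<comment> \<open>The equivalence is pulled back along the two lifts. The comparison on orbits
      relies on harmonicity in each variable separately, which lifted functions need not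
      have.\<close>
    have 1: "equivalent_subreps ?G block_action (C k i p) (lift s ` C k i p)"
      by (rule equivalent_subreps_image[OF act lin[OF p(1)] subC(1) inj[OF p(1)] equiC[OF p(1)]])
    have "equivalent_subreps ?G block_action (C k' i' p') (lift s' ` C k' i' p')"
      by (rule equivalent_subreps_image[OF act lin[OF p(2)] subC(2) inj[OF p(2)] equiC[OF p(2)]])
    then have "equivalent_subreps ?G block_action (lift s' ` C k' i' p') (C k' i' p')"
      by (rule equivalent_subreps_sym) (use C_irr[OF p(2)] in \<open>simp add: irreducible_subrep_def\<close>)
    from equivalent_subreps_trans[OF 1 equivalent_subreps_trans[OF eqv this]]
    have eqvC: "equivalent_subreps ?G block_action (C k i p) (C k' i' p')" .
    obtain F F' where F: "F \<in> C k i p" "F' \<in> C k' i' p'" "F \<noteq> 0" "F' \<noteq> 0"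
      "\<forall>\<gamma>\<in>?\<Gamma>. F (\<gamma> (e, e')) = F' (\<gamma> (e, e'))"
      by (rule spherical_equivalent[OF act \<Gamma> C_sph[OF p(1)] C_hp[OF p(1)] C_nz[OF p(1)]
            C_sph[OF p(2)] eqvC])
    have orbit: "F (\<gamma> e, \<delta> e') = F' (\<gamma> e, \<delta> e')" if "\<gamma> \<in> rotations" "\<delta> \<in> rotations" for \<gamma> \<delta>
    proof -
      have "map_prod \<gamma> \<delta> \<in> ?\<Gamma>" using that by (auto simp: product_group_def)
      from bspec[OF F(5) this] show ?thesis by simp
    qed
    have FF': "(s, k, i) = (s', k', i') \<and> F = F'"
      by (rule harmonic_tensor_orbit_degrees[OF assms e e' t subsetD[OF C_sub[OF p(1)] F(1)]
            subsetD[OF C_sub[OF p(2)] F(2)] F(3)]) (rule orbit)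
    moreover have "p = p'"
    proof (rule ccontr)
      \<comment> \<open>The common function would be a nonzero element of two different summands of
        the direct sum \<open>dsC\<close>.\<close>
      assume "p \<noteq> p'"
      moreover have "p' \<in> J k i" "F \<in> C k i p'" using p(2) F(2) FF' by auto
      ultimately have "F = 0" using direct_sum_disjoint[OF dsC p(1) _ _ F(1)] by simp
      then show False using F(3) by simp
    qed
    ultimately show ?thesis by simp
  qed
  define U where "U = (\<lambda>(s, k, i). lift s ` (harmonic_tensor k i :: ((real^'p) \<times> (real^'q) \<Rightarrow> complex) set))"
  have U_eq: "(\<lambda>(s, k, i). tau_H ` tensor_space
       (norm_power_mult s ` (harmonic_homogeneous k :: (real^'p \<Rightarrow> complex) set))
       (harmonic_homogeneous i :: (real^'q \<Rightarrow> complex) set)) = U"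
    unfolding U_def by (auto simp: fun_eq_iff tau_H_image)
  have finJ: "finite (J k i)" for k i by (simp add: J_def)
  obtain b where b: "\<And>k i. bij_betw (b k i) {..<card (J k i)} (J k i)"
    using ex_bij_betw_nat_finite[OF finJ] unfolding atLeast0LessThan by metis
  define N where "N = (\<lambda>(s :: nat, k, i). card (J k i))"
  define W where "W = (\<lambda>(s :: nat, k, i) j. lift s ` C k i (b k i j))"
  have bJ: "b k i j \<in> J k i" if "j < card (J k i)" for k i j
    using b that by (auto simp: bij_betw_def)
  have dsU: "direct_sum (harmonic_homogeneous n) (idx n) U"
    unfolding U_def by (rule direct_sum_lift)
  have repU: "subrepresentation ?G block_action (U (s, k, i))" for s k i
    unfolding subrepresentation_iff[OF act]
  proof (intro conjI ballI)
    show "cfun.subspace (U (s, k, i))"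
      unfolding U_def prod.case
      by (rule subspace_image[OF linear_on_space_lift_harmonic tensor_space_subspace subset_refl])
    fix \<gamma> F assume g: "\<gamma> \<in> ?\<Gamma>" and "F \<in> U (s, k, i)"
    then obtain f where f: "f \<in> harmonic_tensor k i" "F = lift s f" by (auto simp: U_def)
    \<comment> \<open>Invariance of the whole tensor product is read off from its invariant
      pieces.\<close>
    have "f \<circ> \<gamma> \<in> harmonic_tensor k i"
    proof -
      obtain h where h: "f = (\<Sum>p\<in>J k i. h p)" "\<And>p. p \<in> J k i \<Longrightarrow> h p \<in> C k i p"
        using f(1) direct_sumD(3)[OF dsC] by blast
      have "f \<circ> \<gamma> = (\<Sum>p\<in>J k i. h p \<circ> \<gamma>)" by (simp add: fun_eq_iff fapply h(1))
      also have "\<dots> \<in> harmonic_tensor k i"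
        using h(2) sphericalD(2)[OF C_sph _ g] C_sub
        by (intro cfun.subspace_sum[OF tensor_space_subspace]) blast
      finally show ?thesis .
    qed
    then show "F \<circ> \<gamma> \<in> U (s, k, i)"
      unfolding f(2) U_def prod.case equi[OF g f(1), symmetric] by (rule imageI)
  qed
  have dsW: "direct_sum (U (s, k, i)) {..<N (s, k, i)} (W (s, k, i))" for s k i
  proof -
    have "direct_sum (lift s ` harmonic_tensor k i) (J k i) (\<lambda>p. lift s ` C k i p)"
      by (rule direct_sum_image[OF dsC tensor_space_subspace linear_on_space_lift_harmonic lift_eq_0])
    from direct_sum_reindex[OF this b] show ?thesis
      by (simp add: U_def N_def W_def comp_def)
  qed
  have irrW: "irreducible_subrep ?G block_action (W (s, k, i) j)" if "j < N (s, k, i)" for s k i j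
    using irr[OF bJ] that by (simp add: W_def N_def)
  have neqW: "\<not> equivalent_subreps ?G block_action (W t j) (W t' j')"
    if "t \<in> idx n" "t' \<in> idx n" "j < N t" "j' < N t'" "(t, j) \<noteq> (t', j')" for t t' j j'
  proof
    assume eqv: "equivalent_subreps ?G block_action (W t j) (W t' j')"
    obtain s k i s' k' i' where t: "t = (s, k, i)" "t' = (s', k', i')" by (cases t, cases t') auto
    have j: "j < card (J k i)" "j' < card (J k' i')" using that t by (auto simp: N_def)
    have eq: "(s, k, i) = (s', k', i') \<and> b k i j = b k' i' j'"
      using ineq[OF _ _ bJ[OF j(1)] bJ[OF j(2)]] that(1,2) eqv unfolding t W_def by simp
    then have "j = j'"
      using b[of k i] j by (auto simp: bij_betw_def inj_on_def)
    then show False using that(5) eq t by simp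
  qed
  show ?thesis
    unfolding multiplicity_free_decomposition_def U_eq idx_def[symmetric]
  proof (intro conjI)
    show "direct_sum (harmonic_homogeneous n) (idx n) U" by (rule dsU)
    show "\<forall>t\<in>idx n. subrepresentation ?G block_action (U t)" using repU by auto
    show "\<exists>(N :: nat \<times> nat \<times> nat \<Rightarrow> nat) W. (\<forall>t\<in>idx n. direct_sum (U t) {..<N t} (W t) \<and>
        (\<forall>j<N t. irreducible_subrep ?G block_action (W t j))) \<and>
      (\<forall>t\<in>idx n. \<forall>t'\<in>idx n. \<forall>j<N t. \<forall>j'<N t'. (t, j) \<noteq> (t', j') \<longrightarrow>
        \<not> equivalent_subreps ?G block_action (W t j) (W t' j'))"
    proof (rule exI[of _ N], rule exI[of _ W], intro conjI ballI allI impI)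
      show "direct_sum (U t) {..<N t} (W t)" for t by (cases t) (simp only: dsW)
      show "irreducible_subrep ?G block_action (W t j)" if "j < N t" for t j
        using that by (cases t) (simp only: irrW)
      show "\<not> equivalent_subreps ?G block_action (W t j) (W t' j')"
        if "t \<in> idx n" "t' \<in> idx n" "j < N t" "j' < N t'" "(t, j) \<noteq> (t', j')" for t t' j j'
        using that by (rule neqW)
    qed
  qed
qed

end
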